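(* Let $\mathcal V,\mathcal W$ be symmetric monoidal categories, $(\mathsf M,\mu,\eta,\nabla)$ a symmetric monoidal monad on $\mathcal W$, $F\colon\mathcal V\to\mathcal W$ a symmetric (lax) monoidal functor, $i\colon\mathcal U\hookrightarrow\mathcal W$ a full strict monoidal subcategory, and $\mathcal C$ a $\mathcal V$-category. There is an identity-on-objects 2-functor $$\iota\colon\mathcal C_0\to(\mathcal U/\mathsf MF)_*\mathcal C$$ that strictly preserves monoidal products and coherence maps (when $\mathcal C$ is a monoidal, respectively symmetric monoidal, $\mathcal V$-category). If the functor $F_*^0\colon\mathcal C_0\to(F_*\mathcal C)_0$ is faithful and post-composition by $\eta$ is faithful (i.e. $x\mapsto x;\eta_{F\mathcal C(X,Y)}$ is injective on $\mathcal W$-arrows $x\colon I_{\mathcal W}\to F\mathcal C(X,Y)$ for all objects $X,Y$), then $\iota$ is faithful.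
   Context: Composition is written in diagrammatic order: $f;g=g\circ f$. 2-categories are strict. $\mathsf{cat}$ is the category of small categories with Cartesian product, where "small" is relative to a universe for which the slices below are small; a $\mathsf{cat}$-enriched category is a 2-category. Enriched notions. For a symmetric monoidal category $(\mathcal V,\otimes,I)$, a $\mathcal V$-category has composition arrows $;_{\mathcal C}\colon\mathcal C(A,B)\otimes\mathcal C(B,C)\to\mathcal C(A,C)$ and identities $\mathsf{id}_A\colon I\to\mathcal C(A,A)$. Its underlying category $\mathcal C_0$ has the same objects, arrows $f\colon I\to\mathcal C(A,B)$, and composites $I\cong I\otimes I\xrightarrow{f\otimes g}\mathcal C(A,B)\otimes\mathcal C(B,C)\xrightarrow{;}\mathcal C(A,C)$; it is viewed as a 2-category with only identity 2-cells. The product $\mathcal C\otimes\mathcal D$ of $\mathcal V$-categories has pairs as objects and hom-objects $\mathcal C(A_1,B_1)\otimes\mathcal D(A_2,B_2)$. For a $\mathcal V$-functor $\boxtimes\colon\mathcal C\otimes\mathcal C\to\mathcal C$, $\bar\boxtimes_0\colon\mathcal C_0\times\mathcal C_0\to\mathcal C_0$ sends $(f_1,f_2)$ to $I\cong I\otimes I\xrightarrow{f_1\otimes f_2}\mathcal C(A_1,B_1)\otimes\mathcal C(A_2,B_2)\xrightarrow{\boxtimes}\mathcal C(A_1\boxtimes A_2,B_1\boxtimes B_2)$. A monoidal $\mathcal V$-category $(\mathcal C,\boxtimes,J)$ consists of a $\mathcal V$-category $\mathcal C$, a $\mathcal V$-functor $\boxtimes\colon\mathcal C\otimes\mathcal C\to\mathcal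 C$, an object $J$ and $\mathcal V$-natural isomorphisms with components $a_{A,B,C}\colon I\to\mathcal C((A\boxtimes B)\boxtimes C,A\boxtimes(B\boxtimes C))$, $r_A\colon I\to\mathcal C(A\boxtimes J,A)$, $l_A\colon I\to\mathcal C(J\boxtimes A,A)$ making $(\mathcal C_0,\bar\boxtimes_0,J)$ monoidal; it is symmetric if it has a $\mathcal V$-natural isomorphism $s_{A,B}\colon I\to\mathcal C(A\boxtimes B,B\boxtimes A)$ making $\mathcal C_0$ symmetric monoidal. The coherence maps are $a,r,l$ (and $s$ in the symmetric case). Lax monoidal functor $F\colon\mathcal V\to\mathcal W$: comes with $F_\epsilon\colon I_{\mathcal W}\to FI_{\mathcal V}$ and natural $\widetilde F_{A,B}\colon FA\otimes FB\to F(A\otimes B)$ satisfying associativity and unit laws; symmetric if $\widetilde F_{A,B};F\sigma=\sigma;\widetilde F_{B,A}$. $F_*\mathcal C$ is the $\mathcal W$-category with the objects of $\mathcal C$, hom-objects $F\mathcal C(A,B)$, composition $\widetilde F;F(;_{\mathcal C})$ and identities $F_\epsilon;F(\mathsf{id}_A)$. $F_*^0\colon\mathcal C_0\to(F_*\mathcal C)_0$ is the identity-on-objects functor $f\mapsto F_\epsilon;F(f)$. Symmetric monoidal monad: a monad $(\mathsf M,\mu,\eta)$ on $\mathcal W$ with morphisms $\nabla_{X,Y}\colon\mathsf MX\otimes\mathsf MY\to\mathsf M(X\otimes Y)$ natural in $X,Y$ making $\mathsf M$ a symmetric monoidal functor with unit $\eta_I$ and making $\mu,\eta$ monoidal transformations.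 Its Kleisli category $\mathsf{Kl}_{\mathsf M}$ is symmetric monoidal, with the product of objects as in $\mathcal W$ and the product of $f\colon A\to\mathsf MX$, $g\colon B\to\mathsf MY$ equal to $(f\otimes g);\nabla$. Full strict monoidal subcategory: a full subcategory $\mathcal U\subseteq\mathcal W$ containing $I_{\mathcal W}$ and closed under $\otimes$, which is a strict monoidal category with the inherited structure (associators and unitors at objects of $\mathcal U$ are identities), the inclusion being strict monoidal. The 2-category $(\mathcal U/\mathsf MF)_*\mathcal C$: it is the change of base of $\mathcal C$ along $\mathcal V\xrightarrow{F}\mathcal W\xrightarrow{\mathsf L_{\mathsf M}}\mathsf{Kl}_{\mathsf M}\xrightarrow{\mathcal U/(-)}\mathsf{cat}$, where $\mathsf L_{\mathsf M}$ is the identity on objects with $f\mapsto f;\eta$, and $\mathcal U/(-)$ sends $A$ to the category of $\mathsf{Kl}_{\mathsf M}$-arrows $U\to A$ with $U\in\mathrm{Ob}(\mathcal U)$ and commuting triangles of $\mathsf{Kl}_{\mathsf M}$-arrows between them. Explicitly: 0-cells are the objects of $\mathcal C$; 1-cells $X\to Y$ are $\mathsf{Kl}_{\mathsf M}$-arrows $f\colon U\to F\mathcal C(X,Y)$ with $U\in\mathrm{Ob}(\mathcal U)$; 2-cells from $f\colon U\to F\mathcal C(X,Y)$ to $g\colon V\to F\mathcal C(X,Y)$ are $\mathsf{Kl}_{\mathsf M}$-arrows $\varphi\colon U\to V$ with $f=\varphi;g$. Horizontal composition of 1-cells $f_1,f_2$ is the $\mathsf{Kl}_{\mathsf M}$-composite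 of $f_1\otimes f_2$ with $\widetilde F;F(;_{\mathcal C});\eta$, and of 2-cells is $\varphi_1\otimes\varphi_2$. The identity on $X$ is $F_\epsilon;F(\mathsf{id}_X);\eta$ with parameter object $I_{\mathcal W}$. When $\mathcal C$ is monoidal, the monoidal product is $\boxtimes$ on 0-cells, on 1-cells $f_i\colon U_i\to F\mathcal C(A_i,B_i)$ is the $\mathsf{Kl}_{\mathsf M}$-composite of $f_1\otimes f_2$ with $\widetilde F;F(\boxtimes);\eta$, and on 2-cells is $\varphi_1\otimes\varphi_2$; the unit is $J$; the coherence 1-cells are $F_\epsilon;F(c);\eta$ with $c$ a component of $a,r,l$ (or $s$). With this structure it is a monoidal (respectively symmetric monoidal) 2-category in which interchange (and naturality of the symmetry) hold up to coherent invertible 2-cells permuting the parameter objects. *)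

theory Defs
  imports Main
begin

section \<open>Categories and functors\<close>

text \<open>
  Hom-sets are families indexed by pairs of objects and are not required to be disjoint. Hence
  every operation on arrows carries the objects involved: \<open>cmp C A B D f g\<close> is the diagrammatic
  composite \<open>f ; g\<close> of \<open>f : A \<rightarrow> B\<close> and \<open>g : B \<rightarrow> D\<close>. In this way \<open>\<C>\<^sub>0\<close>, Kleisli categories and
  slices can use the arrows of the base category themselves, without tagging. Values of the
  operations outside the carriers are irrelevant.
\<close>

record ('o, 'm) cat =
  obj :: "'o set"
  hom :: "'o \<Rightarrow> 'o \<Rightarrow> 'm set"
  idn :: "'o \<Rightarrow> 'm"
  cmp :: "'o \<Rightarrow> 'o \<Rightarrow> 'o \<Rightarrow> 'm \<Rightarrow> 'm \<Rightarrow> 'm"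

locale category =
  fixes C :: "('o, 'm, 'x) cat_scheme"
  assumes idn_hom: "A \<in> obj C \<Longrightarrow> idn C A \<in> hom C A A"
    and cmp_hom: "\<lbrakk>A \<in> obj C; B \<in> obj C; D \<in> obj C; f \<in> hom C A B; g \<in> hom C B D\<rbrakk>
      \<Longrightarrow> cmp C A B D f g \<in> hom C A D"
    and idn_cmp: "\<lbrakk>A \<in> obj C; B \<in> obj C; f \<in> hom C A B\<rbrakk> \<Longrightarrow> cmp C A A B (idn C A) f = f"
    and cmp_idn: "\<lbrakk>A \<in> obj C; B \<in> obj C; f \<in> hom C A B\<rbrakk> \<Longrightarrow> cmp C A B B f (idn C B) = f"
    and cmp_assoc: "\<lbrakk>A \<in> obj C; B \<in> obj C; D \<in> obj C; E \<in> obj C;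
        f \<in> hom C A B; g \<in> hom C B D; h \<in> hom C D E\<rbrakk>
      \<Longrightarrow> cmp C A D E (cmp C A B D f g) h = cmp C A B E f (cmp C B D E g h)"

definition inverse_arrows :: "('o, 'm, 'x) cat_scheme \<Rightarrow> 'o \<Rightarrow> 'o \<Rightarrow> 'm \<Rightarrow> 'm \<Rightarrow> bool" where
  "inverse_arrows C A B f g \<longleftrightarrow> f \<in> hom C A B \<and> g \<in> hom C B A \<and>
     cmp C A B A f g = idn C A \<and> cmp C B A B g f = idn C B"

definition is_iso :: "('o, 'm, 'x) cat_scheme \<Rightarrow> 'o \<Rightarrow> 'o \<Rightarrow> 'm \<Rightarrow> bool" where
  "is_iso C A B f \<longleftrightarrow> (\<exists>g. inverse_arrows C A B f g)"

definition inv_arr :: "('o, 'm, 'x) cat_scheme \<Rightarrow> 'o \<Rightarrow> 'o \<Rightarrow> 'm \<Rightarrow> 'm" where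
  "inv_arr C A B f = (THE g. inverse_arrows C A B f g)"

record ('o1, 'm1, 'o2, 'm2) func =
  fobj :: "'o1 \<Rightarrow> 'o2"
  farr :: "'o1 \<Rightarrow> 'o1 \<Rightarrow> 'm1 \<Rightarrow> 'm2"

locale cat_functor = C: category C + D: category D
  for C :: "('o1, 'm1, 'x) cat_scheme" and D :: "('o2, 'm2, 'y) cat_scheme" +
  fixes F :: "('o1, 'm1, 'o2, 'm2, 'z) func_scheme"
  assumes fobj_obj: "A \<in> obj C \<Longrightarrow> fobj F A \<in> obj D"
    and farr_hom: "\<lbrakk>A \<in> obj C; B \<in> obj C; f \<in> hom C A B\<rbrakk>
      \<Longrightarrow> farr F A B f \<in> hom D (fobj F A) (fobj F B)"
    and farr_idn: "A \<in> obj C \<Longrightarrow> farr F A A (idn C A) = idn D (fobj F A)"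
    and farr_cmp: "\<lbrakk>A \<in> obj C; B \<in> obj C; E \<in> obj C; f \<in> hom C A B; g \<in> hom C B E\<rbrakk>
      \<Longrightarrow> farr F A E (cmp C A B E f g)
        = cmp D (fobj F A) (fobj F B) (fobj F E) (farr F A B f) (farr F B E g)"

definition faithful :: "('o1, 'm1, 'x) cat_scheme \<Rightarrow> ('o1, 'm1, 'o2, 'm2, 'z) func_scheme \<Rightarrow> bool" where
  "faithful C F \<longleftrightarrow> (\<forall>A\<in>obj C. \<forall>B\<in>obj C. inj_on (farr F A B) (hom C A B))"

definition prod_cat :: "('o1, 'm1, 'x) cat_scheme \<Rightarrow> ('o2, 'm2, 'y) cat_scheme
    \<Rightarrow> ('o1 \<times> 'o2, 'm1 \<times> 'm2) cat" where
  "prod_cat C D =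
    \<lparr>obj = obj C \<times> obj D,
     hom = (\<lambda>(A, A') (B, B'). hom C A B \<times> hom D A' B'),
     idn = (\<lambda>(A, A'). (idn C A, idn D A')),
     cmp = (\<lambda>(A, A') (B, B') (E, E') (f, f') (g, g'). (cmp C A B E f g, cmp D A' B' E' f' g'))\<rparr>"


section \<open>Symmetric monoidal categories\<close>

text \<open>
  \<open>tenA V A B A' B' f f'\<close> is the product of \<open>f : A \<rightarrow> B\<close> and \<open>f' : A' \<rightarrow> B'\<close>. The structure maps are
  \<open>massoc V A B D : (A \<otimes> B) \<otimes> D \<rightarrow> A \<otimes> (B \<otimes> D)\<close>, \<open>mrunit V A : A \<otimes> I \<rightarrow> A\<close>,
  \<open>mlunit V A : I \<otimes> A \<rightarrow> A\<close> and \<open>braid V A B : A \<otimes> B \<rightarrow> B \<otimes> A\<close>.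
\<close>

record ('o, 'm) moncat = "('o, 'm) cat" +
  munit :: "'o"
  tenO :: "'o \<Rightarrow> 'o \<Rightarrow> 'o"
  tenA :: "'o \<Rightarrow> 'o \<Rightarrow> 'o \<Rightarrow> 'o \<Rightarrow> 'm \<Rightarrow> 'm \<Rightarrow> 'm"
  massoc :: "'o \<Rightarrow> 'o \<Rightarrow> 'o \<Rightarrow> 'm"
  mrunit :: "'o \<Rightarrow> 'm"
  mlunit :: "'o \<Rightarrow> 'm"

record ('o, 'm) smc = "('o, 'm) moncat" +
  braid :: "'o \<Rightarrow> 'o \<Rightarrow> 'm"

locale monoidal_category = category V for V :: "('o, 'm, 'x) moncat_scheme" +
  assumes munit_obj: "munit V \<in> obj V"
    and tenO_obj: "\<lbrakk>A \<in> obj V; B \<in> obj V\<rbrakk> \<Longrightarrow> tenO V A B \<in> obj V"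
    and tenA_hom: "\<lbrakk>A \<in> obj V; B \<in> obj V; A' \<in> obj V; B' \<in> obj V; f \<in> hom V A B; f' \<in> hom V A' B'\<rbrakk>
      \<Longrightarrow> tenA V A B A' B' f f' \<in> hom V (tenO V A A') (tenO V B B')"
    and tenA_idn: "\<lbrakk>A \<in> obj V; A' \<in> obj V\<rbrakk>
      \<Longrightarrow> tenA V A A A' A' (idn V A) (idn V A') = idn V (tenO V A A')"
    and tenA_cmp: "\<lbrakk>A \<in> obj V; B \<in> obj V; D \<in> obj V; A' \<in> obj V; B' \<in> obj V; D' \<in> obj V;
        f \<in> hom V A B; g \<in> hom V B D; f' \<in> hom V A' B'; g' \<in> hom V B' D'\<rbrakk>
      \<Longrightarrow> tenA V A D A' D' (cmp V A B D f g) (cmp V A' B' D' f' g')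
        = cmp V (tenO V A A') (tenO V B B') (tenO V D D') (tenA V A B A' B' f f') (tenA V B D B' D' g g')"
    and massoc_iso: "\<lbrakk>A \<in> obj V; B \<in> obj V; D \<in> obj V\<rbrakk>
      \<Longrightarrow> is_iso V (tenO V (tenO V A B) D) (tenO V A (tenO V B D)) (massoc V A B D)"
    and mrunit_iso: "A \<in> obj V \<Longrightarrow> is_iso V (tenO V A (munit V)) A (mrunit V A)"
    and mlunit_iso: "A \<in> obj V \<Longrightarrow> is_iso V (tenO V (munit V) A) A (mlunit V A)"
    and massoc_natural: "\<lbrakk>A \<in> obj V; B \<in> obj V; D \<in> obj V; A' \<in> obj V; B' \<in> obj V; D' \<in> obj V;
        f \<in> hom V A A'; g \<in> hom V B B'; h \<in> hom V D D'\<rbrakk>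
      \<Longrightarrow> cmp V (tenO V (tenO V A B) D) (tenO V (tenO V A' B') D') (tenO V A' (tenO V B' D'))
            (tenA V (tenO V A B) (tenO V A' B') D D' (tenA V A A' B B' f g) h)
            (massoc V A' B' D')
        = cmp V (tenO V (tenO V A B) D) (tenO V A (tenO V B D)) (tenO V A' (tenO V B' D'))
            (massoc V A B D)
            (tenA V A A' (tenO V B D) (tenO V B' D') f (tenA V B B' D D' g h))"
    and mrunit_natural: "\<lbrakk>A \<in> obj V; B \<in> obj V; f \<in> hom V A B\<rbrakk>
      \<Longrightarrow> cmp V (tenO V A (munit V)) (tenO V B (munit V)) B
            (tenA V A B (munit V) (munit V) f (idn V (munit V))) (mrunit V B)
        = cmp V (tenO V A (munit V)) A B (mrunit V A) f"
    and mlunit_natural: "\<lbrakk>A \<in> obj V; B \<in> obj V; f \<in> hom V A B\<rbrakk>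
      \<Longrightarrow> cmp V (tenO V (munit V) A) (tenO V (munit V) B) B
            (tenA V (munit V) (munit V) A B (idn V (munit V)) f) (mlunit V B)
        = cmp V (tenO V (munit V) A) A B (mlunit V A) f"
    and pentagon: "\<lbrakk>A \<in> obj V; B \<in> obj V; D \<in> obj V; E \<in> obj V\<rbrakk>
      \<Longrightarrow> cmp V (tenO V (tenO V (tenO V A B) D) E) (tenO V (tenO V A B) (tenO V D E))
            (tenO V A (tenO V B (tenO V D E)))
            (massoc V (tenO V A B) D E) (massoc V A B (tenO V D E))
        = cmp V (tenO V (tenO V (tenO V A B) D) E) (tenO V (tenO V A (tenO V B D)) E)
            (tenO V A (tenO V B (tenO V D E)))
            (tenA V (tenO V (tenO V A B) D) (tenO V A (tenO V B D)) E E (massoc V A B D) (idn V E))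
            (cmp V (tenO V (tenO V A (tenO V B D)) E) (tenO V A (tenO V (tenO V B D) E))
              (tenO V A (tenO V B (tenO V D E)))
              (massoc V A (tenO V B D) E)
              (tenA V A A (tenO V (tenO V B D) E) (tenO V B (tenO V D E)) (idn V A) (massoc V B D E)))"
    and triangle: "\<lbrakk>A \<in> obj V; B \<in> obj V\<rbrakk>
      \<Longrightarrow> cmp V (tenO V (tenO V A (munit V)) B) (tenO V A (tenO V (munit V) B)) (tenO V A B)
            (massoc V A (munit V) B)
            (tenA V A A (tenO V (munit V) B) B (idn V A) (mlunit V B))
        = tenA V (tenO V A (munit V)) A B B (mrunit V A) (idn V B)"

locale symmetric_monoidal_category = monoidal_category V for V :: "('o, 'm, 'x) smc_scheme" +
  assumes braid_hom: "\<lbrakk>A \<in> obj V; B \<in> obj V\<rbrakk> \<Longrightarrow> braid V A B \<in> hom V (tenO V A B) (tenO V B A)"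
    and braid_natural: "\<lbrakk>A \<in> obj V; B \<in> obj V; A' \<in> obj V; B' \<in> obj V; f \<in> hom V A A'; g \<in> hom V B B'\<rbrakk>
      \<Longrightarrow> cmp V (tenO V A B) (tenO V A' B') (tenO V B' A') (tenA V A A' B B' f g) (braid V A' B')
        = cmp V (tenO V A B) (tenO V B A) (tenO V B' A') (braid V A B) (tenA V B B' A A' g f)"
    and braid_braid: "\<lbrakk>A \<in> obj V; B \<in> obj V\<rbrakk>
      \<Longrightarrow> cmp V (tenO V A B) (tenO V B A) (tenO V A B) (braid V A B) (braid V B A) = idn V (tenO V A B)"
    and hexagon: "\<lbrakk>A \<in> obj V; B \<in> obj V; D \<in> obj V\<rbrakk>
      \<Longrightarrow> cmp V (tenO V (tenO V A B) D) (tenO V A (tenO V B D)) (tenO V B (tenO V D A))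
            (massoc V A B D)
            (cmp V (tenO V A (tenO V B D)) (tenO V (tenO V B D) A) (tenO V B (tenO V D A))
              (braid V A (tenO V B D)) (massoc V B D A))
        = cmp V (tenO V (tenO V A B) D) (tenO V (tenO V B A) D) (tenO V B (tenO V D A))
            (tenA V (tenO V A B) (tenO V B A) D D (braid V A B) (idn V D))
            (cmp V (tenO V (tenO V B A) D) (tenO V B (tenO V A D)) (tenO V B (tenO V D A))
              (massoc V B A D)
              (tenA V B B (tenO V A D) (tenO V D A) (idn V B) (braid V A D)))"

definition unit_split :: "('o, 'm, 'x) moncat_scheme \<Rightarrow> 'm" \<comment> \<open>\<open>I \<rightarrow> I \<otimes> I\<close>\<close> where
  "unit_split V = inv_arr V (tenO V (munit V) (munit V)) (munit V) (mlunit V (munit V))"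

definition middle_swap :: "('o, 'm, 'x) smc_scheme \<Rightarrow> 'o \<Rightarrow> 'o \<Rightarrow> 'o \<Rightarrow> 'o \<Rightarrow> 'm"
  \<comment> \<open>\<open>(A \<otimes> B) \<otimes> (D \<otimes> E) \<rightarrow> (A \<otimes> D) \<otimes> (B \<otimes> E)\<close>\<close> where
  "middle_swap V A B D E =
    cmp V (tenO V (tenO V A B) (tenO V D E)) (tenO V A (tenO V B (tenO V D E)))
          (tenO V (tenO V A D) (tenO V B E))
      (massoc V A B (tenO V D E))
      (cmp V (tenO V A (tenO V B (tenO V D E))) (tenO V A (tenO V D (tenO V B E)))
             (tenO V (tenO V A D) (tenO V B E))
        (tenA V A A (tenO V B (tenO V D E)) (tenO V D (tenO V B E)) (idn V A)
          (cmp V (tenO V B (tenO V D E)) (tenO V (tenO V B D) E) (tenO V D (tenO V B E))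
            (inv_arr V (tenO V (tenO V B D) E) (tenO V B (tenO V D E)) (massoc V B D E))
            (cmp V (tenO V (tenO V B D) E) (tenO V (tenO V D B) E) (tenO V D (tenO V B E))
              (tenA V (tenO V B D) (tenO V D B) E E (braid V B D) (idn V E))
              (massoc V D B E))))
        (inv_arr V (tenO V (tenO V A D) (tenO V B E)) (tenO V A (tenO V D (tenO V B E)))
          (massoc V A D (tenO V B E))))"

definition full_strict_monoidal_subcategory :: "('o, 'm, 'x) moncat_scheme \<Rightarrow> 'o set \<Rightarrow> bool"
  \<comment> \<open>a full subcategory is given by its set of objects\<close> where
  "full_strict_monoidal_subcategory W U \<longleftrightarrow>
     U \<subseteq> obj W \<and> munit W \<in> U \<and> (\<forall>A\<in>U. \<forall>B\<in>U. tenO W A B \<in> U) \<and>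
     (\<forall>A\<in>U. \<forall>B\<in>U. \<forall>D\<in>U. tenO W (tenO W A B) D = tenO W A (tenO W B D) \<and>
        massoc W A B D = idn W (tenO W A (tenO W B D))) \<and>
     (\<forall>A\<in>U. tenO W A (munit W) = A \<and> mrunit W A = idn W A \<and>
        tenO W (munit W) A = A \<and> mlunit W A = idn W A)"


section \<open>Lax monoidal functors and symmetric monoidal monads\<close>

record ('o1, 'm1, 'o2, 'm2) laxfunc = "('o1, 'm1, 'o2, 'm2) func" +
  feps :: "'m2"                    \<comment> \<open>\<open>F\<^sub>\<epsilon> : I \<rightarrow> F I\<close>\<close>
  fmul :: "'o1 \<Rightarrow> 'o1 \<Rightarrow> 'm2"       \<comment> \<open>\<open>F A \<otimes> F B \<rightarrow> F (A \<otimes> B)\<close>\<close>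

locale lax_monoidal_functor =
  V: monoidal_category V + W: monoidal_category W + cat_functor V W F
  for V :: "('o1, 'm1, 'x) moncat_scheme" and W :: "('o2, 'm2, 'y) moncat_scheme"
    and F :: "('o1, 'm1, 'o2, 'm2, 'z) laxfunc_scheme" +
  assumes feps_hom: "feps F \<in> hom W (munit W) (fobj F (munit V))"
    and fmul_hom: "\<lbrakk>A \<in> obj V; B \<in> obj V\<rbrakk>
      \<Longrightarrow> fmul F A B \<in> hom W (tenO W (fobj F A) (fobj F B)) (fobj F (tenO V A B))"
    and fmul_natural: "\<lbrakk>A \<in> obj V; B \<in> obj V; A' \<in> obj V; B' \<in> obj V; f \<in> hom V A A'; g \<in> hom V B B'\<rbrakk>
      \<Longrightarrow> cmp W (tenO W (fobj F A) (fobj F B)) (tenO W (fobj F A') (fobj F B')) (fobj F (tenO V A' B'))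
            (tenA W (fobj F A) (fobj F A') (fobj F B) (fobj F B') (farr F A A' f) (farr F B B' g))
            (fmul F A' B')
        = cmp W (tenO W (fobj F A) (fobj F B)) (fobj F (tenO V A B)) (fobj F (tenO V A' B'))
            (fmul F A B)
            (farr F (tenO V A B) (tenO V A' B') (tenA V A A' B B' f g))"
    and fmul_assoc: "\<lbrakk>A \<in> obj V; B \<in> obj V; D \<in> obj V\<rbrakk>
      \<Longrightarrow> cmp W (tenO W (tenO W (fobj F A) (fobj F B)) (fobj F D)) (tenO W (fobj F (tenO V A B)) (fobj F D))
              (fobj F (tenO V A (tenO V B D)))
            (tenA W (tenO W (fobj F A) (fobj F B)) (fobj F (tenO V A B)) (fobj F D) (fobj F D)
              (fmul F A B) (idn W (fobj F D)))
            (cmp W (tenO W (fobj F (tenO V A B)) (fobj F D)) (fobj F (tenO V (tenO V A B) D))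
                (fobj F (tenO V A (tenO V B D)))
              (fmul F (tenO V A B) D)
              (farr F (tenO V (tenO V A B) D) (tenO V A (tenO V B D)) (massoc V A B D)))
        = cmp W (tenO W (tenO W (fobj F A) (fobj F B)) (fobj F D)) (tenO W (fobj F A) (tenO W (fobj F B) (fobj F D)))
              (fobj F (tenO V A (tenO V B D)))
            (massoc W (fobj F A) (fobj F B) (fobj F D))
            (cmp W (tenO W (fobj F A) (tenO W (fobj F B) (fobj F D))) (tenO W (fobj F A) (fobj F (tenO V B D)))
                (fobj F (tenO V A (tenO V B D)))
              (tenA W (fobj F A) (fobj F A) (tenO W (fobj F B) (fobj F D)) (fobj F (tenO V B D))
                (idn W (fobj F A)) (fmul F B D))
              (fmul F A (tenO V B D)))"
    and fmul_runit: "A \<in> obj V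
      \<Longrightarrow> cmp W (tenO W (fobj F A) (munit W)) (tenO W (fobj F A) (fobj F (munit V))) (fobj F A)
            (tenA W (fobj F A) (fobj F A) (munit W) (fobj F (munit V)) (idn W (fobj F A)) (feps F))
            (cmp W (tenO W (fobj F A) (fobj F (munit V))) (fobj F (tenO V A (munit V))) (fobj F A)
              (fmul F A (munit V))
              (farr F (tenO V A (munit V)) A (mrunit V A)))
        = mrunit W (fobj F A)"
    and fmul_lunit: "A \<in> obj V
      \<Longrightarrow> cmp W (tenO W (munit W) (fobj F A)) (tenO W (fobj F (munit V)) (fobj F A)) (fobj F A)
            (tenA W (munit W) (fobj F (munit V)) (fobj F A) (fobj F A) (feps F) (idn W (fobj F A)))
            (cmp W (tenO W (fobj F (munit V)) (fobj F A)) (fobj F (tenO V (munit V) A)) (fobj F A)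
              (fmul F (munit V) A)
              (farr F (tenO V (munit V) A) A (mlunit V A)))
        = mlunit W (fobj F A)"

locale symmetric_monoidal_functor =
  V: symmetric_monoidal_category V + W: symmetric_monoidal_category W + lax_monoidal_functor V W F
  for V :: "('o1, 'm1, 'x) smc_scheme" and W :: "('o2, 'm2, 'y) smc_scheme"
    and F :: "('o1, 'm1, 'o2, 'm2, 'z) laxfunc_scheme" +
  assumes fmul_braid: "\<lbrakk>A \<in> obj V; B \<in> obj V\<rbrakk>
      \<Longrightarrow> cmp W (tenO W (fobj F A) (fobj F B)) (fobj F (tenO V A B)) (fobj F (tenO V B A))
            (fmul F A B) (farr F (tenO V A B) (tenO V B A) (braid V A B))
        = cmp W (tenO W (fobj F A) (fobj F B)) (tenO W (fobj F B) (fobj F A)) (fobj F (tenO V B A))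
            (braid W (fobj F A) (fobj F B)) (fmul F B A)"

definition lax_id :: "('o, 'm, 'x) moncat_scheme \<Rightarrow> ('o, 'm, 'o, 'm) laxfunc" where
  "lax_id W = \<lparr>fobj = (\<lambda>A. A), farr = (\<lambda>A B f. f), feps = idn W (munit W), fmul = (\<lambda>A B. idn W (tenO W A B))\<rparr>"

text \<open>\<open>lax_comp V W X F G\<close> is the composite \<open>F ; G\<close> of \<open>F : V \<rightarrow> W\<close> and \<open>G : W \<rightarrow> X\<close>.\<close>

definition lax_comp :: "('o1, 'm1, 'x) moncat_scheme \<Rightarrow> ('o2, 'm2, 'x2) moncat_scheme \<Rightarrow> ('o3, 'm3, 'y) moncat_scheme
    \<Rightarrow> ('o1, 'm1, 'o2, 'm2) laxfunc \<Rightarrow> ('o2, 'm2, 'o3, 'm3) laxfunc \<Rightarrow> ('o1, 'm1, 'o3, 'm3) laxfunc" where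
  "lax_comp V W X F G =
    \<lparr>fobj = (\<lambda>A. fobj G (fobj F A)),
     farr = (\<lambda>A B f. farr G (fobj F A) (fobj F B) (farr F A B f)),
     feps = cmp X (munit X) (fobj G (munit W)) (fobj G (fobj F (munit V)))
       (feps G) (farr G (munit W) (fobj F (munit V)) (feps F)),
     fmul = (\<lambda>A B. cmp X (tenO X (fobj G (fobj F A)) (fobj G (fobj F B)))
         (fobj G (tenO W (fobj F A) (fobj F B))) (fobj G (fobj F (tenO V A B)))
       (fmul G (fobj F A) (fobj F B))
       (farr G (tenO W (fobj F A) (fobj F B)) (fobj F (tenO V A B)) (fmul F A B)))\<rparr>"

locale monoidal_transformation =
  fixes V :: "('o1, 'm1, 'x) moncat_scheme" and W :: "('o2, 'm2, 'y) moncat_scheme"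
    and F G :: "('o1, 'm1, 'o2, 'm2) laxfunc" and \<alpha> :: "'o1 \<Rightarrow> 'm2"
  assumes component_hom: "A \<in> obj V \<Longrightarrow> \<alpha> A \<in> hom W (fobj F A) (fobj G A)"
    and natural: "\<lbrakk>A \<in> obj V; B \<in> obj V; f \<in> hom V A B\<rbrakk>
      \<Longrightarrow> cmp W (fobj F A) (fobj F B) (fobj G B) (farr F A B f) (\<alpha> B)
        = cmp W (fobj F A) (fobj G A) (fobj G B) (\<alpha> A) (farr G A B f)"
    and monoidal_unit: "cmp W (munit W) (fobj F (munit V)) (fobj G (munit V)) (feps F) (\<alpha> (munit V)) = feps G"
    and monoidal_product: "\<lbrakk>A \<in> obj V; B \<in> obj V\<rbrakk>
      \<Longrightarrow> cmp W (tenO W (fobj F A) (fobj F B)) (fobj F (tenO V A B)) (fobj G (tenO V A B))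
            (fmul F A B) (\<alpha> (tenO V A B))
        = cmp W (tenO W (fobj F A) (fobj F B)) (tenO W (fobj G A) (fobj G B)) (fobj G (tenO V A B))
            (tenA W (fobj F A) (fobj G A) (fobj F B) (fobj G B) (\<alpha> A) (\<alpha> B)) (fmul G A B)"

record ('o, 'm) monad = "('o, 'm, 'o, 'm) func" +
  mu :: "'o \<Rightarrow> 'm"                  \<comment> \<open>\<open>M (M A) \<rightarrow> M A\<close>\<close>
  eta :: "'o \<Rightarrow> 'm"                 \<comment> \<open>\<open>A \<rightarrow> M A\<close>\<close>
  nabla :: "'o \<Rightarrow> 'o \<Rightarrow> 'm"         \<comment> \<open>\<open>M A \<otimes> M B \<rightarrow> M (A \<otimes> B)\<close>\<close>

definition monad_lax :: "('o, 'm, 'x) moncat_scheme \<Rightarrow> ('o, 'm) monad \<Rightarrow> ('o, 'm, 'o, 'm) laxfunc" where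
  "monad_lax W M = \<lparr>fobj = fobj M, farr = farr M, feps = eta M (munit W), fmul = nabla M\<rparr>"

locale symmetric_monoidal_monad =
  symmetric_monoidal_functor W W "monad_lax W M" +
  unit: monoidal_transformation W W "lax_id W" "monad_lax W M" "eta M" +
  mult: monoidal_transformation W W "lax_comp W W W (monad_lax W M) (monad_lax W M)" "monad_lax W M" "mu M"
  for W :: "('o, 'm, 'x) smc_scheme" and M :: "('o, 'm) monad" +
  assumes eta_mu: "A \<in> obj W
      \<Longrightarrow> cmp W (fobj M A) (fobj M (fobj M A)) (fobj M A) (eta M (fobj M A)) (mu M A) = idn W (fobj M A)"
    and M_eta_mu: "A \<in> obj W
      \<Longrightarrow> cmp W (fobj M A) (fobj M (fobj M A)) (fobj M A) (farr M A (fobj M A) (eta M A)) (mu M A)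
        = idn W (fobj M A)"
    and mu_mu: "A \<in> obj W
      \<Longrightarrow> cmp W (fobj M (fobj M (fobj M A))) (fobj M (fobj M A)) (fobj M A) (mu M (fobj M A)) (mu M A)
        = cmp W (fobj M (fobj M (fobj M A))) (fobj M (fobj M A)) (fobj M A)
            (farr M (fobj M (fobj M A)) (fobj M A) (mu M A)) (mu M A)"

definition kl_lift :: "('o, 'm, 'x) moncat_scheme \<Rightarrow> ('o, 'm) monad \<Rightarrow> 'o \<Rightarrow> 'o \<Rightarrow> 'm \<Rightarrow> 'm"
  \<comment> \<open>the action of \<open>L\<^sub>M : \<W> \<rightarrow> Kl\<^sub>M\<close> on an arrow \<open>f : A \<rightarrow> B\<close>\<close> where
  "kl_lift W M A B f = cmp W A B (fobj M B) f (eta M B)"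

definition kleisli :: "('o, 'm, 'x) smc_scheme \<Rightarrow> ('o, 'm) monad \<Rightarrow> ('o, 'm) smc" where
  "kleisli W M =
    \<lparr>obj = obj W,
     hom = (\<lambda>A B. hom W A (fobj M B)),
     idn = eta M,
     cmp = (\<lambda>A B D f g. cmp W A (fobj M B) (fobj M D) f
       (cmp W (fobj M B) (fobj M (fobj M D)) (fobj M D) (farr M B (fobj M D) g) (mu M D))),
     munit = munit W,
     tenO = tenO W,
     tenA = (\<lambda>A B A' B' f f'. cmp W (tenO W A A') (tenO W (fobj M B) (fobj M B')) (fobj M (tenO W B B'))
       (tenA W A (fobj M B) A' (fobj M B') f f') (nabla M B B')),
     massoc = (\<lambda>A B D. kl_lift W M (tenO W (tenO W A B) D) (tenO W A (tenO W B D)) (massoc W A B D)),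
     mrunit = (\<lambda>A. kl_lift W M (tenO W A (munit W)) A (mrunit W A)),
     mlunit = (\<lambda>A. kl_lift W M (tenO W (munit W) A) A (mlunit W A)),
     braid = (\<lambda>A B. kl_lift W M (tenO W A B) (tenO W B A) (braid W A B))\<rparr>"


section \<open>Enriched categories\<close>

text \<open>\<open>'a\<close> is the type of objects; \<open>'v\<close> and \<open>'m\<close> are the types of objects and arrows of the base.\<close>

record ('a, 'v, 'm) ecat =
  eobj :: "'a set"
  ehom :: "'a \<Rightarrow> 'a \<Rightarrow> 'v"
  ecomp :: "'a \<Rightarrow> 'a \<Rightarrow> 'a \<Rightarrow> 'm"
  eid :: "'a \<Rightarrow> 'm"

locale enriched_category = V: monoidal_category V for V :: "('v, 'm, 'x) moncat_scheme" +
  fixes C :: "('a, 'v, 'm) ecat"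
  assumes ehom_obj: "\<lbrakk>X \<in> eobj C; Y \<in> eobj C\<rbrakk> \<Longrightarrow> ehom C X Y \<in> obj V"
    and ecomp_hom: "\<lbrakk>X \<in> eobj C; Y \<in> eobj C; Z \<in> eobj C\<rbrakk>
      \<Longrightarrow> ecomp C X Y Z \<in> hom V (tenO V (ehom C X Y) (ehom C Y Z)) (ehom C X Z)"
    and eid_hom: "X \<in> eobj C \<Longrightarrow> eid C X \<in> hom V (munit V) (ehom C X X)"
    and ecomp_assoc: "\<lbrakk>X \<in> eobj C; Y \<in> eobj C; Z \<in> eobj C; T \<in> eobj C\<rbrakk>
      \<Longrightarrow> cmp V (tenO V (tenO V (ehom C X Y) (ehom C Y Z)) (ehom C Z T)) (tenO V (ehom C X Z) (ehom C Z T))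
              (ehom C X T)
            (tenA V (tenO V (ehom C X Y) (ehom C Y Z)) (ehom C X Z) (ehom C Z T) (ehom C Z T)
              (ecomp C X Y Z) (idn V (ehom C Z T)))
            (ecomp C X Z T)
        = cmp V (tenO V (tenO V (ehom C X Y) (ehom C Y Z)) (ehom C Z T))
              (tenO V (ehom C X Y) (tenO V (ehom C Y Z) (ehom C Z T))) (ehom C X T)
            (massoc V (ehom C X Y) (ehom C Y Z) (ehom C Z T))
            (cmp V (tenO V (ehom C X Y) (tenO V (ehom C Y Z) (ehom C Z T))) (tenO V (ehom C X Y) (ehom C Y T))
                (ehom C X T)
              (tenA V (ehom C X Y) (ehom C X Y) (tenO V (ehom C Y Z) (ehom C Z T)) (ehom C Y T)
                (idn V (ehom C X Y)) (ecomp C Y Z T))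
              (ecomp C X Y T))"
    and eid_ecomp: "\<lbrakk>X \<in> eobj C; Y \<in> eobj C\<rbrakk>
      \<Longrightarrow> cmp V (tenO V (munit V) (ehom C X Y)) (tenO V (ehom C X X) (ehom C X Y)) (ehom C X Y)
            (tenA V (munit V) (ehom C X X) (ehom C X Y) (ehom C X Y) (eid C X) (idn V (ehom C X Y)))
            (ecomp C X X Y)
        = mlunit V (ehom C X Y)"
    and ecomp_eid: "\<lbrakk>X \<in> eobj C; Y \<in> eobj C\<rbrakk>
      \<Longrightarrow> cmp V (tenO V (ehom C X Y) (munit V)) (tenO V (ehom C X Y) (ehom C Y Y)) (ehom C X Y)
            (tenA V (ehom C X Y) (ehom C X Y) (munit V) (ehom C Y Y) (idn V (ehom C X Y)) (eid C Y))
            (ecomp C X Y Y)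
        = mrunit V (ehom C X Y)"

definition underlying :: "('v, 'm, 'x) moncat_scheme \<Rightarrow> ('a, 'v, 'm) ecat \<Rightarrow> ('a, 'm) cat" where
  "underlying V C =
    \<lparr>obj = eobj C,
     hom = (\<lambda>X Y. hom V (munit V) (ehom C X Y)),
     idn = eid C,
     cmp = (\<lambda>X Y Z f g. cmp V (munit V) (tenO V (munit V) (munit V)) (ehom C X Z) (unit_split V)
       (cmp V (tenO V (munit V) (munit V)) (tenO V (ehom C X Y) (ehom C Y Z)) (ehom C X Z)
         (tenA V (munit V) (ehom C X Y) (munit V) (ehom C Y Z) f g)
         (ecomp C X Y Z)))\<rparr>"

definition eprod :: "('v, 'm, 'x) smc_scheme \<Rightarrow> ('a, 'v, 'm) ecat \<Rightarrow> ('b, 'v, 'm) ecat \<Rightarrow> ('a \<times> 'b, 'v, 'm) ecat" where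
  "eprod V C D =
    \<lparr>eobj = eobj C \<times> eobj D,
     ehom = (\<lambda>(X, X') (Y, Y'). tenO V (ehom C X Y) (ehom D X' Y')),
     ecomp = (\<lambda>(X, X') (Y, Y') (Z, Z').
       cmp V (tenO V (tenO V (ehom C X Y) (ehom D X' Y')) (tenO V (ehom C Y Z) (ehom D Y' Z')))
             (tenO V (tenO V (ehom C X Y) (ehom C Y Z)) (tenO V (ehom D X' Y') (ehom D Y' Z')))
             (tenO V (ehom C X Z) (ehom D X' Z'))
         (middle_swap V (ehom C X Y) (ehom D X' Y') (ehom C Y Z) (ehom D Y' Z'))
         (tenA V (tenO V (ehom C X Y) (ehom C Y Z)) (ehom C X Z)
                 (tenO V (ehom D X' Y') (ehom D Y' Z')) (ehom D X' Z')
           (ecomp C X Y Z) (ecomp D X' Y' Z'))),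
     eid = (\<lambda>(X, X').
       cmp V (munit V) (tenO V (munit V) (munit V)) (tenO V (ehom C X X) (ehom D X' X'))
         (unit_split V)
         (tenA V (munit V) (ehom C X X) (munit V) (ehom D X' X') (eid C X) (eid D X')))\<rparr>"

record ('a, 'b, 'm) efunc =
  efobj :: "'a \<Rightarrow> 'b"
  efarr :: "'a \<Rightarrow> 'a \<Rightarrow> 'm"

locale enriched_functor = C: enriched_category V C + D: enriched_category V D
  for V :: "('v, 'm, 'x) moncat_scheme" and C :: "('a, 'v, 'm) ecat" and D :: "('b, 'v, 'm) ecat" +
  fixes F :: "('a, 'b, 'm) efunc"
  assumes efobj_obj: "X \<in> eobj C \<Longrightarrow> efobj F X \<in> eobj D"
    and efarr_hom: "\<lbrakk>X \<in> eobj C; Y \<in> eobj C\<rbrakk>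
      \<Longrightarrow> efarr F X Y \<in> hom V (ehom C X Y) (ehom D (efobj F X) (efobj F Y))"
    and efarr_ecomp: "\<lbrakk>X \<in> eobj C; Y \<in> eobj C; Z \<in> eobj C\<rbrakk>
      \<Longrightarrow> cmp V (tenO V (ehom C X Y) (ehom C Y Z)) (ehom C X Z) (ehom D (efobj F X) (efobj F Z))
            (ecomp C X Y Z) (efarr F X Z)
        = cmp V (tenO V (ehom C X Y) (ehom C Y Z))
              (tenO V (ehom D (efobj F X) (efobj F Y)) (ehom D (efobj F Y) (efobj F Z)))
              (ehom D (efobj F X) (efobj F Z))
            (tenA V (ehom C X Y) (ehom D (efobj F X) (efobj F Y)) (ehom C Y Z) (ehom D (efobj F Y) (efobj F Z))
              (efarr F X Y) (efarr F Y Z))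
            (ecomp D (efobj F X) (efobj F Y) (efobj F Z))"
    and efarr_eid: "X \<in> eobj C
      \<Longrightarrow> cmp V (munit V) (ehom C X X) (ehom D (efobj F X) (efobj F X)) (eid C X) (efarr F X X)
        = eid D (efobj F X)"

definition enriched_natural_iso :: "('v, 'm, 'x) moncat_scheme \<Rightarrow> ('a, 'v, 'm) ecat \<Rightarrow> ('b, 'v, 'm) ecat
    \<Rightarrow> ('a, 'b, 'm) efunc \<Rightarrow> ('a, 'b, 'm) efunc \<Rightarrow> ('a \<Rightarrow> 'm) \<Rightarrow> bool" where
  "enriched_natural_iso V C D F G \<alpha> \<longleftrightarrow>
     (\<forall>X\<in>eobj C. is_iso (underlying V D) (efobj F X) (efobj G X) (\<alpha> X)) \<and>
     (\<forall>X\<in>eobj C. \<forall>Y\<in>eobj C.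
        cmp V (ehom C X Y) (tenO V (munit V) (ehom C X Y)) (ehom D (efobj F X) (efobj G Y))
          (inv_arr V (tenO V (munit V) (ehom C X Y)) (ehom C X Y) (mlunit V (ehom C X Y)))
          (cmp V (tenO V (munit V) (ehom C X Y))
              (tenO V (ehom D (efobj F X) (efobj G X)) (ehom D (efobj G X) (efobj G Y)))
              (ehom D (efobj F X) (efobj G Y))
            (tenA V (munit V) (ehom D (efobj F X) (efobj G X)) (ehom C X Y) (ehom D (efobj G X) (efobj G Y))
              (\<alpha> X) (efarr G X Y))
            (ecomp D (efobj F X) (efobj G X) (efobj G Y)))
      = cmp V (ehom C X Y) (tenO V (ehom C X Y) (munit V)) (ehom D (efobj F X) (efobj G Y))
          (inv_arr V (tenO V (ehom C X Y) (munit V)) (ehom C X Y) (mrunit V (ehom C X Y)))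
          (cmp V (tenO V (ehom C X Y) (munit V))
              (tenO V (ehom D (efobj F X) (efobj F Y)) (ehom D (efobj F Y) (efobj G Y)))
              (ehom D (efobj F X) (efobj G Y))
            (tenA V (ehom C X Y) (ehom D (efobj F X) (efobj F Y)) (munit V) (ehom D (efobj F Y) (efobj G Y))
              (efarr F X Y) (\<alpha> Y))
            (ecomp D (efobj F X) (efobj F Y) (efobj G Y))))"


section \<open>Monoidal enriched categories\<close>

text \<open>
  The monoidal structure on an enriched category is kept in a record of its own.
  \<open>etenA S A\<^sub>1 B\<^sub>1 A\<^sub>2 B\<^sub>2 : \<C>(A\<^sub>1,B\<^sub>1) \<otimes> \<C>(A\<^sub>2,B\<^sub>2) \<rightarrow> \<C>(A\<^sub>1 \<boxtimes> A\<^sub>2, B\<^sub>1 \<boxtimes> B\<^sub>2)\<close>.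
\<close>

record ('a, 'm) emon =
  etenO :: "'a \<Rightarrow> 'a \<Rightarrow> 'a"
  etenA :: "'a \<Rightarrow> 'a \<Rightarrow> 'a \<Rightarrow> 'a \<Rightarrow> 'm"
  eunit :: "'a"
  eassoc :: "'a \<Rightarrow> 'a \<Rightarrow> 'a \<Rightarrow> 'm"
  erunit :: "'a \<Rightarrow> 'm"
  elunit :: "'a \<Rightarrow> 'm"

record ('a, 'm) esmon = "('a, 'm) emon" +
  esym :: "'a \<Rightarrow> 'a \<Rightarrow> 'm"

definition underlying_mon :: "('v, 'm, 'x) moncat_scheme \<Rightarrow> ('a, 'v, 'm) ecat \<Rightarrow> ('a, 'm, 'y) emon_scheme
    \<Rightarrow> ('a, 'm) moncat" where
  "underlying_mon V C S =
    \<lparr>obj = obj (underlying V C), hom = hom (underlying V C), idn = idn (underlying V C), cmp = cmp (underlying V C),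
     munit = eunit S,
     tenO = etenO S,
     tenA = (\<lambda>A1 B1 A2 B2 f1 f2.
       cmp V (munit V) (tenO V (munit V) (munit V)) (ehom C (etenO S A1 A2) (etenO S B1 B2)) (unit_split V)
         (cmp V (tenO V (munit V) (munit V)) (tenO V (ehom C A1 B1) (ehom C A2 B2))
             (ehom C (etenO S A1 A2) (etenO S B1 B2))
           (tenA V (munit V) (ehom C A1 B1) (munit V) (ehom C A2 B2) f1 f2)
           (etenA S A1 B1 A2 B2))),
     massoc = eassoc S,
     mrunit = erunit S,
     mlunit = elunit S\<rparr>"

definition underlying_smon :: "('v, 'm, 'x) moncat_scheme \<Rightarrow> ('a, 'v, 'm) ecat \<Rightarrow> ('a, 'm, 'y) esmon_scheme
    \<Rightarrow> ('a, 'm) smc" where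
  "underlying_smon V C S = moncat.extend (underlying_mon V C S) \<lparr>braid = esym S\<rparr>"

definition ef_id :: "('v, 'm, 'x) moncat_scheme \<Rightarrow> ('a, 'v, 'm) ecat \<Rightarrow> ('a, 'a, 'm) efunc" where
  "ef_id V C = \<lparr>efobj = (\<lambda>A. A), efarr = (\<lambda>A B. idn V (ehom C A B))\<rparr>"

definition ef_ten :: "('a, 'm, 'y) emon_scheme \<Rightarrow> ('a \<times> 'a, 'a, 'm) efunc"
  \<comment> \<open>\<open>(A, B) \<mapsto> A \<boxtimes> B\<close>\<close> where
  "ef_ten S = \<lparr>efobj = (\<lambda>(A, B). etenO S A B), efarr = (\<lambda>(A, B) (A', B'). etenA S A A' B B')\<rparr>"

definition ef_ten_swap :: "('v, 'm, 'x) smc_scheme \<Rightarrow> ('a, 'v, 'm) ecat \<Rightarrow> ('a, 'm, 'y) emon_scheme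
    \<Rightarrow> ('a \<times> 'a, 'a, 'm) efunc"
  \<comment> \<open>\<open>(A, B) \<mapsto> B \<boxtimes> A\<close>\<close> where
  "ef_ten_swap V C S =
    \<lparr>efobj = (\<lambda>(A, B). etenO S B A),
     efarr = (\<lambda>(A, B) (A', B').
       cmp V (tenO V (ehom C A A') (ehom C B B')) (tenO V (ehom C B B') (ehom C A A'))
           (ehom C (etenO S B A) (etenO S B' A'))
         (braid V (ehom C A A') (ehom C B B')) (etenA S B B' A A'))\<rparr>"

definition ef_ten_left :: "('v, 'm, 'x) moncat_scheme \<Rightarrow> ('a, 'v, 'm) ecat \<Rightarrow> ('a, 'm, 'y) emon_scheme
    \<Rightarrow> (('a \<times> 'a) \<times> 'a, 'a, 'm) efunc"
  \<comment> \<open>\<open>((A, B), D) \<mapsto> (A \<boxtimes> B) \<boxtimes> D\<close>\<close> where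
  "ef_ten_left V C S =
    \<lparr>efobj = (\<lambda>((A, B), D). etenO S (etenO S A B) D),
     efarr = (\<lambda>((A, B), D) ((A', B'), D').
       cmp V (tenO V (tenO V (ehom C A A') (ehom C B B')) (ehom C D D'))
           (tenO V (ehom C (etenO S A B) (etenO S A' B')) (ehom C D D'))
           (ehom C (etenO S (etenO S A B) D) (etenO S (etenO S A' B') D'))
         (tenA V (tenO V (ehom C A A') (ehom C B B')) (ehom C (etenO S A B) (etenO S A' B'))
             (ehom C D D') (ehom C D D')
           (etenA S A A' B B') (idn V (ehom C D D')))
         (etenA S (etenO S A B) (etenO S A' B') D D'))\<rparr>"

definition ef_ten_right :: "('v, 'm, 'x) moncat_scheme \<Rightarrow> ('a, 'v, 'm) ecat \<Rightarrow> ('a, 'm, 'y) emon_scheme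
    \<Rightarrow> (('a \<times> 'a) \<times> 'a, 'a, 'm) efunc"
  \<comment> \<open>\<open>((A, B), D) \<mapsto> A \<boxtimes> (B \<boxtimes> D)\<close>\<close> where
  "ef_ten_right V C S =
    \<lparr>efobj = (\<lambda>((A, B), D). etenO S A (etenO S B D)),
     efarr = (\<lambda>((A, B), D) ((A', B'), D').
       cmp V (tenO V (tenO V (ehom C A A') (ehom C B B')) (ehom C D D'))
           (tenO V (ehom C A A') (tenO V (ehom C B B') (ehom C D D')))
           (ehom C (etenO S A (etenO S B D)) (etenO S A' (etenO S B' D')))
         (massoc V (ehom C A A') (ehom C B B') (ehom C D D'))
         (cmp V (tenO V (ehom C A A') (tenO V (ehom C B B') (ehom C D D')))
             (tenO V (ehom C A A') (ehom C (etenO S B D) (etenO S B' D')))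
             (ehom C (etenO S A (etenO S B D)) (etenO S A' (etenO S B' D')))
           (tenA V (ehom C A A') (ehom C A A') (tenO V (ehom C B B') (ehom C D D'))
               (ehom C (etenO S B D) (etenO S B' D'))
             (idn V (ehom C A A')) (etenA S B B' D D'))
           (etenA S A A' (etenO S B D) (etenO S B' D'))))\<rparr>"

definition ef_ten_unit :: "('v, 'm, 'x) moncat_scheme \<Rightarrow> ('a, 'v, 'm) ecat \<Rightarrow> ('a, 'm, 'y) emon_scheme
    \<Rightarrow> ('a, 'a, 'm) efunc"
  \<comment> \<open>\<open>A \<mapsto> A \<boxtimes> J\<close>\<close> where
  "ef_ten_unit V C S =
    \<lparr>efobj = (\<lambda>A. etenO S A (eunit S)),
     efarr = (\<lambda>A B.
       cmp V (ehom C A B) (tenO V (ehom C A B) (munit V)) (ehom C (etenO S A (eunit S)) (etenO S B (eunit S)))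
         (inv_arr V (tenO V (ehom C A B) (munit V)) (ehom C A B) (mrunit V (ehom C A B)))
         (cmp V (tenO V (ehom C A B) (munit V)) (tenO V (ehom C A B) (ehom C (eunit S) (eunit S)))
             (ehom C (etenO S A (eunit S)) (etenO S B (eunit S)))
           (tenA V (ehom C A B) (ehom C A B) (munit V) (ehom C (eunit S) (eunit S))
             (idn V (ehom C A B)) (eid C (eunit S)))
           (etenA S A B (eunit S) (eunit S))))\<rparr>"

definition ef_unit_ten :: "('v, 'm, 'x) moncat_scheme \<Rightarrow> ('a, 'v, 'm) ecat \<Rightarrow> ('a, 'm, 'y) emon_scheme
    \<Rightarrow> ('a, 'a, 'm) efunc"
  \<comment> \<open>\<open>A \<mapsto> J \<boxtimes> A\<close>\<close> where
  "ef_unit_ten V C S =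
    \<lparr>efobj = (\<lambda>A. etenO S (eunit S) A),
     efarr = (\<lambda>A B.
       cmp V (ehom C A B) (tenO V (munit V) (ehom C A B)) (ehom C (etenO S (eunit S) A) (etenO S (eunit S) B))
         (inv_arr V (tenO V (munit V) (ehom C A B)) (ehom C A B) (mlunit V (ehom C A B)))
         (cmp V (tenO V (munit V) (ehom C A B)) (tenO V (ehom C (eunit S) (eunit S)) (ehom C A B))
             (ehom C (etenO S (eunit S) A) (etenO S (eunit S) B))
           (tenA V (munit V) (ehom C (eunit S) (eunit S)) (ehom C A B) (ehom C A B)
             (eid C (eunit S)) (idn V (ehom C A B)))
           (etenA S (eunit S) (eunit S) A B)))\<rparr>"

locale monoidal_enriched_category =
  V: symmetric_monoidal_category V + enriched_category V C +
  ten: enriched_functor V "eprod V C C" C "ef_ten S" +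
  underlying: monoidal_category "underlying_mon V C S"
  for V :: "('v, 'm, 'x) smc_scheme" and C :: "('a, 'v, 'm) ecat" and S :: "('a, 'm, 'y) emon_scheme" +
  assumes eunit_obj: "eunit S \<in> eobj C"
    and eassoc_natural_iso: "enriched_natural_iso V (eprod V (eprod V C C) C) C
      (ef_ten_left V C S) (ef_ten_right V C S) (\<lambda>((A, B), D). eassoc S A B D)"
    and erunit_natural_iso: "enriched_natural_iso V C C (ef_ten_unit V C S) (ef_id V C) (erunit S)"
    and elunit_natural_iso: "enriched_natural_iso V C C (ef_unit_ten V C S) (ef_id V C) (elunit S)"

locale symmetric_monoidal_enriched_category =
  monoidal_enriched_category V C S + underlying: symmetric_monoidal_category "underlying_smon V C S"
  for V :: "('v, 'm, 'x) smc_scheme" and C :: "('a, 'v, 'm) ecat" and S :: "('a, 'm, 'y) esmon_scheme" +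
  assumes esym_natural_iso: "enriched_natural_iso V (eprod V C C) C
      (ef_ten S) (ef_ten_swap V C S) (\<lambda>(A, B). esym S A B)"


section \<open>Change of base\<close>

text \<open>
  For \<open>h : A \<otimes> B \<rightarrow> D\<close> in \<open>V\<close>, \<open>lax_binary\<close> is \<open>F A \<otimes> F B \<rightarrow> F (A \<otimes> B) \<rightarrow> F D\<close>; for \<open>x : I \<rightarrow> D\<close>,
  \<open>lax_nullary\<close> is \<open>I \<rightarrow> F I \<rightarrow> F D\<close>.
\<close>

definition lax_binary :: "('v, 'm, 'x) moncat_scheme \<Rightarrow> ('w, 'n, 'y) moncat_scheme
    \<Rightarrow> ('v, 'm, 'w, 'n) laxfunc \<Rightarrow> 'v \<Rightarrow> 'v \<Rightarrow> 'v \<Rightarrow> 'm \<Rightarrow> 'n" where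
  "lax_binary V W F A B D h =
     cmp W (tenO W (fobj F A) (fobj F B)) (fobj F (tenO V A B)) (fobj F D)
       (fmul F A B) (farr F (tenO V A B) D h)"

definition lax_nullary :: "('v, 'm, 'x) moncat_scheme \<Rightarrow> ('w, 'n, 'y) moncat_scheme
    \<Rightarrow> ('v, 'm, 'w, 'n) laxfunc \<Rightarrow> 'v \<Rightarrow> 'm \<Rightarrow> 'n" where
  "lax_nullary V W F D x =
     cmp W (munit W) (fobj F (munit V)) (fobj F D) (feps F) (farr F (munit V) D x)"

definition change_base :: "('v, 'm, 'x) moncat_scheme \<Rightarrow> ('w, 'n, 'y) moncat_scheme
    \<Rightarrow> ('v, 'm, 'w, 'n) laxfunc \<Rightarrow> ('a, 'v, 'm) ecat \<Rightarrow> ('a, 'w, 'n) ecat" where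
  "change_base V W F C =
    \<lparr>eobj = eobj C,
     ehom = (\<lambda>X Y. fobj F (ehom C X Y)),
     ecomp = (\<lambda>X Y Z. lax_binary V W F (ehom C X Y) (ehom C Y Z) (ehom C X Z) (ecomp C X Y Z)),
     eid = (\<lambda>X. lax_nullary V W F (ehom C X X) (eid C X))\<rparr>"

definition change_base_underlying :: "('v, 'm, 'x) moncat_scheme \<Rightarrow> ('w, 'n, 'y) moncat_scheme
    \<Rightarrow> ('v, 'm, 'w, 'n) laxfunc \<Rightarrow> ('a, 'v, 'm) ecat \<Rightarrow> ('a, 'm, 'a, 'n) func"
  \<comment> \<open>\<open>F\<^sub>*\<^sup>0 : \<C>\<^sub>0 \<rightarrow> (F\<^sub>*\<C>)\<^sub>0\<close>\<close> where
  "change_base_underlying V W F C =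
    \<lparr>fobj = (\<lambda>X. X), farr = (\<lambda>X Y f. lax_nullary V W F (ehom C X Y) f)\<rparr>"


section \<open>2-categories and 2-functors\<close>

text \<open>
  A (strict) 2-category is a category enriched in small categories: \<open>thom T X Y\<close> is the category
  of 1-cells \<open>X \<rightarrow> Y\<close> and 2-cells between them, and horizontal composition is the functor
  \<open>tcmp T X Y Z\<close> from \<open>thom T X Y \<times> thom T Y Z\<close> to \<open>thom T X Z\<close>.
\<close>

record ('c, 'f, 'p) twocat =
  tobj :: "'c set"
  thom :: "'c \<Rightarrow> 'c \<Rightarrow> ('f, 'p) cat"
  tid :: "'c \<Rightarrow> 'f"
  tcmp :: "'c \<Rightarrow> 'c \<Rightarrow> 'c \<Rightarrow> ('f \<times> 'f, 'p \<times> 'p, 'f, 'p) func"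

locale two_category =
  fixes T :: "('c, 'f, 'p) twocat"
  assumes thom_category: "\<lbrakk>X \<in> tobj T; Y \<in> tobj T\<rbrakk> \<Longrightarrow> category (thom T X Y)"
    and tid_obj: "X \<in> tobj T \<Longrightarrow> tid T X \<in> obj (thom T X X)"
    and tcmp_functor: "\<lbrakk>X \<in> tobj T; Y \<in> tobj T; Z \<in> tobj T\<rbrakk>
      \<Longrightarrow> cat_functor (prod_cat (thom T X Y) (thom T Y Z)) (thom T X Z) (tcmp T X Y Z)"
    and tcmp_assoc1: "\<lbrakk>X \<in> tobj T; Y \<in> tobj T; Z \<in> tobj T; Z' \<in> tobj T;
        f \<in> obj (thom T X Y); g \<in> obj (thom T Y Z); h \<in> obj (thom T Z Z')\<rbrakk>
      \<Longrightarrow> fobj (tcmp T X Z Z') (fobj (tcmp T X Y Z) (f, g), h)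
        = fobj (tcmp T X Y Z') (f, fobj (tcmp T Y Z Z') (g, h))"
    and tcmp_assoc2: "\<lbrakk>X \<in> tobj T; Y \<in> tobj T; Z \<in> tobj T; Z' \<in> tobj T;
        f \<in> obj (thom T X Y); g \<in> obj (thom T Y Z); h \<in> obj (thom T Z Z');
        f' \<in> obj (thom T X Y); g' \<in> obj (thom T Y Z); h' \<in> obj (thom T Z Z');
        \<phi> \<in> hom (thom T X Y) f f'; \<psi> \<in> hom (thom T Y Z) g g'; \<chi> \<in> hom (thom T Z Z') h h'\<rbrakk>
      \<Longrightarrow> farr (tcmp T X Z Z') (fobj (tcmp T X Y Z) (f, g), h) (fobj (tcmp T X Y Z) (f', g'), h')
            (farr (tcmp T X Y Z) (f, g) (f', g') (\<phi>, \<psi>), \<chi>)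
        = farr (tcmp T X Y Z') (f, fobj (tcmp T Y Z Z') (g, h)) (f', fobj (tcmp T Y Z Z') (g', h'))
            (\<phi>, farr (tcmp T Y Z Z') (g, h) (g', h') (\<psi>, \<chi>))"
    and tid_tcmp1: "\<lbrakk>X \<in> tobj T; Y \<in> tobj T; f \<in> obj (thom T X Y)\<rbrakk>
      \<Longrightarrow> fobj (tcmp T X X Y) (tid T X, f) = f"
    and tid_tcmp2: "\<lbrakk>X \<in> tobj T; Y \<in> tobj T; f \<in> obj (thom T X Y); g \<in> obj (thom T X Y); \<phi> \<in> hom (thom T X Y) f g\<rbrakk>
      \<Longrightarrow> farr (tcmp T X X Y) (tid T X, f) (tid T X, g) (idn (thom T X X) (tid T X), \<phi>) = \<phi>"
    and tcmp_tid1: "\<lbrakk>X \<in> tobj T; Y \<in> tobj T; f \<in> obj (thom T X Y)\<rbrakk>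
      \<Longrightarrow> fobj (tcmp T X Y Y) (f, tid T Y) = f"
    and tcmp_tid2: "\<lbrakk>X \<in> tobj T; Y \<in> tobj T; f \<in> obj (thom T X Y); g \<in> obj (thom T X Y); \<phi> \<in> hom (thom T X Y) f g\<rbrakk>
      \<Longrightarrow> farr (tcmp T X Y Y) (f, tid T Y) (g, tid T Y) (\<phi>, idn (thom T Y Y) (tid T Y)) = \<phi>"

record ('c1, 'f1, 'p1, 'c2, 'f2, 'p2) twofunc =
  tfobj :: "'c1 \<Rightarrow> 'c2"
  tfhom :: "'c1 \<Rightarrow> 'c1 \<Rightarrow> ('f1, 'p1, 'f2, 'p2) func"

locale two_functor = S: two_category S + T: two_category T
  for S :: "('c1, 'f1, 'p1) twocat" and T :: "('c2, 'f2, 'p2) twocat" +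
  fixes G :: "('c1, 'f1, 'p1, 'c2, 'f2, 'p2) twofunc"
  assumes tfobj_obj: "X \<in> tobj S \<Longrightarrow> tfobj G X \<in> tobj T"
    and tfhom_functor: "\<lbrakk>X \<in> tobj S; Y \<in> tobj S\<rbrakk>
      \<Longrightarrow> cat_functor (thom S X Y) (thom T (tfobj G X) (tfobj G Y)) (tfhom G X Y)"
    and tfhom_tid: "X \<in> tobj S \<Longrightarrow> fobj (tfhom G X X) (tid S X) = tid T (tfobj G X)"
    and tfhom_tcmp1: "\<lbrakk>X \<in> tobj S; Y \<in> tobj S; Z \<in> tobj S; f \<in> obj (thom S X Y); g \<in> obj (thom S Y Z)\<rbrakk>
      \<Longrightarrow> fobj (tfhom G X Z) (fobj (tcmp S X Y Z) (f, g))
        = fobj (tcmp T (tfobj G X) (tfobj G Y) (tfobj G Z)) (fobj (tfhom G X Y) f, fobj (tfhom G Y Z) g)"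
    and tfhom_tcmp2: "\<lbrakk>X \<in> tobj S; Y \<in> tobj S; Z \<in> tobj S;
        f \<in> obj (thom S X Y); g \<in> obj (thom S Y Z); f' \<in> obj (thom S X Y); g' \<in> obj (thom S Y Z);
        \<phi> \<in> hom (thom S X Y) f f'; \<psi> \<in> hom (thom S Y Z) g g'\<rbrakk>
      \<Longrightarrow> farr (tfhom G X Z) (fobj (tcmp S X Y Z) (f, g)) (fobj (tcmp S X Y Z) (f', g'))
            (farr (tcmp S X Y Z) (f, g) (f', g') (\<phi>, \<psi>))
        = farr (tcmp T (tfobj G X) (tfobj G Y) (tfobj G Z))
            (fobj (tfhom G X Y) f, fobj (tfhom G Y Z) g) (fobj (tfhom G X Y) f', fobj (tfhom G Y Z) g')
            (farr (tfhom G X Y) f f' \<phi>, farr (tfhom G Y Z) g g' \<psi>)"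

definition identity_on_objects :: "('c, 'f1, 'p1) twocat \<Rightarrow> ('c, 'f2, 'p2) twocat
    \<Rightarrow> ('c, 'f1, 'p1, 'c, 'f2, 'p2) twofunc \<Rightarrow> bool" where
  "identity_on_objects S T G \<longleftrightarrow> tobj S = tobj T \<and> (\<forall>X\<in>tobj S. tfobj G X = X)"

definition two_faithful :: "('c1, 'f1, 'p1) twocat \<Rightarrow> ('c1, 'f1, 'p1, 'c2, 'f2, 'p2) twofunc \<Rightarrow> bool" where
  "two_faithful S G \<longleftrightarrow> (\<forall>X\<in>tobj S. \<forall>Y\<in>tobj S.
     inj_on (fobj (tfhom G X Y)) (obj (thom S X Y)) \<and> faithful (thom S X Y) (tfhom G X Y))"

text \<open>
  The data of a monoidal product on a 2-category: \<open>tten N A\<^sub>1 B\<^sub>1 A\<^sub>2 B\<^sub>2\<close> is the action of the product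
  on 1-cells and 2-cells, from \<open>thom T A\<^sub>1 B\<^sub>1 \<times> thom T A\<^sub>2 B\<^sub>2\<close> to \<open>thom T (A\<^sub>1 \<boxtimes> A\<^sub>2) (B\<^sub>1 \<boxtimes> B\<^sub>2)\<close>; the last
  components are the coherence 1-cells.
\<close>

record ('c, 'f, 'p) twomon =
  ttenO :: "'c \<Rightarrow> 'c \<Rightarrow> 'c"
  tten :: "'c \<Rightarrow> 'c \<Rightarrow> 'c \<Rightarrow> 'c \<Rightarrow> ('f \<times> 'f, 'p \<times> 'p, 'f, 'p) func"
  tunit :: "'c"
  tassoc :: "'c \<Rightarrow> 'c \<Rightarrow> 'c \<Rightarrow> 'f"
  trunit :: "'c \<Rightarrow> 'f"
  tlunit :: "'c \<Rightarrow> 'f"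

record ('c, 'f, 'p) twosmon = "('c, 'f, 'p) twomon" +
  tsym :: "'c \<Rightarrow> 'c \<Rightarrow> 'f"

definition strictly_preserves_monoidal :: "('c1, 'f1, 'p1) twocat \<Rightarrow> ('c1, 'f1, 'p1, 'x) twomon_scheme
    \<Rightarrow> ('c2, 'f2, 'p2, 'y) twomon_scheme \<Rightarrow> ('c1, 'f1, 'p1, 'c2, 'f2, 'p2) twofunc \<Rightarrow> bool" where
  "strictly_preserves_monoidal S N N' G \<longleftrightarrow>
     tfobj G (tunit N) = tunit N' \<and>
     (\<forall>A\<in>tobj S. \<forall>B\<in>tobj S. tfobj G (ttenO N A B) = ttenO N' (tfobj G A) (tfobj G B)) \<and>
     (\<forall>A1\<in>tobj S. \<forall>B1\<in>tobj S. \<forall>A2\<in>tobj S. \<forall>B2\<in>tobj S.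
        \<forall>f1\<in>obj (thom S A1 B1). \<forall>f2\<in>obj (thom S A2 B2).
          fobj (tfhom G (ttenO N A1 A2) (ttenO N B1 B2)) (fobj (tten N A1 B1 A2 B2) (f1, f2))
          = fobj (tten N' (tfobj G A1) (tfobj G B1) (tfobj G A2) (tfobj G B2))
              (fobj (tfhom G A1 B1) f1, fobj (tfhom G A2 B2) f2)) \<and>
     (\<forall>A1\<in>tobj S. \<forall>B1\<in>tobj S. \<forall>A2\<in>tobj S. \<forall>B2\<in>tobj S.
        \<forall>f1\<in>obj (thom S A1 B1). \<forall>g1\<in>obj (thom S A1 B1). \<forall>f2\<in>obj (thom S A2 B2). \<forall>g2\<in>obj (thom S A2 B2).
        \<forall>\<phi>1\<in>hom (thom S A1 B1) f1 g1. \<forall>\<phi>2\<in>hom (thom S A2 B2) f2 g2.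
          farr (tfhom G (ttenO N A1 A2) (ttenO N B1 B2))
              (fobj (tten N A1 B1 A2 B2) (f1, f2)) (fobj (tten N A1 B1 A2 B2) (g1, g2))
              (farr (tten N A1 B1 A2 B2) (f1, f2) (g1, g2) (\<phi>1, \<phi>2))
          = farr (tten N' (tfobj G A1) (tfobj G B1) (tfobj G A2) (tfobj G B2))
              (fobj (tfhom G A1 B1) f1, fobj (tfhom G A2 B2) f2)
              (fobj (tfhom G A1 B1) g1, fobj (tfhom G A2 B2) g2)
              (farr (tfhom G A1 B1) f1 g1 \<phi>1, farr (tfhom G A2 B2) f2 g2 \<phi>2)) \<and>
     (\<forall>A\<in>tobj S. \<forall>B\<in>tobj S. \<forall>D\<in>tobj S.
        fobj (tfhom G (ttenO N (ttenO N A B) D) (ttenO N A (ttenO N B D))) (tassoc N A B D)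
        = tassoc N' (tfobj G A) (tfobj G B) (tfobj G D)) \<and>
     (\<forall>A\<in>tobj S. fobj (tfhom G (ttenO N A (tunit N)) A) (trunit N A) = trunit N' (tfobj G A)) \<and>
     (\<forall>A\<in>tobj S. fobj (tfhom G (ttenO N (tunit N) A) A) (tlunit N A) = tlunit N' (tfobj G A))"

definition strictly_preserves_symmetric_monoidal :: "('c1, 'f1, 'p1) twocat \<Rightarrow> ('c1, 'f1, 'p1, 'x) twosmon_scheme
    \<Rightarrow> ('c2, 'f2, 'p2, 'y) twosmon_scheme \<Rightarrow> ('c1, 'f1, 'p1, 'c2, 'f2, 'p2) twofunc \<Rightarrow> bool" where
  "strictly_preserves_symmetric_monoidal S N N' G \<longleftrightarrow>
     strictly_preserves_monoidal S N N' G \<and>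
     (\<forall>A\<in>tobj S. \<forall>B\<in>tobj S.
        fobj (tfhom G (ttenO N A B) (ttenO N B A)) (tsym N A B) = tsym N' (tfobj G A) (tfobj G B))"


section \<open>Ordinary categories as 2-categories\<close>

definition discrete_cat :: "'f set \<Rightarrow> ('f, unit) cat" where
  "discrete_cat A = \<lparr>obj = A, hom = (\<lambda>f g. {u. f = g}), idn = (\<lambda>f. ()), cmp = (\<lambda>f g h u v. ())\<rparr>"

definition locally_discrete :: "('o, 'm, 'x) cat_scheme \<Rightarrow> ('o, 'm, unit) twocat" where
  "locally_discrete C =
    \<lparr>tobj = obj C,
     thom = (\<lambda>X Y. discrete_cat (hom C X Y)),
     tid = idn C,
     tcmp = (\<lambda>X Y Z. \<lparr>fobj = (\<lambda>(f, g). cmp C X Y Z f g), farr = (\<lambda>_ _ _. ())\<rparr>)\<rparr>"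

definition locally_discrete_mon :: "('o, 'm, 'x) moncat_scheme \<Rightarrow> ('o, 'm, unit) twomon" where
  "locally_discrete_mon C =
    \<lparr>ttenO = tenO C,
     tten = (\<lambda>A1 B1 A2 B2. \<lparr>fobj = (\<lambda>(f1, f2). tenA C A1 B1 A2 B2 f1 f2), farr = (\<lambda>_ _ _. ())\<rparr>),
     tunit = munit C,
     tassoc = massoc C,
     trunit = mrunit C,
     tlunit = mlunit C\<rparr>"

definition locally_discrete_smon :: "('o, 'm, 'x) smc_scheme \<Rightarrow> ('o, 'm, unit) twosmon" where
  "locally_discrete_smon C = twomon.extend (locally_discrete_mon C) \<lparr>tsym = braid C\<rparr>"


section \<open>The 2-category of parametrised arrows\<close>

definition slice :: "('o, 'm, 'x) cat_scheme \<Rightarrow> 'o set \<Rightarrow> 'o \<Rightarrow> ('o \<times> 'm, 'm) cat"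
  \<comment> \<open>arrows \<open>P \<rightarrow> A\<close> with \<open>P \<in> U\<close>, paired with their domain, and commuting triangles\<close> where
  "slice K U A =
    \<lparr>obj = {(P, f). P \<in> U \<and> f \<in> hom K P A},
     hom = (\<lambda>(P, f) (Q, g). {\<phi> \<in> hom K P Q. f = cmp K P Q A \<phi> g}),
     idn = (\<lambda>(P, f). idn K P),
     cmp = (\<lambda>(P, f) (Q, g) (R, h) \<phi> \<psi>. cmp K P Q R \<phi> \<psi>)\<rparr>"

text \<open>
  For \<open>h : A \<otimes> B \<rightarrow> D\<close> in \<open>\<V>\<close>, \<open>slice_binary\<close> sends Kleisli arrows \<open>f : P \<rightarrow> F A\<close> and \<open>g : Q \<rightarrow> F B\<close> to the
  Kleisli composite of \<open>f \<otimes> g : P \<otimes> Q \<rightarrow> F A \<otimes> F B\<close> with the image under \<open>L\<^sub>M\<close> of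
  \<open>F A \<otimes> F B \<rightarrow> F (A \<otimes> B) \<rightarrow> F D\<close>. For \<open>x : I \<rightarrow> D\<close>, \<open>slice_nullary\<close> is the image under \<open>L\<^sub>M\<close> of
  \<open>I \<rightarrow> F I \<rightarrow> F D\<close>.
\<close>

definition slice_binary :: "('v, 'm, 'x) moncat_scheme \<Rightarrow> ('w, 'n, 'y) smc_scheme \<Rightarrow> ('w, 'n) monad
    \<Rightarrow> ('v, 'm, 'w, 'n) laxfunc \<Rightarrow> 'v \<Rightarrow> 'v \<Rightarrow> 'v \<Rightarrow> 'm
    \<Rightarrow> (('w \<times> 'n) \<times> ('w \<times> 'n), 'n \<times> 'n, 'w \<times> 'n, 'n) func" where
  "slice_binary V W M F A B D h =
    \<lparr>fobj = (\<lambda>((P, f), (Q, g)).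
       (tenO W P Q,
        cmp (kleisli W M) (tenO W P Q) (tenO W (fobj F A) (fobj F B)) (fobj F D)
          (tenA (kleisli W M) P (fobj F A) Q (fobj F B) f g)
          (kl_lift W M (tenO W (fobj F A) (fobj F B)) (fobj F D) (lax_binary V W F A B D h)))),
     farr = (\<lambda>((P, f), (Q, g)) ((P', f'), (Q', g')) (\<phi>, \<psi>). tenA (kleisli W M) P P' Q Q' \<phi> \<psi>)\<rparr>"

definition slice_nullary :: "('v, 'm, 'x) moncat_scheme \<Rightarrow> ('w, 'n, 'y) smc_scheme \<Rightarrow> ('w, 'n) monad
    \<Rightarrow> ('v, 'm, 'w, 'n) laxfunc \<Rightarrow> 'v \<Rightarrow> 'm \<Rightarrow> 'w \<times> 'n" where
  "slice_nullary V W M F D x =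
    (munit W, kl_lift W M (munit W) (fobj F D) (lax_nullary V W F D x))"

definition param_twocat :: "('v, 'm, 'x) moncat_scheme \<Rightarrow> ('w, 'n, 'y) smc_scheme \<Rightarrow> ('w, 'n) monad
    \<Rightarrow> ('v, 'm, 'w, 'n) laxfunc \<Rightarrow> 'w set \<Rightarrow> ('a, 'v, 'm) ecat \<Rightarrow> ('a, 'w \<times> 'n, 'n) twocat"
  \<comment> \<open>\<open>(\<U>/MF)\<^sub>*\<C>\<close>\<close> where
  "param_twocat V W M F U C =
    \<lparr>tobj = eobj C,
     thom = (\<lambda>X Y. slice (kleisli W M) U (fobj F (ehom C X Y))),
     tid = (\<lambda>X. slice_nullary V W M F (ehom C X X) (eid C X)),
     tcmp = (\<lambda>X Y Z. slice_binary V W M F (ehom C X Y) (ehom C Y Z) (ehom C X Z) (ecomp C X Y Z))\<rparr>"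

definition param_twomon :: "('v, 'm, 'x) moncat_scheme \<Rightarrow> ('w, 'n, 'y) smc_scheme \<Rightarrow> ('w, 'n) monad
    \<Rightarrow> ('v, 'm, 'w, 'n) laxfunc \<Rightarrow> ('a, 'v, 'm) ecat \<Rightarrow> ('a, 'm, 'z) emon_scheme \<Rightarrow> ('a, 'w \<times> 'n, 'n) twomon" where
  "param_twomon V W M F C S =
    \<lparr>ttenO = etenO S,
     tten = (\<lambda>A1 B1 A2 B2. slice_binary V W M F (ehom C A1 B1) (ehom C A2 B2)
       (ehom C (etenO S A1 A2) (etenO S B1 B2)) (etenA S A1 B1 A2 B2)),
     tunit = eunit S,
     tassoc = (\<lambda>A B D. slice_nullary V W M F
       (ehom C (etenO S (etenO S A B) D) (etenO S A (etenO S B D))) (eassoc S A B D)),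
     trunit = (\<lambda>A. slice_nullary V W M F (ehom C (etenO S A (eunit S)) A) (erunit S A)),
     tlunit = (\<lambda>A. slice_nullary V W M F (ehom C (etenO S (eunit S) A) A) (elunit S A))\<rparr>"

definition param_twosmon :: "('v, 'm, 'x) moncat_scheme \<Rightarrow> ('w, 'n, 'y) smc_scheme \<Rightarrow> ('w, 'n) monad
    \<Rightarrow> ('v, 'm, 'w, 'n) laxfunc \<Rightarrow> ('a, 'v, 'm) ecat \<Rightarrow> ('a, 'm, 'z) esmon_scheme \<Rightarrow> ('a, 'w \<times> 'n, 'n) twosmon" where
  "param_twosmon V W M F C S = twomon.extend (param_twomon V W M F C S)
    \<lparr>tsym = (\<lambda>A B. slice_nullary V W M F (ehom C (etenO S A B) (etenO S B A)) (esym S A B))\<rparr>"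

end

theory Submission
  imports Defs
begin

text \<open>
  On 1-cells the 2-functor sends \<open>f : I \<rightarrow> \<C>(X,Y)\<close> to \<open>F\<^sub>\<epsilon> ; F f ; \<eta>\<close>, seen as an arrow with parameter object \<open>I\<close>;
  its source has only identity 2-cells, and these go to the identity \<open>\<eta>\<^sub>I\<close> of \<open>I\<close> in the Kleisli category.

  Composition in \<open>\<C>\<^sub>0\<close> and the product \<open>\<boxtimes>\<close> on \<open>\<C>\<^sub>0\<close> have the same shape: both are convolutions
  \<open>I \<cong> I \<otimes> I \<rightarrow> A \<otimes> B \<rightarrow> D\<close> of two arrows \<open>f : I \<rightarrow> A\<close>, \<open>g : I \<rightarrow> B\<close> with some \<open>h : A \<otimes> B \<rightarrow> D\<close>. A lax monoidal
  functor carries convolutions to convolutions (\<open>lax_convolution\<close>), and \<open>L\<^sub>M\<close> preserves composites and tensor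
  products strictly (\<open>lift_seq\<close>, \<open>lift_ten\<close>). In \<open>\<W>\<close> the isomorphism \<open>I \<cong> I \<otimes> I\<close> is an identity because
  \<open>I\<close> lies in the strict subcategory \<open>\<U>\<close>, so what remains of the convolution is exactly the composite, or the product, of
  parametrised arrows (\<open>slice_binary_nullary\<close>). Thus preservation of composition and of \<open>\<boxtimes>\<close> are two instances of one
  equation. Identities and coherence maps are preserved because those of the target are, by construction, \<open>F\<^sub>\<epsilon> ; F c ; \<eta>\<close> for the
  corresponding map \<open>c\<close> of \<open>\<C>\<^sub>0\<close>.

  The action on 1-cells is \<open>F\<^sub>*\<^sup>0\<close> followed by composition with \<open>\<eta>\<close>, so it is injective when both of these are; on
  2-cells there is nothing to show, since a hom-set of a discrete category has at most one element.

  That the source is a 2-category rests on \<open>l\<^sub>I = r\<^sub>I\<close> in a monoidal category (\<open>lunit_unit_eq_runit_unit\<close>), which makes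
  composition in \<open>\<C>\<^sub>0\<close> unital on both sides and associative. The target is obtained from \<open>\<C>\<close> in three steps: change of base
  along \<open>F\<close> (\<open>change_base_enriched\<close>), along \<open>L\<^sub>M\<close> (\<open>kleisli_enriched\<close>, for which the Kleisli category has to be monoidal),
  and along \<open>\<U>/(-)\<close> (\<open>slice_two_category\<close>). The last step yields a strict 2-category because the associators and unitors at
  the parameter objects are identities, so that naturality of associator and unitors turns into strict associativity and
  unitality of the tensor product of arrows between objects of \<open>\<U>\<close>.
\<close>

section \<open>Arrows with their endpoints\<close>

text \<open>
  An arrow is taken together with its source and target. Composition and tensor product of such triples are free of
  object arguments, which makes long equations readable and lets the simplifier normalise composites to the right;
  all typing conditions reduce to equations between sources and targets. The lemma \<open>triple_ops\<close> leads back to the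
  operations on bare arrows.
\<close>

type_synonym ('o, 'm) arrow = "'o \<times> 'm \<times> 'o"

definition src :: "('o, 'm) arrow \<Rightarrow> 'o" where "src x = fst x"
definition mor :: "('o, 'm) arrow \<Rightarrow> 'm" where "mor x = fst (snd x)"
definition tgt :: "('o, 'm) arrow \<Rightarrow> 'o" where "tgt x = snd (snd x)"

definition arr :: "('o, 'm, 'x) cat_scheme \<Rightarrow> ('o, 'm) arrow \<Rightarrow> bool" where
  "arr C x \<longleftrightarrow> src x \<in> obj C \<and> tgt x \<in> obj C \<and> mor x \<in> hom C (src x) (tgt x)"

definition one :: "('o, 'm, 'x) cat_scheme \<Rightarrow> 'o \<Rightarrow> ('o, 'm) arrow" where
  "one C A = (A, idn C A, A)"

definition seq :: "('o, 'm) arrow \<Rightarrow> ('o, 'm, 'x) cat_scheme \<Rightarrow> ('o, 'm) arrow \<Rightarrow> ('o, 'm) arrow"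
    (\<open>(_ \<cdot>\<^bsub>_\<^esub>/ _)\<close> [61, 0, 60] 60) where
  "x \<cdot>\<^bsub>C\<^esub> y = (src x, cmp C (src x) (tgt x) (tgt y) (mor x) (mor y), tgt y)"

definition ten :: "('o, 'm) arrow \<Rightarrow> ('o, 'm, 'x) moncat_scheme \<Rightarrow> ('o, 'm) arrow \<Rightarrow> ('o, 'm) arrow"
    (\<open>(_ \<otimes>\<^bsub>_\<^esub>/ _)\<close> [71, 0, 70] 70) where
  "x \<otimes>\<^bsub>V\<^esub> y = (tenO V (src x) (src y),
     tenA V (src x) (tgt x) (src y) (tgt y) (mor x) (mor y), tenO V (tgt x) (tgt y))"

definition assoc_arr :: "('o, 'm, 'x) moncat_scheme \<Rightarrow> 'o \<Rightarrow> 'o \<Rightarrow> 'o \<Rightarrow> ('o, 'm) arrow" where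
  "assoc_arr V A B D = (tenO V (tenO V A B) D, massoc V A B D, tenO V A (tenO V B D))"
definition runit_arr :: "('o, 'm, 'x) moncat_scheme \<Rightarrow> 'o \<Rightarrow> ('o, 'm) arrow" where
  "runit_arr V A = (tenO V A (munit V), mrunit V A, A)"
definition lunit_arr :: "('o, 'm, 'x) moncat_scheme \<Rightarrow> 'o \<Rightarrow> ('o, 'm) arrow" where
  "lunit_arr V A = (tenO V (munit V) A, mlunit V A, A)"
definition unit_split_arr :: "('o, 'm, 'x) moncat_scheme \<Rightarrow> ('o, 'm) arrow" where
  "unit_split_arr V = (munit V, unit_split V, tenO V (munit V) (munit V))"

lemma triple_sel [simp]: "src (A, f, B) = A" "mor (A, f, B) = f" "tgt (A, f, B) = B"
  by (simp_all add: src_def mor_def tgt_def)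

lemma arr_triple: "arr C (A, f, B) \<longleftrightarrow> A \<in> obj C \<and> B \<in> obj C \<and> f \<in> hom C A B"
  by (simp add: arr_def)

lemma triple_cases: obtains A f B where "x = (A, f, B)"
  by (cases x) auto

lemma arrow_src_tgt [simp]:
  "src (one C A) = A" "tgt (one C A) = A"
  "src (x \<cdot>\<^bsub>C\<^esub> y) = src x" "tgt (x \<cdot>\<^bsub>C\<^esub> y) = tgt y"
  "src (x \<otimes>\<^bsub>V\<^esub> y) = tenO V (src x) (src y)" "tgt (x \<otimes>\<^bsub>V\<^esub> y) = tenO V (tgt x) (tgt y)"
  "src (assoc_arr V A B D) = tenO V (tenO V A B) D" "tgt (assoc_arr V A B D) = tenO V A (tenO V B D)"
  "src (runit_arr V A) = tenO V A (munit V)" "tgt (runit_arr V A) = A"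
  "src (lunit_arr V A) = tenO V (munit V) A" "tgt (lunit_arr V A) = A"
  "src (unit_split_arr V) = munit V" "tgt (unit_split_arr V) = tenO V (munit V) (munit V)"
  by (simp_all add: one_def seq_def ten_def assoc_arr_def runit_arr_def lunit_arr_def unit_split_arr_def)

lemma triple_ops [simp]:
  "(A, f, B) \<cdot>\<^bsub>C\<^esub> (B', g, D) = (A, cmp C A B D f g, D)"
  "(A, f, B) \<otimes>\<^bsub>V\<^esub> (A', f', B') = (tenO V A A', tenA V A B A' B' f f', tenO V B B')"
  by (simp_all add: seq_def ten_def)

context category
begin

lemma arr_obj [simp]: "arr C x \<Longrightarrow> src x \<in> obj C" "arr C x \<Longrightarrow> tgt x \<in> obj C"
  by (simp_all add: arr_def)

lemma arr_one [simp]: "A \<in> obj C \<Longrightarrow> arr C (one C A)"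
  by (simp add: one_def arr_triple idn_hom)

lemma arr_seq [simp]: "\<lbrakk>arr C x; arr C y; tgt x = src y\<rbrakk> \<Longrightarrow> arr C (x \<cdot>\<^bsub>C\<^esub> y)"
  by (cases x rule: triple_cases, cases y rule: triple_cases) (simp add: arr_triple cmp_hom)

lemma one_seq [simp]: "\<lbrakk>arr C x; src x = A\<rbrakk> \<Longrightarrow> one C A \<cdot>\<^bsub>C\<^esub> x = x"
  by (cases x rule: triple_cases) (simp add: one_def arr_triple idn_cmp)

lemma seq_one [simp]: "\<lbrakk>arr C x; tgt x = A\<rbrakk> \<Longrightarrow> x \<cdot>\<^bsub>C\<^esub> one C A = x"
  by (cases x rule: triple_cases) (simp add: one_def arr_triple cmp_idn)

lemma seq_assoc [simp]:
  "\<lbrakk>arr C x; arr C y; arr C z; tgt x = src y; tgt y = src z\<rbrakk>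
    \<Longrightarrow> (x \<cdot>\<^bsub>C\<^esub> y) \<cdot>\<^bsub>C\<^esub> z = x \<cdot>\<^bsub>C\<^esub> y \<cdot>\<^bsub>C\<^esub> z"
  by (cases x rule: triple_cases, cases y rule: triple_cases, cases z rule: triple_cases)
    (simp add: arr_triple cmp_assoc)

text \<open>
  Composites are normalised to the right; this form of an equation applies it at the head of a longer composite.
\<close>

lemma seq_eq_seq:
  "\<lbrakk>x \<cdot>\<^bsub>C\<^esub> y = z; arr C x; arr C y; arr C w; tgt x = src y; tgt y = src w\<rbrakk>
    \<Longrightarrow> x \<cdot>\<^bsub>C\<^esub> y \<cdot>\<^bsub>C\<^esub> w = z \<cdot>\<^bsub>C\<^esub> w"
  by (subst seq_assoc [symmetric]) simp_all

definition inverse_pair :: "('o, 'm) arrow \<Rightarrow> ('o, 'm) arrow \<Rightarrow> bool" where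
  "inverse_pair x y \<longleftrightarrow> arr C x \<and> arr C y \<and> tgt x = src y \<and> tgt y = src x \<and>
     x \<cdot>\<^bsub>C\<^esub> y = one C (src x) \<and> y \<cdot>\<^bsub>C\<^esub> x = one C (tgt x)"

lemma inverse_arr: "inverse_pair x y \<Longrightarrow> arr C x"
  by (simp add: inverse_pair_def)

lemma inverse_triple:
  "\<lbrakk>A \<in> obj C; B \<in> obj C\<rbrakk> \<Longrightarrow> inverse_pair (A, f, B) (B, g, A) \<longleftrightarrow> inverse_arrows C A B f g"
  by (auto simp: inverse_pair_def inverse_arrows_def arr_triple one_def)

lemma inverse_unique:
  assumes "inverse_pair x y" "inverse_pair x z"
  shows "y = z"
proof -
  have "y = y \<cdot>\<^bsub>C\<^esub> x \<cdot>\<^bsub>C\<^esub> z" using assms by (simp add: inverse_pair_def)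
  also have "\<dots> = (y \<cdot>\<^bsub>C\<^esub> x) \<cdot>\<^bsub>C\<^esub> z" using assms by (subst seq_assoc) (auto simp: inverse_pair_def)
  also have "\<dots> = z" using assms by (simp add: inverse_pair_def)
  finally show ?thesis .
qed

lemma inv_arr_inverse:
  assumes "is_iso C A B f" "A \<in> obj C" "B \<in> obj C"
  shows "inverse_pair (A, f, B) (B, inv_arr C A B f, A)"
proof -
  obtain g where g: "inverse_arrows C A B f g" using assms(1) by (auto simp: is_iso_def)
  moreover have "h = g" if "inverse_arrows C A B f h" for h
    using inverse_unique[of "(A, f, B)" "(B, g, A)" "(B, h, A)"] g that assms(2,3)
    by (simp add: inverse_triple)
  ultimately have "inv_arr C A B f = g" unfolding inv_arr_def by (intro the_equality)
  then show ?thesis using g assms(2,3) by (simp add: inverse_triple)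
qed

lemma cancel_left:
  assumes "x \<cdot>\<^bsub>C\<^esub> f = x \<cdot>\<^bsub>C\<^esub> g" "inverse_pair x y" "arr C f" "arr C g" "src f = tgt x" "src g = tgt x"
  shows "f = g"
proof -
  have "y \<cdot>\<^bsub>C\<^esub> x \<cdot>\<^bsub>C\<^esub> f = y \<cdot>\<^bsub>C\<^esub> x \<cdot>\<^bsub>C\<^esub> g" by (simp add: assms(1))
  then show ?thesis using assms(2-) by (simp add: inverse_pair_def flip: seq_assoc)
qed

lemma cancel_right:
  assumes "f \<cdot>\<^bsub>C\<^esub> x = g \<cdot>\<^bsub>C\<^esub> x" "inverse_pair x y" "arr C f" "arr C g" "tgt f = src x" "tgt g = src x"
  shows "f = g"
proof -
  have "(f \<cdot>\<^bsub>C\<^esub> x) \<cdot>\<^bsub>C\<^esub> y = (g \<cdot>\<^bsub>C\<^esub> x) \<cdot>\<^bsub>C\<^esub> y" by (simp add: assms(1))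
  then show ?thesis using assms(2-) by (simp add: inverse_pair_def)
qed

end

section \<open>Monoidal categories\<close>

context monoidal_category
begin

lemma arr_ten [simp]: "\<lbrakk>arr V x; arr V y\<rbrakk> \<Longrightarrow> arr V (x \<otimes>\<^bsub>V\<^esub> y)"
  by (cases x rule: triple_cases, cases y rule: triple_cases) (simp add: arr_triple tenO_obj tenA_hom)

declare munit_obj [simp] tenO_obj [simp]

lemma one_ten_one [simp]:
  "\<lbrakk>A \<in> obj V; B \<in> obj V\<rbrakk> \<Longrightarrow> one V A \<otimes>\<^bsub>V\<^esub> one V B = one V (tenO V A B)"
  by (simp add: one_def tenA_idn)

lemma interchange:
  "\<lbrakk>arr V f; arr V g; arr V f'; arr V g'; tgt f = src g; tgt f' = src g'\<rbrakk>
    \<Longrightarrow> (f \<otimes>\<^bsub>V\<^esub> f') \<cdot>\<^bsub>V\<^esub> (g \<otimes>\<^bsub>V\<^esub> g') = (f \<cdot>\<^bsub>V\<^esub> g) \<otimes>\<^bsub>V\<^esub> (f' \<cdot>\<^bsub>V\<^esub> g')"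
  by (cases f rule: triple_cases, cases g rule: triple_cases,
      cases f' rule: triple_cases, cases g' rule: triple_cases)
    (simp add: arr_triple tenA_cmp)

text \<open>
  The interchange law at the head of a composite that is bracketed to the right.
\<close>

lemma interchange_seq:
  "\<lbrakk>arr V f; arr V g; arr V f'; arr V g'; tgt f = src g; tgt f' = src g';
    arr V h; src h = tenO V (tgt g) (tgt g')\<rbrakk>
    \<Longrightarrow> (f \<otimes>\<^bsub>V\<^esub> f') \<cdot>\<^bsub>V\<^esub> (g \<otimes>\<^bsub>V\<^esub> g') \<cdot>\<^bsub>V\<^esub> h = (f \<cdot>\<^bsub>V\<^esub> g) \<otimes>\<^bsub>V\<^esub> (f' \<cdot>\<^bsub>V\<^esub> g') \<cdot>\<^bsub>V\<^esub> h"
  by (simp add: interchange flip: seq_assoc)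

lemma inverse_ten:
  "\<lbrakk>inverse_pair f g; inverse_pair f' g'\<rbrakk> \<Longrightarrow> inverse_pair (f \<otimes>\<^bsub>V\<^esub> f') (g \<otimes>\<^bsub>V\<^esub> g')"
  by (auto simp: inverse_pair_def interchange)

lemma inverse_one: "A \<in> obj V \<Longrightarrow> inverse_pair (one V A) (one V A)"
  by (simp add: inverse_pair_def)

lemma assoc_inverse:
  assumes "A \<in> obj V" "B \<in> obj V" "D \<in> obj V"
  obtains y where "inverse_pair (assoc_arr V A B D) y"
  using inv_arr_inverse[OF massoc_iso[OF assms]] assms by (auto simp: assoc_arr_def)

lemma runit_inverse:
  assumes "A \<in> obj V" obtains y where "inverse_pair (runit_arr V A) y"
  using inv_arr_inverse[OF mrunit_iso[OF assms]] assms by (auto simp: runit_arr_def)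

lemma lunit_inverse:
  assumes "A \<in> obj V" obtains y where "inverse_pair (lunit_arr V A) y"
  using inv_arr_inverse[OF mlunit_iso[OF assms]] assms by (auto simp: lunit_arr_def)

lemma arr_assoc [simp]: "\<lbrakk>A \<in> obj V; B \<in> obj V; D \<in> obj V\<rbrakk> \<Longrightarrow> arr V (assoc_arr V A B D)"
  by (meson assoc_inverse inverse_arr)
lemma arr_runit [simp]: "A \<in> obj V \<Longrightarrow> arr V (runit_arr V A)"
  by (meson runit_inverse inverse_arr)
lemma arr_lunit [simp]: "A \<in> obj V \<Longrightarrow> arr V (lunit_arr V A)"
  by (meson lunit_inverse inverse_arr)

lemma assoc_natural:
  "\<lbrakk>arr V f; arr V g; arr V h\<rbrakk>
    \<Longrightarrow> ((f \<otimes>\<^bsub>V\<^esub> g) \<otimes>\<^bsub>V\<^esub> h) \<cdot>\<^bsub>V\<^esub> assoc_arr V (tgt f) (tgt g) (tgt h)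
      = assoc_arr V (src f) (src g) (src h) \<cdot>\<^bsub>V\<^esub> (f \<otimes>\<^bsub>V\<^esub> g \<otimes>\<^bsub>V\<^esub> h)"
  by (cases f rule: triple_cases, cases g rule: triple_cases, cases h rule: triple_cases)
    (simp add: arr_triple assoc_arr_def massoc_natural)

lemma runit_natural: "arr V f \<Longrightarrow> (f \<otimes>\<^bsub>V\<^esub> one V (munit V)) \<cdot>\<^bsub>V\<^esub> runit_arr V (tgt f) = runit_arr V (src f) \<cdot>\<^bsub>V\<^esub> f"
  by (cases f rule: triple_cases) (simp add: arr_triple runit_arr_def one_def mrunit_natural)

lemma lunit_natural: "arr V f \<Longrightarrow> (one V (munit V) \<otimes>\<^bsub>V\<^esub> f) \<cdot>\<^bsub>V\<^esub> lunit_arr V (tgt f) = lunit_arr V (src f) \<cdot>\<^bsub>V\<^esub> f"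
  by (cases f rule: triple_cases) (simp add: arr_triple lunit_arr_def one_def mlunit_natural)

lemma assoc_pentagon:
  "\<lbrakk>A \<in> obj V; B \<in> obj V; D \<in> obj V; E \<in> obj V\<rbrakk>
    \<Longrightarrow> assoc_arr V (tenO V A B) D E \<cdot>\<^bsub>V\<^esub> assoc_arr V A B (tenO V D E)
      = (assoc_arr V A B D \<otimes>\<^bsub>V\<^esub> one V E) \<cdot>\<^bsub>V\<^esub> assoc_arr V A (tenO V B D) E \<cdot>\<^bsub>V\<^esub> (one V A \<otimes>\<^bsub>V\<^esub> assoc_arr V B D E)"
  by (simp add: assoc_arr_def one_def pentagon)

lemma assoc_triangle:
  "\<lbrakk>A \<in> obj V; B \<in> obj V\<rbrakk>
    \<Longrightarrow> assoc_arr V A (munit V) B \<cdot>\<^bsub>V\<^esub> (one V A \<otimes>\<^bsub>V\<^esub> lunit_arr V B) = runit_arr V A \<otimes>\<^bsub>V\<^esub> one V B"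
  by (simp add: assoc_arr_def one_def lunit_arr_def runit_arr_def triangle)

lemma unit_ten_faithful:
  assumes "one V (munit V) \<otimes>\<^bsub>V\<^esub> f = one V (munit V) \<otimes>\<^bsub>V\<^esub> g" "arr V f" "arr V g" "src f = src g" "tgt f = tgt g"
  shows "f = g"
proof -
  obtain y where y: "inverse_pair (lunit_arr V (src f)) y" using assms(2) by (meson lunit_inverse arr_obj)
  have "lunit_arr V (src f) \<cdot>\<^bsub>V\<^esub> f = lunit_arr V (src f) \<cdot>\<^bsub>V\<^esub> g"
    using lunit_natural[of f] lunit_natural[of g] assms by simp
  then show ?thesis by (rule cancel_left[OF _ y]) (use assms in simp_all)
qed

lemma ten_unit_faithful:
  assumes "f \<otimes>\<^bsub>V\<^esub> one V (munit V) = g \<otimes>\<^bsub>V\<^esub> one V (munit V)" "arr V f" "arr V g" "src f = src g" "tgt f = tgt g"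
  shows "f = g"
proof -
  obtain y where y: "inverse_pair (runit_arr V (src f)) y" using assms(2) by (meson runit_inverse arr_obj)
  have "runit_arr V (src f) \<cdot>\<^bsub>V\<^esub> f = runit_arr V (src f) \<cdot>\<^bsub>V\<^esub> g"
    using runit_natural[of f] runit_natural[of g] assms by simp
  then show ?thesis by (rule cancel_left[OF _ y]) (use assms in simp_all)
qed

text \<open>
  Kelly's argument. By naturality of \<open>l\<close>, tensoring with \<open>I\<close> on the left is faithful, so the equation may be checked after
  applying \<open>I \<otimes> -\<close> and composing with two associators on the left. Then the pentagon and two instances of the
  triangle, with naturality of the associator, identify both sides.
\<close>

lemma lunit_ten:
  assumes A: "A \<in> obj V" and B: "B \<in> obj V"
  shows "assoc_arr V (munit V) A B \<cdot>\<^bsub>V\<^esub> lunit_arr V (tenO V A B) = lunit_arr V A \<otimes>\<^bsub>V\<^esub> one V B"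
proof -
  let ?I = "munit V" and ?i = "one V (munit V)" and ?b = "one V B"
  let ?p = "assoc_arr V ?I ?I A \<otimes>\<^bsub>V\<^esub> ?b" and ?q = "assoc_arr V ?I (tenO V ?I A) B"
  have "?p \<cdot>\<^bsub>V\<^esub> ?q \<cdot>\<^bsub>V\<^esub> (?i \<otimes>\<^bsub>V\<^esub> (assoc_arr V ?I A B \<cdot>\<^bsub>V\<^esub> lunit_arr V (tenO V A B)))
      = (?p \<cdot>\<^bsub>V\<^esub> ?q \<cdot>\<^bsub>V\<^esub> (?i \<otimes>\<^bsub>V\<^esub> assoc_arr V ?I A B)) \<cdot>\<^bsub>V\<^esub> (?i \<otimes>\<^bsub>V\<^esub> lunit_arr V (tenO V A B))"
    using A B by (simp add: interchange)
  also have "\<dots> = (assoc_arr V (tenO V ?I ?I) A B \<cdot>\<^bsub>V\<^esub> assoc_arr V ?I ?I (tenO V A B)) \<cdot>\<^bsub>V\<^esub> (?i \<otimes>\<^bsub>V\<^esub> lunit_arr V (tenO V A B))"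
    using A B by (subst assoc_pentagon) simp_all
  also have "\<dots> = assoc_arr V (tenO V ?I ?I) A B \<cdot>\<^bsub>V\<^esub> (runit_arr V ?I \<otimes>\<^bsub>V\<^esub> one V A \<otimes>\<^bsub>V\<^esub> ?b)"
    using A B by (simp add: assoc_triangle)
  also have "\<dots> = ((runit_arr V ?I \<otimes>\<^bsub>V\<^esub> one V A) \<otimes>\<^bsub>V\<^esub> ?b) \<cdot>\<^bsub>V\<^esub> assoc_arr V ?I A B"
    using A B assoc_natural[of "runit_arr V ?I" "one V A" ?b] by simp
  also have "\<dots> = ?p \<cdot>\<^bsub>V\<^esub> ((?i \<otimes>\<^bsub>V\<^esub> lunit_arr V A) \<otimes>\<^bsub>V\<^esub> ?b) \<cdot>\<^bsub>V\<^esub> assoc_arr V ?I A B"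
    using A B by (simp add: interchange_seq assoc_triangle)
  also have "\<dots> = ?p \<cdot>\<^bsub>V\<^esub> ?q \<cdot>\<^bsub>V\<^esub> (?i \<otimes>\<^bsub>V\<^esub> lunit_arr V A \<otimes>\<^bsub>V\<^esub> ?b)"
    using A B assoc_natural[of ?i "lunit_arr V A" ?b] by simp
  finally have eq: "?p \<cdot>\<^bsub>V\<^esub> ?q \<cdot>\<^bsub>V\<^esub> (?i \<otimes>\<^bsub>V\<^esub> (assoc_arr V ?I A B \<cdot>\<^bsub>V\<^esub> lunit_arr V (tenO V A B)))
      = ?p \<cdot>\<^bsub>V\<^esub> ?q \<cdot>\<^bsub>V\<^esub> (?i \<otimes>\<^bsub>V\<^esub> lunit_arr V A \<otimes>\<^bsub>V\<^esub> ?b)" .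
  obtain y z where "inverse_pair (assoc_arr V ?I ?I A) y" and z: "inverse_pair ?q z"
    using A B by (meson assoc_inverse munit_obj tenO_obj)
  then have "inverse_pair ?p (y \<otimes>\<^bsub>V\<^esub> ?b)" using B by (simp add: inverse_ten inverse_one)
  from eq this have "?q \<cdot>\<^bsub>V\<^esub> (?i \<otimes>\<^bsub>V\<^esub> (assoc_arr V ?I A B \<cdot>\<^bsub>V\<^esub> lunit_arr V (tenO V A B)))
      = ?q \<cdot>\<^bsub>V\<^esub> (?i \<otimes>\<^bsub>V\<^esub> lunit_arr V A \<otimes>\<^bsub>V\<^esub> ?b)"
    by (rule cancel_left) (use A B in simp_all)
  then have "?i \<otimes>\<^bsub>V\<^esub> (assoc_arr V ?I A B \<cdot>\<^bsub>V\<^esub> lunit_arr V (tenO V A B)) = ?i \<otimes>\<^bsub>V\<^esub> lunit_arr V A \<otimes>\<^bsub>V\<^esub> ?b"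
    by (rule cancel_left[OF _ z]) (use A B in simp_all)
  then show ?thesis by (rule unit_ten_faithful) (use A B in simp_all)
qed

text \<open>
  By naturality, \<open>l\<close> at \<open>I \<otimes> I\<close> is \<open>I \<otimes> l\<^sub>I\<close>. Hence \<open>l\<^sub>I \<otimes> I\<close> and \<open>r\<^sub>I \<otimes> I\<close> are both equal to the associator followed
  by \<open>I \<otimes> l\<^sub>I\<close>, and tensoring with \<open>I\<close> on the right is faithful.
\<close>

lemma lunit_unit_eq_runit_unit: "lunit_arr V (munit V) = runit_arr V (munit V)"
proof -
  let ?I = "munit V" and ?i = "one V (munit V)"
  obtain y where y: "inverse_pair (lunit_arr V ?I) y" by (meson lunit_inverse munit_obj)
  have "(?i \<otimes>\<^bsub>V\<^esub> lunit_arr V ?I) \<cdot>\<^bsub>V\<^esub> lunit_arr V ?I = lunit_arr V (tenO V ?I ?I) \<cdot>\<^bsub>V\<^esub> lunit_arr V ?I"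
    using lunit_natural[of "lunit_arr V ?I"] by simp
  then have "?i \<otimes>\<^bsub>V\<^esub> lunit_arr V ?I = lunit_arr V (tenO V ?I ?I)" by (rule cancel_right[OF _ y]) simp_all
  then have "lunit_arr V ?I \<otimes>\<^bsub>V\<^esub> ?i = runit_arr V ?I \<otimes>\<^bsub>V\<^esub> ?i"
    using lunit_ten[of ?I ?I] assoc_triangle[of ?I ?I] by simp
  then show ?thesis by (rule ten_unit_faithful) simp_all
qed

lemma unit_split_inverse: "inverse_pair (lunit_arr V (munit V)) (unit_split_arr V)"
  using inv_arr_inverse[OF mlunit_iso[OF munit_obj]]
  by (simp add: lunit_arr_def unit_split_arr_def unit_split_def)

lemma arr_unit_split [simp]: "arr V (unit_split_arr V)"
  and unit_split_lunit: "unit_split_arr V \<cdot>\<^bsub>V\<^esub> lunit_arr V (munit V) = one V (munit V)"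
  and lunit_unit_split: "lunit_arr V (munit V) \<cdot>\<^bsub>V\<^esub> unit_split_arr V = one V (tenO V (munit V) (munit V))"
  using unit_split_inverse by (simp_all add: inverse_pair_def)

text \<open>
  Postcomposing with the isomorphism \<open>I \<otimes> l\<^sub>I\<close> reduces this to the triangle identity, using \<open>l\<^sub>I = r\<^sub>I\<close>.
\<close>

lemma unit_split_coassoc:
  "(unit_split_arr V \<otimes>\<^bsub>V\<^esub> one V (munit V)) \<cdot>\<^bsub>V\<^esub> assoc_arr V (munit V) (munit V) (munit V)
    = one V (munit V) \<otimes>\<^bsub>V\<^esub> unit_split_arr V"
proof (rule cancel_right)
  let ?i = "one V (munit V)"
  show "inverse_pair (?i \<otimes>\<^bsub>V\<^esub> lunit_arr V (munit V)) (?i \<otimes>\<^bsub>V\<^esub> unit_split_arr V)"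
    by (simp add: inverse_ten inverse_one unit_split_inverse)
  show "((unit_split_arr V \<otimes>\<^bsub>V\<^esub> ?i) \<cdot>\<^bsub>V\<^esub> assoc_arr V (munit V) (munit V) (munit V)) \<cdot>\<^bsub>V\<^esub> (?i \<otimes>\<^bsub>V\<^esub> lunit_arr V (munit V))
      = (?i \<otimes>\<^bsub>V\<^esub> unit_split_arr V) \<cdot>\<^bsub>V\<^esub> (?i \<otimes>\<^bsub>V\<^esub> lunit_arr V (munit V))"
    by (simp add: assoc_triangle interchange unit_split_lunit flip: lunit_unit_eq_runit_unit)
qed simp_all

end

text \<open>
  Conversely, the axioms of a category, and below those of a monoidal category, may be verified on triples. This is how
  underlying categories and Kleisli categories are treated.
\<close>

lemma category_arrI:
  assumes "\<And>A. A \<in> obj C \<Longrightarrow> arr C (one C A)"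
    and "\<And>x y. \<lbrakk>arr C x; arr C y; tgt x = src y\<rbrakk> \<Longrightarrow> arr C (x \<cdot>\<^bsub>C\<^esub> y)"
    and "\<And>x. arr C x \<Longrightarrow> one C (src x) \<cdot>\<^bsub>C\<^esub> x = x"
    and "\<And>x. arr C x \<Longrightarrow> x \<cdot>\<^bsub>C\<^esub> one C (tgt x) = x"
    and "\<And>x y z. \<lbrakk>arr C x; arr C y; arr C z; tgt x = src y; tgt y = src z\<rbrakk>
      \<Longrightarrow> (x \<cdot>\<^bsub>C\<^esub> y) \<cdot>\<^bsub>C\<^esub> z = x \<cdot>\<^bsub>C\<^esub> y \<cdot>\<^bsub>C\<^esub> z"
  shows "category C"
proof
  fix A B D E f g h
  assume obj: "A \<in> obj C" "B \<in> obj C" "D \<in> obj C" "E \<in> obj C"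
  show "idn C A \<in> hom C A A" using assms(1)[of A] obj by (simp add: arr_triple one_def)
  assume f: "f \<in> hom C A B"
  show "cmp C A A B (idn C A) f = f" using assms(3)[of "(A, f, B)"] obj f by (simp add: arr_triple one_def)
  show "cmp C A B B f (idn C B) = f" using assms(4)[of "(A, f, B)"] obj f by (simp add: arr_triple one_def)
  assume g: "g \<in> hom C B D"
  show "cmp C A B D f g \<in> hom C A D"
    using assms(2)[of "(A, f, B)" "(B, g, D)"] obj f g by (simp add: arr_triple)
  assume h: "h \<in> hom C D E"
  show "cmp C A D E (cmp C A B D f g) h = cmp C A B E f (cmp C B D E g h)"
    using assms(5)[of "(A, f, B)" "(B, g, D)" "(D, h, E)"] obj f g h by (simp add: arr_triple)
qed

lemma (in category) is_isoI:
  assumes "inverse_pair (A, f, B) y" "A \<in> obj C" "B \<in> obj C"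
  shows "is_iso C A B f"
proof -
  have "y = (B, mor y, A)" using assms(1) by (cases y rule: triple_cases) (simp add: inverse_pair_def)
  then have "inverse_arrows C A B f (mor y)" using assms by (metis inverse_triple)
  then show ?thesis by (auto simp: is_iso_def)
qed

lemma monoidal_category_arrI:
  assumes "category V"
    and unit: "munit V \<in> obj V"
    and obj: "\<And>A B. \<lbrakk>A \<in> obj V; B \<in> obj V\<rbrakk> \<Longrightarrow> tenO V A B \<in> obj V"
    and arr: "\<And>x y. \<lbrakk>arr V x; arr V y\<rbrakk> \<Longrightarrow> arr V (x \<otimes>\<^bsub>V\<^esub> y)"
    and one: "\<And>A B. \<lbrakk>A \<in> obj V; B \<in> obj V\<rbrakk> \<Longrightarrow> one V A \<otimes>\<^bsub>V\<^esub> one V B = one V (tenO V A B)"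
    and interchange: "\<And>f g f' g'. \<lbrakk>arr V f; arr V g; arr V f'; arr V g'; tgt f = src g; tgt f' = src g'\<rbrakk>
      \<Longrightarrow> (f \<cdot>\<^bsub>V\<^esub> g) \<otimes>\<^bsub>V\<^esub> (f' \<cdot>\<^bsub>V\<^esub> g') = (f \<otimes>\<^bsub>V\<^esub> f') \<cdot>\<^bsub>V\<^esub> (g \<otimes>\<^bsub>V\<^esub> g')"
    and assoc_arr: "\<And>A B D. \<lbrakk>A \<in> obj V; B \<in> obj V; D \<in> obj V\<rbrakk> \<Longrightarrow> \<exists>y. category.inverse_pair V (assoc_arr V A B D) y"
    and runit_arr: "\<And>A. A \<in> obj V \<Longrightarrow> \<exists>y. category.inverse_pair V (runit_arr V A) y"
    and lunit_arr: "\<And>A. A \<in> obj V \<Longrightarrow> \<exists>y. category.inverse_pair V (lunit_arr V A) y"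
    and assoc_natural: "\<And>f g h. \<lbrakk>arr V f; arr V g; arr V h\<rbrakk>
      \<Longrightarrow> ((f \<otimes>\<^bsub>V\<^esub> g) \<otimes>\<^bsub>V\<^esub> h) \<cdot>\<^bsub>V\<^esub> assoc_arr V (tgt f) (tgt g) (tgt h)
        = assoc_arr V (src f) (src g) (src h) \<cdot>\<^bsub>V\<^esub> (f \<otimes>\<^bsub>V\<^esub> g \<otimes>\<^bsub>V\<^esub> h)"
    and runit_natural: "\<And>f. arr V f \<Longrightarrow> (f \<otimes>\<^bsub>V\<^esub> one V (munit V)) \<cdot>\<^bsub>V\<^esub> runit_arr V (tgt f) = runit_arr V (src f) \<cdot>\<^bsub>V\<^esub> f"
    and lunit_natural: "\<And>f. arr V f \<Longrightarrow> (one V (munit V) \<otimes>\<^bsub>V\<^esub> f) \<cdot>\<^bsub>V\<^esub> lunit_arr V (tgt f) = lunit_arr V (src f) \<cdot>\<^bsub>V\<^esub> f"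
    and pentagon: "\<And>A B D E. \<lbrakk>A \<in> obj V; B \<in> obj V; D \<in> obj V; E \<in> obj V\<rbrakk>
      \<Longrightarrow> assoc_arr V (tenO V A B) D E \<cdot>\<^bsub>V\<^esub> assoc_arr V A B (tenO V D E)
        = (assoc_arr V A B D \<otimes>\<^bsub>V\<^esub> one V E) \<cdot>\<^bsub>V\<^esub> assoc_arr V A (tenO V B D) E \<cdot>\<^bsub>V\<^esub> (one V A \<otimes>\<^bsub>V\<^esub> assoc_arr V B D E)"
    and triangle: "\<And>A B. \<lbrakk>A \<in> obj V; B \<in> obj V\<rbrakk>
      \<Longrightarrow> assoc_arr V A (munit V) B \<cdot>\<^bsub>V\<^esub> (one V A \<otimes>\<^bsub>V\<^esub> lunit_arr V B) = runit_arr V A \<otimes>\<^bsub>V\<^esub> one V B"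
  shows "monoidal_category V"
proof -
  interpret category V by fact
  show ?thesis
  proof (unfold_locales, goal_cases)
    case 1 show ?case by (fact unit)
  next
    case 2 then show ?case by (rule obj)
  next
    case (3 A B A' B' f f')
    then show ?case using arr[of "(A, f, B)" "(A', f', B')"] by (simp add: arr_triple)
  next
    case (4 A A') then show ?case using one[of A A'] by (simp add: one_def)
  next
    case (5 A B D A' B' D' f g f' g')
    then show ?case using interchange[of "(A, f, B)" "(B, g, D)" "(A', f', B')" "(B', g', D')"]
      by (simp add: arr_triple)
  next
    case (6 A B D)
    then show ?case using assoc_arr[of A B D] obj by (auto simp: assoc_arr_def intro: is_isoI)
  next
    case (7 A) then show ?case using runit_arr[of A] obj unit by (auto simp: runit_arr_def intro: is_isoI)
  next
    case (8 A) then show ?case using lunit_arr[of A] obj unit by (auto simp: lunit_arr_def intro: is_isoI)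
  next
    case (9 A B D A' B' D' f g h)
    then show ?case using assoc_natural[of "(A, f, A')" "(B, g, B')" "(D, h, D')"]
      by (simp add: arr_triple assoc_arr_def)
  next
    case (10 A B f) then show ?case using runit_natural[of "(A, f, B)"] by (simp add: arr_triple runit_arr_def one_def)
  next
    case (11 A B f) then show ?case using lunit_natural[of "(A, f, B)"] by (simp add: arr_triple lunit_arr_def one_def)
  next
    case (12 A B D E) then show ?case using pentagon[of A B D E] by (simp add: assoc_arr_def one_def)
  next
    case (13 A B) then show ?case using triangle[of A B] by (simp add: assoc_arr_def one_def lunit_arr_def runit_arr_def)
  qed
qed

section \<open>Enriched categories and their underlying categories\<close>

definition comp_arr :: "('v, 'm, 'x) moncat_scheme \<Rightarrow> ('a, 'v, 'm) ecat \<Rightarrow> 'a \<Rightarrow> 'a \<Rightarrow> 'a \<Rightarrow> ('v, 'm) arrow" where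
  "comp_arr V C X Y Z = (tenO V (ehom C X Y) (ehom C Y Z), ecomp C X Y Z, ehom C X Z)"

definition id_arr :: "('v, 'm, 'x) moncat_scheme \<Rightarrow> ('a, 'v, 'm) ecat \<Rightarrow> 'a \<Rightarrow> ('v, 'm) arrow" where
  "id_arr V C X = (munit V, eid C X, ehom C X X)"

lemma comp_id_arr_src_tgt [simp]:
  "src (comp_arr V C X Y Z) = tenO V (ehom C X Y) (ehom C Y Z)" "tgt (comp_arr V C X Y Z) = ehom C X Z"
  "src (id_arr V C X) = munit V" "tgt (id_arr V C X) = ehom C X X"
  by (simp_all add: comp_arr_def id_arr_def)

context enriched_category
begin

declare ehom_obj [simp]

lemma arr_comp_arr [simp]:
  "\<lbrakk>X \<in> eobj C; Y \<in> eobj C; Z \<in> eobj C\<rbrakk> \<Longrightarrow> arr V (comp_arr V C X Y Z)"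
  by (simp add: comp_arr_def arr_triple ecomp_hom)

lemma arr_id_arr [simp]: "X \<in> eobj C \<Longrightarrow> arr V (id_arr V C X)"
  by (simp add: id_arr_def arr_triple eid_hom)

lemma comp_arr_assoc:
  "\<lbrakk>X \<in> eobj C; Y \<in> eobj C; Z \<in> eobj C; T \<in> eobj C\<rbrakk>
    \<Longrightarrow> (comp_arr V C X Y Z \<otimes>\<^bsub>V\<^esub> one V (ehom C Z T)) \<cdot>\<^bsub>V\<^esub> comp_arr V C X Z T
      = assoc_arr V (ehom C X Y) (ehom C Y Z) (ehom C Z T) \<cdot>\<^bsub>V\<^esub>
        (one V (ehom C X Y) \<otimes>\<^bsub>V\<^esub> comp_arr V C Y Z T) \<cdot>\<^bsub>V\<^esub> comp_arr V C X Y T"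
  by (simp add: comp_arr_def assoc_arr_def one_def ecomp_assoc)

lemma id_comp_arr:
  "\<lbrakk>X \<in> eobj C; Y \<in> eobj C\<rbrakk>
    \<Longrightarrow> (id_arr V C X \<otimes>\<^bsub>V\<^esub> one V (ehom C X Y)) \<cdot>\<^bsub>V\<^esub> comp_arr V C X X Y = lunit_arr V (ehom C X Y)"
  by (simp add: comp_arr_def id_arr_def lunit_arr_def one_def eid_ecomp)

lemma comp_id_arr:
  "\<lbrakk>X \<in> eobj C; Y \<in> eobj C\<rbrakk>
    \<Longrightarrow> (one V (ehom C X Y) \<otimes>\<^bsub>V\<^esub> id_arr V C Y) \<cdot>\<^bsub>V\<^esub> comp_arr V C X Y Y = runit_arr V (ehom C X Y)"
  by (simp add: comp_arr_def id_arr_def runit_arr_def one_def ecomp_eid)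

text \<open>
  The associativity and unit axioms of an enriched category, generalised from identities to arbitrary arrows into the
  hom-objects. Associativity of composition in the underlying category and of horizontal composition of parametrised arrows
  are both read off from this.
\<close>

lemma comp_arr_ten_assoc:
  assumes obj: "X \<in> eobj C" "Y \<in> eobj C" "Z \<in> eobj C" "T \<in> eobj C"
    and arr: "arr V f" "arr V g" "arr V h"
    and tgt: "tgt f = ehom C X Y" "tgt g = ehom C Y Z" "tgt h = ehom C Z T"
  shows "(((f \<otimes>\<^bsub>V\<^esub> g) \<cdot>\<^bsub>V\<^esub> comp_arr V C X Y Z) \<otimes>\<^bsub>V\<^esub> h) \<cdot>\<^bsub>V\<^esub> comp_arr V C X Z T
    = assoc_arr V (src f) (src g) (src h) \<cdot>\<^bsub>V\<^esub>
      (f \<otimes>\<^bsub>V\<^esub> ((g \<otimes>\<^bsub>V\<^esub> h) \<cdot>\<^bsub>V\<^esub> comp_arr V C Y Z T)) \<cdot>\<^bsub>V\<^esub> comp_arr V C X Y T"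
proof -
  have "(((f \<otimes>\<^bsub>V\<^esub> g) \<cdot>\<^bsub>V\<^esub> comp_arr V C X Y Z) \<otimes>\<^bsub>V\<^esub> h) \<cdot>\<^bsub>V\<^esub> comp_arr V C X Z T
      = ((f \<otimes>\<^bsub>V\<^esub> g) \<otimes>\<^bsub>V\<^esub> h) \<cdot>\<^bsub>V\<^esub> (comp_arr V C X Y Z \<otimes>\<^bsub>V\<^esub> one V (ehom C Z T)) \<cdot>\<^bsub>V\<^esub> comp_arr V C X Z T"
    using assms by (simp add: V.interchange_seq)
  also have "\<dots> = ((f \<otimes>\<^bsub>V\<^esub> g) \<otimes>\<^bsub>V\<^esub> h) \<cdot>\<^bsub>V\<^esub> assoc_arr V (tgt f) (tgt g) (tgt h) \<cdot>\<^bsub>V\<^esub>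
        (one V (ehom C X Y) \<otimes>\<^bsub>V\<^esub> comp_arr V C Y Z T) \<cdot>\<^bsub>V\<^esub> comp_arr V C X Y T"
    using obj by (simp add: comp_arr_assoc tgt)
  also have "\<dots> = (assoc_arr V (src f) (src g) (src h) \<cdot>\<^bsub>V\<^esub> (f \<otimes>\<^bsub>V\<^esub> g \<otimes>\<^bsub>V\<^esub> h)) \<cdot>\<^bsub>V\<^esub>
        (one V (ehom C X Y) \<otimes>\<^bsub>V\<^esub> comp_arr V C Y Z T) \<cdot>\<^bsub>V\<^esub> comp_arr V C X Y T"
    by (rule V.seq_eq_seq[OF V.assoc_natural]) (use assms in simp_all)
  also have "\<dots> = assoc_arr V (src f) (src g) (src h) \<cdot>\<^bsub>V\<^esub>
      (f \<otimes>\<^bsub>V\<^esub> ((g \<otimes>\<^bsub>V\<^esub> h) \<cdot>\<^bsub>V\<^esub> comp_arr V C Y Z T)) \<cdot>\<^bsub>V\<^esub> comp_arr V C X Y T"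
    using assms by (simp add: V.interchange_seq)
  finally show ?thesis .
qed

lemma id_ten_comp_arr:
  assumes "X \<in> eobj C" "Y \<in> eobj C" "arr V f" "tgt f = ehom C X Y"
  shows "(id_arr V C X \<otimes>\<^bsub>V\<^esub> f) \<cdot>\<^bsub>V\<^esub> comp_arr V C X X Y = lunit_arr V (src f) \<cdot>\<^bsub>V\<^esub> f"
proof -
  have "(id_arr V C X \<otimes>\<^bsub>V\<^esub> f) \<cdot>\<^bsub>V\<^esub> comp_arr V C X X Y
      = (one V (munit V) \<otimes>\<^bsub>V\<^esub> f) \<cdot>\<^bsub>V\<^esub> (id_arr V C X \<otimes>\<^bsub>V\<^esub> one V (tgt f)) \<cdot>\<^bsub>V\<^esub> comp_arr V C X X Y"
    using assms by (simp add: V.interchange_seq)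
  then show ?thesis using assms V.lunit_natural[of f] by (simp add: id_comp_arr)
qed

lemma ten_id_comp_arr:
  assumes "X \<in> eobj C" "Y \<in> eobj C" "arr V f" "tgt f = ehom C X Y"
  shows "(f \<otimes>\<^bsub>V\<^esub> id_arr V C Y) \<cdot>\<^bsub>V\<^esub> comp_arr V C X Y Y = runit_arr V (src f) \<cdot>\<^bsub>V\<^esub> f"
proof -
  have "(f \<otimes>\<^bsub>V\<^esub> id_arr V C Y) \<cdot>\<^bsub>V\<^esub> comp_arr V C X Y Y
      = (f \<otimes>\<^bsub>V\<^esub> one V (munit V)) \<cdot>\<^bsub>V\<^esub> (one V (tgt f) \<otimes>\<^bsub>V\<^esub> id_arr V C Y) \<cdot>\<^bsub>V\<^esub> comp_arr V C X Y Y"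
    using assms by (simp add: V.interchange_seq)
  then show ?thesis using assms V.runit_natural[of f] by (simp add: comp_id_arr)
qed

text \<open>
  The two ways of splitting \<open>I\<close> into three factors agree up to the associator, and this is the associator that
  occurs in the associativity of enriched composition.
\<close>

lemma underlying_comp_assoc:
  assumes obj: "X \<in> eobj C" "Y \<in> eobj C" "Z \<in> eobj C" "T \<in> eobj C"
    and arr: "arr V f" "arr V g" "arr V h"
    and src: "src f = munit V" "src g = munit V" "src h = munit V"
    and tgt: "tgt f = ehom C X Y" "tgt g = ehom C Y Z" "tgt h = ehom C Z T"
  shows "unit_split_arr V \<cdot>\<^bsub>V\<^esub> ((unit_split_arr V \<cdot>\<^bsub>V\<^esub> (f \<otimes>\<^bsub>V\<^esub> g) \<cdot>\<^bsub>V\<^esub> comp_arr V C X Y Z) \<otimes>\<^bsub>V\<^esub> h) \<cdot>\<^bsub>V\<^esub> comp_arr V C X Z T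
    = unit_split_arr V \<cdot>\<^bsub>V\<^esub> (f \<otimes>\<^bsub>V\<^esub> (unit_split_arr V \<cdot>\<^bsub>V\<^esub> (g \<otimes>\<^bsub>V\<^esub> h) \<cdot>\<^bsub>V\<^esub> comp_arr V C Y Z T)) \<cdot>\<^bsub>V\<^esub> comp_arr V C X Y T"
proof -
  let ?s = "unit_split_arr V" and ?i = "one V (munit V)"
  let ?fg = "(f \<otimes>\<^bsub>V\<^esub> g) \<cdot>\<^bsub>V\<^esub> comp_arr V C X Y Z" and ?gh = "(g \<otimes>\<^bsub>V\<^esub> h) \<cdot>\<^bsub>V\<^esub> comp_arr V C Y Z T"
  have "((?s \<cdot>\<^bsub>V\<^esub> ?fg) \<otimes>\<^bsub>V\<^esub> h) \<cdot>\<^bsub>V\<^esub> comp_arr V C X Z T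
      = (?s \<otimes>\<^bsub>V\<^esub> ?i) \<cdot>\<^bsub>V\<^esub> (?fg \<otimes>\<^bsub>V\<^esub> h) \<cdot>\<^bsub>V\<^esub> comp_arr V C X Z T"
    using assms by (simp add: V.interchange_seq)
  also have "\<dots> = ((?s \<otimes>\<^bsub>V\<^esub> ?i) \<cdot>\<^bsub>V\<^esub> assoc_arr V (munit V) (munit V) (munit V)) \<cdot>\<^bsub>V\<^esub> (f \<otimes>\<^bsub>V\<^esub> ?gh) \<cdot>\<^bsub>V\<^esub> comp_arr V C X Y T"
    using assms by (simp add: comp_arr_ten_assoc)
  also have "\<dots> = (?i \<otimes>\<^bsub>V\<^esub> ?s) \<cdot>\<^bsub>V\<^esub> (f \<otimes>\<^bsub>V\<^esub> ?gh) \<cdot>\<^bsub>V\<^esub> comp_arr V C X Y T"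
    by (simp add: V.unit_split_coassoc)
  also have "\<dots> = (f \<otimes>\<^bsub>V\<^esub> (?s \<cdot>\<^bsub>V\<^esub> ?gh)) \<cdot>\<^bsub>V\<^esub> comp_arr V C X Y T"
    using assms by (simp add: V.interchange_seq)
  finally show ?thesis by simp
qed

lemma underlying_simps:
  "obj (underlying V C) = eobj C"
  "f \<in> hom (underlying V C) X Y \<longleftrightarrow> f \<in> hom V (munit V) (ehom C X Y)"
  by (simp_all add: underlying_def)

text \<open>
  The arrow \<open>I \<rightarrow> \<C>(X,Y)\<close> of the base that represents an arrow \<open>X \<rightarrow> Y\<close> of the underlying category. The translation of
  composition along it (\<open>hom_arr_seq\<close>) reduces the laws of the underlying category to equations in the base.
\<close>

definition hom_arr :: "('a, 'm) arrow \<Rightarrow> ('v, 'm) arrow" where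
  "hom_arr x = (munit V, mor x, ehom C (src x) (tgt x))"

lemma hom_arr_src_tgt [simp]: "src (hom_arr x) = munit V" "tgt (hom_arr x) = ehom C (src x) (tgt x)"
  by (simp_all add: hom_arr_def)

lemma hom_arr_one [simp]: "hom_arr (one (underlying V C) X) = id_arr V C X"
  by (simp add: hom_arr_def underlying_def one_def id_arr_def)

lemma hom_arr_seq [simp]:
  "tgt x = src y \<Longrightarrow> hom_arr (x \<cdot>\<^bsub>underlying V C\<^esub> y)
    = unit_split_arr V \<cdot>\<^bsub>V\<^esub> (hom_arr x \<otimes>\<^bsub>V\<^esub> hom_arr y) \<cdot>\<^bsub>V\<^esub> comp_arr V C (src x) (tgt x) (tgt y)"
  by (cases x rule: triple_cases, cases y rule: triple_cases)
    (simp add: hom_arr_def underlying_def unit_split_arr_def comp_arr_def)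

lemma arr_underlying:
  "arr (underlying V C) x \<longleftrightarrow> src x \<in> eobj C \<and> tgt x \<in> eobj C \<and> arr V (hom_arr x)"
  by (cases x rule: triple_cases) (auto simp: hom_arr_def underlying_simps arr_triple)

lemma hom_arr_eqI:
  "\<lbrakk>src x = src y; tgt x = tgt y; hom_arr x = hom_arr y\<rbrakk> \<Longrightarrow> x = y"
  by (cases x rule: triple_cases, cases y rule: triple_cases) (simp add: hom_arr_def)

theorem underlying_category: "category (underlying V C)"
proof (rule category_arrI)
  fix A assume "A \<in> obj (underlying V C)"
  then show "arr (underlying V C) (one (underlying V C) A)"
    by (simp add: arr_underlying underlying_simps)
next
  fix x y assume "arr (underlying V C) x" "arr (underlying V C) y" "tgt x = src y"
  then show "arr (underlying V C) (x \<cdot>\<^bsub>underlying V C\<^esub> y)"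
    by (simp add: arr_underlying)
next
  fix x assume x: "arr (underlying V C) x"
  then have "unit_split_arr V \<cdot>\<^bsub>V\<^esub> (id_arr V C (src x) \<otimes>\<^bsub>V\<^esub> hom_arr x) \<cdot>\<^bsub>V\<^esub> comp_arr V C (src x) (src x) (tgt x) = hom_arr x"
    by (simp add: arr_underlying id_ten_comp_arr V.seq_eq_seq[OF V.unit_split_lunit])
  then show "one (underlying V C) (src x) \<cdot>\<^bsub>underlying V C\<^esub> x = x"
    by (intro hom_arr_eqI) simp_all
  have "unit_split_arr V \<cdot>\<^bsub>V\<^esub> (hom_arr x \<otimes>\<^bsub>V\<^esub> id_arr V C (tgt x)) \<cdot>\<^bsub>V\<^esub> comp_arr V C (src x) (tgt x) (tgt x) = hom_arr x"
    using x by (simp add: arr_underlying ten_id_comp_arr V.seq_eq_seq[OF V.unit_split_lunit] flip: V.lunit_unit_eq_runit_unit)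
  then show "x \<cdot>\<^bsub>underlying V C\<^esub> one (underlying V C) (tgt x) = x"
    by (intro hom_arr_eqI) simp_all
next
  fix x y z
  assume "arr (underlying V C) x" "arr (underlying V C) y" "arr (underlying V C) z" "tgt x = src y" "tgt y = src z"
  then show "(x \<cdot>\<^bsub>underlying V C\<^esub> y) \<cdot>\<^bsub>underlying V C\<^esub> z = x \<cdot>\<^bsub>underlying V C\<^esub> y \<cdot>\<^bsub>underlying V C\<^esub> z"
    by (intro hom_arr_eqI) (simp_all add: arr_underlying underlying_comp_assoc)
qed

end

lemma enriched_category_arrI:
  assumes "monoidal_category V"
    and hom: "\<And>X Y. \<lbrakk>X \<in> eobj C; Y \<in> eobj C\<rbrakk> \<Longrightarrow> ehom C X Y \<in> obj V"
    and comp: "\<And>X Y Z. \<lbrakk>X \<in> eobj C; Y \<in> eobj C; Z \<in> eobj C\<rbrakk> \<Longrightarrow> arr V (comp_arr V C X Y Z)"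
    and id: "\<And>X. X \<in> eobj C \<Longrightarrow> arr V (id_arr V C X)"
    and assoc: "\<And>X Y Z T. \<lbrakk>X \<in> eobj C; Y \<in> eobj C; Z \<in> eobj C; T \<in> eobj C\<rbrakk>
      \<Longrightarrow> (comp_arr V C X Y Z \<otimes>\<^bsub>V\<^esub> one V (ehom C Z T)) \<cdot>\<^bsub>V\<^esub> comp_arr V C X Z T
        = assoc_arr V (ehom C X Y) (ehom C Y Z) (ehom C Z T) \<cdot>\<^bsub>V\<^esub>
          (one V (ehom C X Y) \<otimes>\<^bsub>V\<^esub> comp_arr V C Y Z T) \<cdot>\<^bsub>V\<^esub> comp_arr V C X Y T"
    and lunit: "\<And>X Y. \<lbrakk>X \<in> eobj C; Y \<in> eobj C\<rbrakk>
      \<Longrightarrow> (id_arr V C X \<otimes>\<^bsub>V\<^esub> one V (ehom C X Y)) \<cdot>\<^bsub>V\<^esub> comp_arr V C X X Y = lunit_arr V (ehom C X Y)"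
    and runit: "\<And>X Y. \<lbrakk>X \<in> eobj C; Y \<in> eobj C\<rbrakk>
      \<Longrightarrow> (one V (ehom C X Y) \<otimes>\<^bsub>V\<^esub> id_arr V C Y) \<cdot>\<^bsub>V\<^esub> comp_arr V C X Y Y = runit_arr V (ehom C X Y)"
  shows "enriched_category V C"
proof -
  interpret monoidal_category V by fact
  show ?thesis
  proof (unfold_locales, goal_cases)
    case 1 then show ?case by (rule hom)
  next
    case (2 X Y Z) then show ?case using comp[of X Y Z] by (simp add: arr_triple comp_arr_def)
  next
    case (3 X) then show ?case using id[of X] by (simp add: arr_triple id_arr_def)
  next
    case (4 X Y Z T) then show ?case using assoc[of X Y Z T] by (simp add: comp_arr_def assoc_arr_def one_def)
  next
    case (5 X Y) then show ?case using lunit[of X Y] by (simp add: comp_arr_def id_arr_def lunit_arr_def one_def)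
  next
    case (6 X Y) then show ?case using runit[of X Y] by (simp add: comp_arr_def id_arr_def runit_arr_def one_def)
  qed
qed

section \<open>Lax monoidal functors and change of base\<close>

definition fmap :: "('o1, 'm1, 'o2, 'm2, 'z) func_scheme \<Rightarrow> ('o1, 'm1) arrow \<Rightarrow> ('o2, 'm2) arrow" where
  "fmap F x = (fobj F (src x), farr F (src x) (tgt x) (mor x), fobj F (tgt x))"

definition eps_arr :: "('o1, 'm1, 'x) moncat_scheme \<Rightarrow> ('o2, 'm2, 'y) moncat_scheme
    \<Rightarrow> ('o1, 'm1, 'o2, 'm2, 'z) laxfunc_scheme \<Rightarrow> ('o2, 'm2) arrow" where
  "eps_arr V W F = (munit W, feps F, fobj F (munit V))"

definition mul_arr :: "('o1, 'm1, 'x) moncat_scheme \<Rightarrow> ('o2, 'm2, 'y) moncat_scheme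
    \<Rightarrow> ('o1, 'm1, 'o2, 'm2, 'z) laxfunc_scheme \<Rightarrow> 'o1 \<Rightarrow> 'o1 \<Rightarrow> ('o2, 'm2) arrow" where
  "mul_arr V W F A B = (tenO W (fobj F A) (fobj F B), fmul F A B, fobj F (tenO V A B))"

lemma fmap_src_tgt [simp]: "src (fmap F x) = fobj F (src x)" "tgt (fmap F x) = fobj F (tgt x)"
  by (simp_all add: fmap_def)

lemma lax_src_tgt [simp]:
  "src (eps_arr V W F) = munit W" "tgt (eps_arr V W F) = fobj F (munit V)"
  "src (mul_arr V W F A B) = tenO W (fobj F A) (fobj F B)" "tgt (mul_arr V W F A B) = fobj F (tenO V A B)"
  by (simp_all add: eps_arr_def mul_arr_def)

context cat_functor
begin

declare fobj_obj [simp]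

lemma arr_fmap [simp]: "arr C x \<Longrightarrow> arr D (fmap F x)"
  by (cases x rule: triple_cases) (simp add: fmap_def arr_triple farr_hom)

lemma fmap_one [simp]: "A \<in> obj C \<Longrightarrow> fmap F (one C A) = one D (fobj F A)"
  by (simp add: fmap_def one_def farr_idn)

lemma fmap_seq: "\<lbrakk>arr C x; arr C y; tgt x = src y\<rbrakk> \<Longrightarrow> fmap F (x \<cdot>\<^bsub>C\<^esub> y) = fmap F x \<cdot>\<^bsub>D\<^esub> fmap F y"
  by (cases x rule: triple_cases, cases y rule: triple_cases) (simp add: fmap_def arr_triple farr_cmp)

end

context lax_monoidal_functor
begin

lemma arr_eps [simp]: "arr W (eps_arr V W F)"
  by (simp add: eps_arr_def arr_triple feps_hom)

lemma arr_mul [simp]: "\<lbrakk>A \<in> obj V; B \<in> obj V\<rbrakk> \<Longrightarrow> arr W (mul_arr V W F A B)"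
  by (simp add: mul_arr_def arr_triple fmul_hom)

lemma mul_natural:
  "\<lbrakk>arr V f; arr V g; tgt f = A; tgt g = B\<rbrakk>
    \<Longrightarrow> (fmap F f \<otimes>\<^bsub>W\<^esub> fmap F g) \<cdot>\<^bsub>W\<^esub> mul_arr V W F A B
      = mul_arr V W F (src f) (src g) \<cdot>\<^bsub>W\<^esub> fmap F (f \<otimes>\<^bsub>V\<^esub> g)"
  by (cases f rule: triple_cases, cases g rule: triple_cases)
    (auto simp: arr_triple mul_arr_def fmap_def fmul_natural)

lemma mul_assoc:
  "\<lbrakk>A \<in> obj V; B \<in> obj V; D \<in> obj V\<rbrakk>
    \<Longrightarrow> (mul_arr V W F A B \<otimes>\<^bsub>W\<^esub> one W (fobj F D)) \<cdot>\<^bsub>W\<^esub> mul_arr V W F (tenO V A B) D \<cdot>\<^bsub>W\<^esub> fmap F (assoc_arr V A B D)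
      = assoc_arr W (fobj F A) (fobj F B) (fobj F D) \<cdot>\<^bsub>W\<^esub>
        (one W (fobj F A) \<otimes>\<^bsub>W\<^esub> mul_arr V W F B D) \<cdot>\<^bsub>W\<^esub> mul_arr V W F A (tenO V B D)"
  by (simp add: mul_arr_def one_def assoc_arr_def fmap_def fmul_assoc)

lemma mul_runit:
  "A \<in> obj V \<Longrightarrow> (one W (fobj F A) \<otimes>\<^bsub>W\<^esub> eps_arr V W F) \<cdot>\<^bsub>W\<^esub> mul_arr V W F A (munit V) \<cdot>\<^bsub>W\<^esub> fmap F (runit_arr V A)
    = runit_arr W (fobj F A)"
  by (simp add: mul_arr_def eps_arr_def one_def runit_arr_def fmap_def fmul_runit)

lemma mul_lunit:
  "A \<in> obj V \<Longrightarrow> (eps_arr V W F \<otimes>\<^bsub>W\<^esub> one W (fobj F A)) \<cdot>\<^bsub>W\<^esub> mul_arr V W F (munit V) A \<cdot>\<^bsub>W\<^esub> fmap F (lunit_arr V A)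
    = lunit_arr W (fobj F A)"
  by (simp add: mul_arr_def eps_arr_def one_def lunit_arr_def fmap_def fmul_lunit)

text \<open>
  Compatibility of \<open>F\<^sub>\<epsilon>\<close> with the isomorphism \<open>s : I \<rightarrow> I \<otimes> I\<close> inverse to \<open>l\<close>: insert \<open>F l ; F s\<close>, so that the left unit law of \<open>F\<close> at \<open>I\<close> applies, and move the
  second \<open>F\<^sub>\<epsilon>\<close> past \<open>l\<close> by naturality.
\<close>

lemma eps_ten_eps:
  "(eps_arr V W F \<otimes>\<^bsub>W\<^esub> eps_arr V W F) \<cdot>\<^bsub>W\<^esub> mul_arr V W F (munit V) (munit V)
    = lunit_arr W (munit W) \<cdot>\<^bsub>W\<^esub> eps_arr V W F \<cdot>\<^bsub>W\<^esub> fmap F (unit_split_arr V)"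
proof -
  let ?e = "eps_arr V W F" and ?m = "mul_arr V W F (munit V) (munit V)" and ?I = "munit V"
  have "(?e \<otimes>\<^bsub>W\<^esub> ?e) \<cdot>\<^bsub>W\<^esub> ?m
      = (one W (munit W) \<otimes>\<^bsub>W\<^esub> ?e) \<cdot>\<^bsub>W\<^esub> ((?e \<otimes>\<^bsub>W\<^esub> one W (fobj F ?I)) \<cdot>\<^bsub>W\<^esub> ?m \<cdot>\<^bsub>W\<^esub> fmap F (lunit_arr V ?I)) \<cdot>\<^bsub>W\<^esub> fmap F (unit_split_arr V)"
    by (simp add: W.interchange_seq V.lunit_unit_split flip: fmap_seq)
  also have "\<dots> = ((one W (munit W) \<otimes>\<^bsub>W\<^esub> ?e) \<cdot>\<^bsub>W\<^esub> lunit_arr W (tgt ?e)) \<cdot>\<^bsub>W\<^esub> fmap F (unit_split_arr V)"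
    by (simp add: mul_lunit)
  also have "\<dots> = lunit_arr W (munit W) \<cdot>\<^bsub>W\<^esub> ?e \<cdot>\<^bsub>W\<^esub> fmap F (unit_split_arr V)"
    by (simp only: W.lunit_natural arr_eps) simp
  finally show ?thesis .
qed

text \<open>
  A lax monoidal functor preserves convolutions \<open>I \<cong> I \<otimes> I \<rightarrow> A \<otimes> B \<rightarrow> D\<close>. With \<open>h\<close> the composition of an enriched category this is
  functoriality of \<open>F\<^sub>*\<^sup>0\<close>; with \<open>h\<close> the action of \<open>\<boxtimes>\<close> on hom-objects it is preservation of the monoidal product.
\<close>

lemma lax_convolution:
  assumes "arr V f" "arr V g" "arr V h" "src f = munit V" "src g = munit V" "src h = tenO V (tgt f) (tgt g)"
  shows "unit_split_arr W \<cdot>\<^bsub>W\<^esub> ((eps_arr V W F \<cdot>\<^bsub>W\<^esub> fmap F f) \<otimes>\<^bsub>W\<^esub> (eps_arr V W F \<cdot>\<^bsub>W\<^esub> fmap F g)) \<cdot>\<^bsub>W\<^esub>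
      mul_arr V W F (tgt f) (tgt g) \<cdot>\<^bsub>W\<^esub> fmap F h
    = eps_arr V W F \<cdot>\<^bsub>W\<^esub> fmap F (unit_split_arr V \<cdot>\<^bsub>V\<^esub> (f \<otimes>\<^bsub>V\<^esub> g) \<cdot>\<^bsub>V\<^esub> h)"
proof -
  let ?e = "eps_arr V W F" and ?s = "unit_split_arr W"
  have "((?e \<cdot>\<^bsub>W\<^esub> fmap F f) \<otimes>\<^bsub>W\<^esub> (?e \<cdot>\<^bsub>W\<^esub> fmap F g)) \<cdot>\<^bsub>W\<^esub> mul_arr V W F (tgt f) (tgt g)
      = (?e \<otimes>\<^bsub>W\<^esub> ?e) \<cdot>\<^bsub>W\<^esub> (fmap F f \<otimes>\<^bsub>W\<^esub> fmap F g) \<cdot>\<^bsub>W\<^esub> mul_arr V W F (tgt f) (tgt g)"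
    using assms by (simp add: W.interchange_seq)
  also have "\<dots> = ((?e \<otimes>\<^bsub>W\<^esub> ?e) \<cdot>\<^bsub>W\<^esub> mul_arr V W F (munit V) (munit V)) \<cdot>\<^bsub>W\<^esub> fmap F (f \<otimes>\<^bsub>V\<^esub> g)"
    using assms by (simp add: mul_natural)
  also have "\<dots> = lunit_arr W (munit W) \<cdot>\<^bsub>W\<^esub> ?e \<cdot>\<^bsub>W\<^esub> fmap F (unit_split_arr V) \<cdot>\<^bsub>W\<^esub> fmap F (f \<otimes>\<^bsub>V\<^esub> g)"
    using assms by (simp add: eps_ten_eps)
  finally have "((?e \<cdot>\<^bsub>W\<^esub> fmap F f) \<otimes>\<^bsub>W\<^esub> (?e \<cdot>\<^bsub>W\<^esub> fmap F g)) \<cdot>\<^bsub>W\<^esub> mul_arr V W F (tgt f) (tgt g)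
      = lunit_arr W (munit W) \<cdot>\<^bsub>W\<^esub> ?e \<cdot>\<^bsub>W\<^esub> fmap F (unit_split_arr V \<cdot>\<^bsub>V\<^esub> (f \<otimes>\<^bsub>V\<^esub> g))"
    using assms by (simp add: fmap_seq)
  from W.seq_eq_seq[OF this, of "fmap F h"] show ?thesis
    using assms by (simp add: W.seq_eq_seq[OF W.unit_split_lunit] flip: fmap_seq)
qed

end

text \<open>
  All three axioms follow the same pattern: naturality of \<open>F A \<otimes> F B \<rightarrow> F (A \<otimes> B)\<close> gathers the structure of \<open>\<C>\<close> under \<open>F\<close>, where the
  axiom of \<open>\<C>\<close> applies; the image of the coherence map so obtained is then absorbed by the matching law of \<open>F\<close>.
\<close>

theorem change_base_enriched:
  fixes F :: "('v, 'm, 'w, 'n) laxfunc"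
  assumes "lax_monoidal_functor V W F" and "enriched_category V C"
  shows "enriched_category W (change_base V W F C)"
proof -
  interpret lax_monoidal_functor V W F by fact
  interpret C: enriched_category V C by fact
  let ?C = "change_base V W F C"
  have obj [simp]: "eobj ?C = eobj C" and hom [simp]: "ehom ?C = (\<lambda>X Y. fobj F (ehom C X Y))"
    by (simp_all add: change_base_def)
  have comp [simp]: "comp_arr W ?C X Y Z = mul_arr V W F (ehom C X Y) (ehom C Y Z) \<cdot>\<^bsub>W\<^esub> fmap F (comp_arr V C X Y Z)" for X Y Z
    by (simp add: change_base_def comp_arr_def mul_arr_def fmap_def lax_binary_def)
  have id [simp]: "id_arr W ?C X = eps_arr V W F \<cdot>\<^bsub>W\<^esub> fmap F (id_arr V C X)" for X
    by (simp add: change_base_def id_arr_def eps_arr_def fmap_def lax_nullary_def)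
  \<comment> \<open>The common step: arrows under \<open>F\<close> are moved to the right through \<open>mul_arr\<close>.\<close>
  have ten_comp: "((a \<cdot>\<^bsub>W\<^esub> fmap F f) \<otimes>\<^bsub>W\<^esub> (b \<cdot>\<^bsub>W\<^esub> fmap F g)) \<cdot>\<^bsub>W\<^esub> mul_arr V W F (tgt f) (tgt g) \<cdot>\<^bsub>W\<^esub> fmap F h
      = (a \<otimes>\<^bsub>W\<^esub> b) \<cdot>\<^bsub>W\<^esub> mul_arr V W F (src f) (src g) \<cdot>\<^bsub>W\<^esub> fmap F ((f \<otimes>\<^bsub>V\<^esub> g) \<cdot>\<^bsub>V\<^esub> h)"
    if "arr W a" "arr W b" "arr V f" "arr V g" "arr V h"
      "tgt a = fobj F (src f)" "tgt b = fobj F (src g)" "src h = tenO V (tgt f) (tgt g)" for a b f g h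
  proof -
    have "((a \<cdot>\<^bsub>W\<^esub> fmap F f) \<otimes>\<^bsub>W\<^esub> (b \<cdot>\<^bsub>W\<^esub> fmap F g)) \<cdot>\<^bsub>W\<^esub> mul_arr V W F (tgt f) (tgt g)
        = (a \<otimes>\<^bsub>W\<^esub> b) \<cdot>\<^bsub>W\<^esub> (fmap F f \<otimes>\<^bsub>W\<^esub> fmap F g) \<cdot>\<^bsub>W\<^esub> mul_arr V W F (tgt f) (tgt g)"
      using that by (simp add: W.interchange_seq)
    also have "\<dots> = ((a \<otimes>\<^bsub>W\<^esub> b) \<cdot>\<^bsub>W\<^esub> mul_arr V W F (src f) (src g)) \<cdot>\<^bsub>W\<^esub> fmap F (f \<otimes>\<^bsub>V\<^esub> g)"
      using that by (simp add: mul_natural)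
    finally have "((a \<cdot>\<^bsub>W\<^esub> fmap F f) \<otimes>\<^bsub>W\<^esub> (b \<cdot>\<^bsub>W\<^esub> fmap F g)) \<cdot>\<^bsub>W\<^esub> mul_arr V W F (tgt f) (tgt g)
        = ((a \<otimes>\<^bsub>W\<^esub> b) \<cdot>\<^bsub>W\<^esub> mul_arr V W F (src f) (src g)) \<cdot>\<^bsub>W\<^esub> fmap F (f \<otimes>\<^bsub>V\<^esub> g)" .
    from W.seq_eq_seq[OF this, of "fmap F h"] show ?thesis using that by (simp add: fmap_seq)
  qed
  show ?thesis
  proof (rule enriched_category_arrI)
    show "monoidal_category W" by unfold_locales
  next
    fix X Y Z T assume X: "X \<in> eobj ?C" "Y \<in> eobj ?C" "Z \<in> eobj ?C" "T \<in> eobj ?C"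
    let ?a = "assoc_arr V (ehom C X Y) (ehom C Y Z) (ehom C Z T)"
    let ?r = "(one V (ehom C X Y) \<otimes>\<^bsub>V\<^esub> comp_arr V C Y Z T) \<cdot>\<^bsub>V\<^esub> comp_arr V C X Y T"
    let ?m = "mul_arr V W F"
    have "(comp_arr W ?C X Y Z \<otimes>\<^bsub>W\<^esub> one W (ehom ?C Z T)) \<cdot>\<^bsub>W\<^esub> comp_arr W ?C X Z T
        = (?m (ehom C X Y) (ehom C Y Z) \<otimes>\<^bsub>W\<^esub> one W (ehom ?C Z T)) \<cdot>\<^bsub>W\<^esub>
          ?m (tenO V (ehom C X Y) (ehom C Y Z)) (ehom C Z T) \<cdot>\<^bsub>W\<^esub> fmap F (?a \<cdot>\<^bsub>V\<^esub> ?r)"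
      using X ten_comp[of "?m (ehom C X Y) (ehom C Y Z)" "one W (ehom ?C Z T)" "comp_arr V C X Y Z"
        "one V (ehom C Z T)" "comp_arr V C X Z T"] by (simp add: C.comp_arr_assoc)
    also have "\<dots> = ((?m (ehom C X Y) (ehom C Y Z) \<otimes>\<^bsub>W\<^esub> one W (ehom ?C Z T)) \<cdot>\<^bsub>W\<^esub>
          ?m (tenO V (ehom C X Y) (ehom C Y Z)) (ehom C Z T) \<cdot>\<^bsub>W\<^esub> fmap F ?a) \<cdot>\<^bsub>W\<^esub> fmap F ?r"
      using X by (simp add: fmap_seq)
    also have "\<dots> = assoc_arr W (ehom ?C X Y) (ehom ?C Y Z) (ehom ?C Z T) \<cdot>\<^bsub>W\<^esub>
        (one W (ehom ?C X Y) \<otimes>\<^bsub>W\<^esub> ?m (ehom C Y Z) (ehom C Z T)) \<cdot>\<^bsub>W\<^esub>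
        ?m (ehom C X Y) (tenO V (ehom C Y Z) (ehom C Z T)) \<cdot>\<^bsub>W\<^esub> fmap F ?r"
      using X by (simp add: mul_assoc)
    also have "\<dots> = assoc_arr W (ehom ?C X Y) (ehom ?C Y Z) (ehom ?C Z T) \<cdot>\<^bsub>W\<^esub>
        (one W (ehom ?C X Y) \<otimes>\<^bsub>W\<^esub> comp_arr W ?C Y Z T) \<cdot>\<^bsub>W\<^esub> comp_arr W ?C X Y T"
      using X ten_comp[of "one W (ehom ?C X Y)" "?m (ehom C Y Z) (ehom C Z T)" "one V (ehom C X Y)" "comp_arr V C Y Z T"
        "comp_arr V C X Y T"] by simp
    finally show "(comp_arr W ?C X Y Z \<otimes>\<^bsub>W\<^esub> one W (ehom ?C Z T)) \<cdot>\<^bsub>W\<^esub> comp_arr W ?C X Z T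
      = assoc_arr W (ehom ?C X Y) (ehom ?C Y Z) (ehom ?C Z T) \<cdot>\<^bsub>W\<^esub>
        (one W (ehom ?C X Y) \<otimes>\<^bsub>W\<^esub> comp_arr W ?C Y Z T) \<cdot>\<^bsub>W\<^esub> comp_arr W ?C X Y T" .
  next
    fix X Y assume X: "X \<in> eobj ?C" "Y \<in> eobj ?C"
    show "(id_arr W ?C X \<otimes>\<^bsub>W\<^esub> one W (ehom ?C X Y)) \<cdot>\<^bsub>W\<^esub> comp_arr W ?C X X Y = lunit_arr W (ehom ?C X Y)"
      using X ten_comp[of "eps_arr V W F" "one W (ehom ?C X Y)" "id_arr V C X" "one V (ehom C X Y)" "comp_arr V C X X Y"]
      by (simp add: C.id_comp_arr mul_lunit)
    show "(one W (ehom ?C X Y) \<otimes>\<^bsub>W\<^esub> id_arr W ?C Y) \<cdot>\<^bsub>W\<^esub> comp_arr W ?C X Y Y = runit_arr W (ehom ?C X Y)"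
      using X ten_comp[of "one W (ehom ?C X Y)" "eps_arr V W F" "one V (ehom C X Y)" "id_arr V C Y" "comp_arr V C X Y Y"]
      by (simp add: C.comp_id_arr mul_runit)
  qed simp_all
qed

section \<open>The Kleisli category of a symmetric monoidal monad\<close>

definition eta_arr :: "('o, 'm) monad \<Rightarrow> 'o \<Rightarrow> ('o, 'm) arrow" where
  "eta_arr M A = (A, eta M A, fobj M A)"
definition mu_arr :: "('o, 'm) monad \<Rightarrow> 'o \<Rightarrow> ('o, 'm) arrow" where
  "mu_arr M A = (fobj M (fobj M A), mu M A, fobj M A)"
definition nabla_arr :: "('o, 'm, 'x) moncat_scheme \<Rightarrow> ('o, 'm) monad \<Rightarrow> 'o \<Rightarrow> 'o \<Rightarrow> ('o, 'm) arrow" where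
  "nabla_arr W M A B = (tenO W (fobj M A) (fobj M B), nabla M A B, fobj M (tenO W A B))"

text \<open>
  \<open>base_arr\<close> views a Kleisli arrow \<open>A \<rightarrow> B\<close> as the arrow \<open>A \<rightarrow> M B\<close> of the base category that it is; since it is injective on arrows
  with a given target, equations in the Kleisli category can be checked in the base. \<open>lift_arr\<close> is the action of \<open>L\<^sub>M\<close> on arrows.
\<close>

definition base_arr :: "('o, 'm) monad \<Rightarrow> ('o, 'm) arrow \<Rightarrow> ('o, 'm) arrow" where
  "base_arr M x = (src x, mor x, fobj M (tgt x))"
definition lift_arr :: "('o, 'm, 'x) moncat_scheme \<Rightarrow> ('o, 'm) monad \<Rightarrow> ('o, 'm) arrow \<Rightarrow> ('o, 'm) arrow" where
  "lift_arr W M x = (src x, kl_lift W M (src x) (tgt x) (mor x), tgt x)"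

lemma kleisli_src_tgt [simp]:
  "src (eta_arr M A) = A" "tgt (eta_arr M A) = fobj M A"
  "src (mu_arr M A) = fobj M (fobj M A)" "tgt (mu_arr M A) = fobj M A"
  "src (nabla_arr W M A B) = tenO W (fobj M A) (fobj M B)" "tgt (nabla_arr W M A B) = fobj M (tenO W A B)"
  "src (base_arr M x) = src x" "tgt (base_arr M x) = fobj M (tgt x)"
  "src (lift_arr W M x) = src x" "tgt (lift_arr W M x) = tgt x"
  by (simp_all add: eta_arr_def mu_arr_def nabla_arr_def base_arr_def lift_arr_def)

lemma base_arr_eqI: "\<lbrakk>base_arr M x = base_arr M y; tgt x = tgt y\<rbrakk> \<Longrightarrow> x = y"
  by (cases x rule: triple_cases, cases y rule: triple_cases) (simp add: base_arr_def)

lemma kleisli_simps [simp]: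
  "obj (kleisli W M) = obj W" "munit (kleisli W M) = munit W" "tenO (kleisli W M) = tenO W"
  by (simp_all add: kleisli_def)

lemma base_arr_simps [simp]:
  "tgt x = src y \<Longrightarrow> base_arr M (x \<cdot>\<^bsub>kleisli W M\<^esub> y)
    = base_arr M x \<cdot>\<^bsub>W\<^esub> fmap M (base_arr M y) \<cdot>\<^bsub>W\<^esub> mu_arr M (tgt y)"
  "base_arr M (x \<otimes>\<^bsub>kleisli W M\<^esub> y)
    = (base_arr M x \<otimes>\<^bsub>W\<^esub> base_arr M y) \<cdot>\<^bsub>W\<^esub> nabla_arr W M (tgt x) (tgt y)"
  "base_arr M (one (kleisli W M) A) = eta_arr M A"
  "base_arr M (lift_arr W M x) = x \<cdot>\<^bsub>W\<^esub> eta_arr M (tgt x)"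
  by (cases x rule: triple_cases, cases y rule: triple_cases,
      simp add: base_arr_def kleisli_def fmap_def mu_arr_def nabla_arr_def one_def eta_arr_def lift_arr_def kl_lift_def)+

lemma kleisli_structure_lift [simp]:
  "assoc_arr (kleisli W M) A B D = lift_arr W M (assoc_arr W A B D)"
  "runit_arr (kleisli W M) A = lift_arr W M (runit_arr W A)"
  "lunit_arr (kleisli W M) A = lift_arr W M (lunit_arr W A)"
  by (simp_all add: assoc_arr_def runit_arr_def lunit_arr_def lift_arr_def kleisli_def)

context symmetric_monoidal_monad
begin

text \<open>
  The laws of \<open>M\<close> as a lax monoidal functor are stated for the auxiliary record \<open>monad_lax\<close>; these equations restate them for the
  operations of the monad itself.
\<close>

lemma fmap_monad_lax: "fmap (monad_lax W M) = fmap M"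
  by (simp add: fmap_def monad_lax_def fun_eq_iff)

lemma eps_monad_lax: "eps_arr W W (monad_lax W M) = eta_arr M (munit W)"
  by (simp add: eps_arr_def monad_lax_def eta_arr_def)

lemma mul_monad_lax: "mul_arr W W (monad_lax W M) = nabla_arr W M"
  by (simp add: mul_arr_def monad_lax_def nabla_arr_def fun_eq_iff)

lemma fobj_monad_lax: "fobj (monad_lax W M) = fobj M"
  by (simp add: monad_lax_def)

lemmas monad_lax_simps = fmap_monad_lax eps_monad_lax mul_monad_lax fobj_monad_lax

lemmas monad_arr [simp] = arr_fmap[unfolded monad_lax_simps] arr_mul[unfolded monad_lax_simps]
  fmap_one[unfolded monad_lax_simps] fobj_obj[unfolded monad_lax_simps]

lemmas monad_fmap_seq = fmap_seq[unfolded monad_lax_simps]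
lemmas nabla_natural = mul_natural[unfolded monad_lax_simps]
lemmas nabla_assoc = mul_assoc[unfolded monad_lax_simps]
lemmas nabla_runit = mul_runit[unfolded monad_lax_simps]
lemmas nabla_lunit = mul_lunit[unfolded monad_lax_simps]

lemma arr_eta [simp]: "A \<in> obj W \<Longrightarrow> arr W (eta_arr M A)"
  using unit.component_hom[of A] by (simp add: eta_arr_def arr_triple lax_id_def monad_lax_def)

lemma arr_mu [simp]: "A \<in> obj W \<Longrightarrow> arr W (mu_arr M A)"
  using mult.component_hom[of A] by (simp add: mu_arr_def arr_triple lax_comp_def monad_lax_def)

lemma eta_natural:
  "\<lbrakk>arr W f; src f = A\<rbrakk> \<Longrightarrow> eta_arr M A \<cdot>\<^bsub>W\<^esub> fmap M f = f \<cdot>\<^bsub>W\<^esub> eta_arr M (tgt f)"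
  using unit.natural[of "src f" "tgt f" "mor f"]
  by (cases f rule: triple_cases) (auto simp: eta_arr_def fmap_def arr_triple lax_id_def monad_lax_def)

lemma mu_natural:
  "\<lbrakk>arr W f; tgt f = A\<rbrakk> \<Longrightarrow> fmap M (fmap M f) \<cdot>\<^bsub>W\<^esub> mu_arr M A = mu_arr M (src f) \<cdot>\<^bsub>W\<^esub> fmap M f"
  using mult.natural[of "src f" "tgt f" "mor f"]
  by (cases f rule: triple_cases) (auto simp: mu_arr_def fmap_def arr_triple lax_comp_def monad_lax_def)

lemma eta_ten:
  assumes "A \<in> obj W" "B \<in> obj W"
  shows "(eta_arr M A \<otimes>\<^bsub>W\<^esub> eta_arr M B) \<cdot>\<^bsub>W\<^esub> nabla_arr W M A B = eta_arr M (tenO W A B)"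
proof -
  have "one W (tenO W A B) \<cdot>\<^bsub>W\<^esub> eta_arr M (tenO W A B) = (eta_arr M A \<otimes>\<^bsub>W\<^esub> eta_arr M B) \<cdot>\<^bsub>W\<^esub> nabla_arr W M A B"
    using unit.monoidal_product[OF assms]
    by (simp add: eta_arr_def nabla_arr_def lax_id_def monad_lax_def one_def)
  then show ?thesis using assms by simp
qed

lemma mu_ten:
  assumes "A \<in> obj W" "B \<in> obj W"
  shows "nabla_arr W M (fobj M A) (fobj M B) \<cdot>\<^bsub>W\<^esub> fmap M (nabla_arr W M A B) \<cdot>\<^bsub>W\<^esub> mu_arr M (tenO W A B)
    = (mu_arr M A \<otimes>\<^bsub>W\<^esub> mu_arr M B) \<cdot>\<^bsub>W\<^esub> nabla_arr W M A B"
proof -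
  have "(nabla_arr W M (fobj M A) (fobj M B) \<cdot>\<^bsub>W\<^esub> fmap M (nabla_arr W M A B)) \<cdot>\<^bsub>W\<^esub> mu_arr M (tenO W A B)
      = (mu_arr M A \<otimes>\<^bsub>W\<^esub> mu_arr M B) \<cdot>\<^bsub>W\<^esub> nabla_arr W M A B"
    using mult.monoidal_product[OF assms]
    by (simp add: mu_arr_def nabla_arr_def lax_comp_def monad_lax_def fmap_def)
  then show ?thesis using assms by simp
qed


lemma eta_mu_arr: "A \<in> obj W \<Longrightarrow> eta_arr M (fobj M A) \<cdot>\<^bsub>W\<^esub> mu_arr M A = one W (fobj M A)"
  by (simp add: eta_arr_def mu_arr_def one_def eta_mu)

lemma fmap_eta_mu_arr: "A \<in> obj W \<Longrightarrow> fmap M (eta_arr M A) \<cdot>\<^bsub>W\<^esub> mu_arr M A = one W (fobj M A)"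
  by (simp add: eta_arr_def mu_arr_def one_def fmap_def M_eta_mu)

lemma mu_mu_arr:
  "A \<in> obj W \<Longrightarrow> fmap M (mu_arr M A) \<cdot>\<^bsub>W\<^esub> mu_arr M A = mu_arr M (fobj M A) \<cdot>\<^bsub>W\<^esub> mu_arr M A"
  by (simp add: mu_arr_def fmap_def mu_mu)

lemma arr_kleisli_iff:
  "arr (kleisli W M) x \<longleftrightarrow> src x \<in> obj W \<and> tgt x \<in> obj W \<and> arr W (base_arr M x)"
  by (cases x rule: triple_cases) (auto simp: arr_triple kleisli_def base_arr_def)

sublocale Kl: category "kleisli W M"
proof (rule category_arrI)
  fix A assume "A \<in> obj (kleisli W M)"
  then show "arr (kleisli W M) (one (kleisli W M) A)" by (simp add: arr_kleisli_iff)
next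
  fix x y assume "arr (kleisli W M) x" "arr (kleisli W M) y" "tgt x = src y"
  then show "arr (kleisli W M) (x \<cdot>\<^bsub>kleisli W M\<^esub> y)" by (simp add: arr_kleisli_iff)
next
  fix x assume x: "arr (kleisli W M) x"
  then have "eta_arr M (src x) \<cdot>\<^bsub>W\<^esub> fmap M (base_arr M x) \<cdot>\<^bsub>W\<^esub> mu_arr M (tgt x) = base_arr M x"
    by (simp add: arr_kleisli_iff V.seq_eq_seq[OF eta_natural] eta_mu_arr)
  then show "one (kleisli W M) (src x) \<cdot>\<^bsub>kleisli W M\<^esub> x = x" by - (rule base_arr_eqI[of M], simp_all)
  show "x \<cdot>\<^bsub>kleisli W M\<^esub> one (kleisli W M) (tgt x) = x"
    using x by - (rule base_arr_eqI[of M], simp_all add: arr_kleisli_iff fmap_eta_mu_arr)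
next
  fix x y z
  assume "arr (kleisli W M) x" "arr (kleisli W M) y" "arr (kleisli W M) z" "tgt x = src y" "tgt y = src z"
  then show "(x \<cdot>\<^bsub>kleisli W M\<^esub> y) \<cdot>\<^bsub>kleisli W M\<^esub> z = x \<cdot>\<^bsub>kleisli W M\<^esub> y \<cdot>\<^bsub>kleisli W M\<^esub> z"
    by - (rule base_arr_eqI[of M],
      simp_all add: arr_kleisli_iff monad_fmap_seq mu_mu_arr V.seq_eq_seq[OF mu_natural])
qed


lemma lift_one: "A \<in> obj W \<Longrightarrow> lift_arr W M (one W A) = one (kleisli W M) A"
  by - (rule base_arr_eqI[of M], simp_all)

text \<open>
  Composing with an arrow in the image of \<open>L\<^sub>M\<close> involves no multiplication: on the left it is composition in the base, on the right it
  is composition with the image under \<open>M\<close>.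
\<close>

lemma lift_seq_kleisli:
  assumes "arr W x" "arr (kleisli W M) y" "tgt x = src y"
  shows "base_arr M (lift_arr W M x \<cdot>\<^bsub>kleisli W M\<^esub> y) = x \<cdot>\<^bsub>W\<^esub> base_arr M y"
  using assms
  by (simp add: arr_kleisli_iff V.seq_eq_seq[OF eta_natural] eta_mu_arr)

lemma kleisli_seq_lift:
  assumes "arr (kleisli W M) x" "arr W y" "tgt x = src y"
  shows "base_arr M (x \<cdot>\<^bsub>kleisli W M\<^esub> lift_arr W M y) = base_arr M x \<cdot>\<^bsub>W\<^esub> fmap M y"
  using assms by (simp add: arr_kleisli_iff monad_fmap_seq fmap_eta_mu_arr)

lemma arr_lift [simp]: "arr W x \<Longrightarrow> arr (kleisli W M) (lift_arr W M x)"
  by (simp add: arr_kleisli_iff)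

lemma lift_seq:
  assumes "arr W x" "arr W y" "tgt x = src y"
  shows "lift_arr W M (x \<cdot>\<^bsub>W\<^esub> y) = lift_arr W M x \<cdot>\<^bsub>kleisli W M\<^esub> lift_arr W M y"
  using assms by - (rule base_arr_eqI[of M], simp_all add: lift_seq_kleisli del: base_arr_simps(1))

text \<open>
  \<open>L\<^sub>M\<close> preserves tensor products because the unit \<open>\<eta>\<close> is a monoidal transformation.
\<close>

lemma lift_ten:
  assumes "arr W x" "arr W y"
  shows "lift_arr W M (x \<otimes>\<^bsub>W\<^esub> y) = lift_arr W M x \<otimes>\<^bsub>kleisli W M\<^esub> lift_arr W M y"
proof (rule base_arr_eqI[of M])
  have "((x \<cdot>\<^bsub>W\<^esub> eta_arr M (tgt x)) \<otimes>\<^bsub>W\<^esub> (y \<cdot>\<^bsub>W\<^esub> eta_arr M (tgt y))) \<cdot>\<^bsub>W\<^esub> nabla_arr W M (tgt x) (tgt y)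
      = (x \<otimes>\<^bsub>W\<^esub> y) \<cdot>\<^bsub>W\<^esub> (eta_arr M (tgt x) \<otimes>\<^bsub>W\<^esub> eta_arr M (tgt y)) \<cdot>\<^bsub>W\<^esub> nabla_arr W M (tgt x) (tgt y)"
    using assms by (simp add: V.interchange_seq)
  then show "base_arr M (lift_arr W M (x \<otimes>\<^bsub>W\<^esub> y)) = base_arr M (lift_arr W M x \<otimes>\<^bsub>kleisli W M\<^esub> lift_arr W M y)"
    using assms by (simp add: eta_ten)
qed simp

lemma lift_inverse: "V.inverse_pair x y \<Longrightarrow> Kl.inverse_pair (lift_arr W M x) (lift_arr W M y)"
  by (simp add: V.inverse_pair_def Kl.inverse_pair_def lift_one flip: lift_seq)

text \<open>
  Interchange holds because the multiplication \<open>\<mu>\<close> is a monoidal transformation and \<open>\<nabla>\<close> is natural.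
\<close>

lemma kleisli_interchange:
  assumes "arr (kleisli W M) f" "arr (kleisli W M) g" "arr (kleisli W M) f'" "arr (kleisli W M) g'"
    and "tgt f = src g" "tgt f' = src g'"
  shows "(f \<cdot>\<^bsub>kleisli W M\<^esub> g) \<otimes>\<^bsub>kleisli W M\<^esub> (f' \<cdot>\<^bsub>kleisli W M\<^esub> g')
    = (f \<otimes>\<^bsub>kleisli W M\<^esub> f') \<cdot>\<^bsub>kleisli W M\<^esub> (g \<otimes>\<^bsub>kleisli W M\<^esub> g')"
proof (rule base_arr_eqI[of M])
  let ?b = "base_arr M" and ?n = "nabla_arr W M" and ?mu = "mu_arr M" and ?M = "fmap M"
  note arr = assms[unfolded arr_kleisli_iff]
  have "((?b f \<cdot>\<^bsub>W\<^esub> ?M (?b g) \<cdot>\<^bsub>W\<^esub> ?mu (tgt g)) \<otimes>\<^bsub>W\<^esub> (?b f' \<cdot>\<^bsub>W\<^esub> ?M (?b g') \<cdot>\<^bsub>W\<^esub> ?mu (tgt g'))) \<cdot>\<^bsub>W\<^esub> ?n (tgt g) (tgt g')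
      = (?b f \<otimes>\<^bsub>W\<^esub> ?b f') \<cdot>\<^bsub>W\<^esub> (?M (?b g) \<otimes>\<^bsub>W\<^esub> ?M (?b g')) \<cdot>\<^bsub>W\<^esub> (?mu (tgt g) \<otimes>\<^bsub>W\<^esub> ?mu (tgt g')) \<cdot>\<^bsub>W\<^esub> ?n (tgt g) (tgt g')"
    using arr by (simp add: V.interchange_seq)
  also have "\<dots> = (?b f \<otimes>\<^bsub>W\<^esub> ?b f') \<cdot>\<^bsub>W\<^esub> ((?M (?b g) \<otimes>\<^bsub>W\<^esub> ?M (?b g')) \<cdot>\<^bsub>W\<^esub> ?n (tgt (?b g)) (tgt (?b g'))) \<cdot>\<^bsub>W\<^esub>
      ?M (?n (tgt g) (tgt g')) \<cdot>\<^bsub>W\<^esub> ?mu (tenO W (tgt g) (tgt g'))"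
    using arr by (simp add: mu_ten)
  also have "\<dots> = (?b f \<otimes>\<^bsub>W\<^esub> ?b f') \<cdot>\<^bsub>W\<^esub> (?n (src g) (src g') \<cdot>\<^bsub>W\<^esub> ?M (?b g \<otimes>\<^bsub>W\<^esub> ?b g')) \<cdot>\<^bsub>W\<^esub>
      ?M (?n (tgt g) (tgt g')) \<cdot>\<^bsub>W\<^esub> ?mu (tenO W (tgt g) (tgt g'))"
    using arr by (simp only: nabla_natural) simp
  finally show "?b ((f \<cdot>\<^bsub>kleisli W M\<^esub> g) \<otimes>\<^bsub>kleisli W M\<^esub> (f' \<cdot>\<^bsub>kleisli W M\<^esub> g'))
      = ?b ((f \<otimes>\<^bsub>kleisli W M\<^esub> f') \<cdot>\<^bsub>kleisli W M\<^esub> (g \<otimes>\<^bsub>kleisli W M\<^esub> g'))"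
    using arr by (simp add: monad_fmap_seq)
qed simp

text \<open>
  For Kleisli arrows, naturality of the coherence maps of the base is combined with the coherence laws of \<open>\<nabla>\<close>.
\<close>

lemma kleisli_assoc_natural:
  assumes "arr (kleisli W M) f" "arr (kleisli W M) g" "arr (kleisli W M) h"
  shows "((f \<otimes>\<^bsub>kleisli W M\<^esub> g) \<otimes>\<^bsub>kleisli W M\<^esub> h) \<cdot>\<^bsub>kleisli W M\<^esub> lift_arr W M (assoc_arr W (tgt f) (tgt g) (tgt h))
    = lift_arr W M (assoc_arr W (src f) (src g) (src h)) \<cdot>\<^bsub>kleisli W M\<^esub> (f \<otimes>\<^bsub>kleisli W M\<^esub> g \<otimes>\<^bsub>kleisli W M\<^esub> h)"
proof (rule base_arr_eqI[of M])
  let ?b = "base_arr M" and ?n = "nabla_arr W M" and ?f = "tgt f" and ?g = "tgt g" and ?h = "tgt h"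
  note arr = assms[unfolded arr_kleisli_iff]
  have "((((?b f \<otimes>\<^bsub>W\<^esub> ?b g) \<cdot>\<^bsub>W\<^esub> ?n ?f ?g) \<otimes>\<^bsub>W\<^esub> ?b h) \<cdot>\<^bsub>W\<^esub> ?n (tenO W ?f ?g) ?h) \<cdot>\<^bsub>W\<^esub> fmap M (assoc_arr W ?f ?g ?h)
      = ((?b f \<otimes>\<^bsub>W\<^esub> ?b g) \<otimes>\<^bsub>W\<^esub> ?b h) \<cdot>\<^bsub>W\<^esub> (?n ?f ?g \<otimes>\<^bsub>W\<^esub> one W (fobj M ?h)) \<cdot>\<^bsub>W\<^esub>
        ?n (tenO W ?f ?g) ?h \<cdot>\<^bsub>W\<^esub> fmap M (assoc_arr W ?f ?g ?h)"
    using arr by (simp add: V.interchange_seq)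
  also have "\<dots> = (((?b f \<otimes>\<^bsub>W\<^esub> ?b g) \<otimes>\<^bsub>W\<^esub> ?b h) \<cdot>\<^bsub>W\<^esub> assoc_arr W (tgt (?b f)) (tgt (?b g)) (tgt (?b h))) \<cdot>\<^bsub>W\<^esub>
        (one W (fobj M ?f) \<otimes>\<^bsub>W\<^esub> ?n ?g ?h) \<cdot>\<^bsub>W\<^esub> ?n ?f (tenO W ?g ?h)"
    using arr by (simp add: nabla_assoc)
  also have "\<dots> = assoc_arr W (src f) (src g) (src h) \<cdot>\<^bsub>W\<^esub> (?b f \<otimes>\<^bsub>W\<^esub> ((?b g \<otimes>\<^bsub>W\<^esub> ?b h) \<cdot>\<^bsub>W\<^esub> ?n ?g ?h)) \<cdot>\<^bsub>W\<^esub> ?n ?f (tenO W ?g ?h)"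
    using arr by (simp only: V.assoc_natural) (simp add: V.interchange_seq)
  finally show "?b (((f \<otimes>\<^bsub>kleisli W M\<^esub> g) \<otimes>\<^bsub>kleisli W M\<^esub> h) \<cdot>\<^bsub>kleisli W M\<^esub> lift_arr W M (assoc_arr W ?f ?g ?h))
    = ?b (lift_arr W M (assoc_arr W (src f) (src g) (src h)) \<cdot>\<^bsub>kleisli W M\<^esub> (f \<otimes>\<^bsub>kleisli W M\<^esub> g \<otimes>\<^bsub>kleisli W M\<^esub> h))"
    using arr assms by (simp add: kleisli_seq_lift lift_seq_kleisli arr_kleisli_iff del: base_arr_simps(1))
qed simp

lemma kleisli_runit_natural:
  assumes "arr (kleisli W M) f"
  shows "(f \<otimes>\<^bsub>kleisli W M\<^esub> one (kleisli W M) (munit W)) \<cdot>\<^bsub>kleisli W M\<^esub> lift_arr W M (runit_arr W (tgt f))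
    = lift_arr W M (runit_arr W (src f)) \<cdot>\<^bsub>kleisli W M\<^esub> f"
proof (rule base_arr_eqI[of M])
  let ?b = "base_arr M" and ?n = "nabla_arr W M" and ?f = "tgt f" and ?I = "munit W"
  note arr = assms[unfolded arr_kleisli_iff]
  have "((?b f \<otimes>\<^bsub>W\<^esub> eta_arr M ?I) \<cdot>\<^bsub>W\<^esub> ?n ?f ?I) \<cdot>\<^bsub>W\<^esub> fmap M (runit_arr W ?f)
      = (?b f \<otimes>\<^bsub>W\<^esub> one W ?I) \<cdot>\<^bsub>W\<^esub> (one W (fobj M ?f) \<otimes>\<^bsub>W\<^esub> eta_arr M ?I) \<cdot>\<^bsub>W\<^esub> ?n ?f ?I \<cdot>\<^bsub>W\<^esub> fmap M (runit_arr W ?f)"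
    using arr by (simp add: V.interchange_seq)
  also have "\<dots> = runit_arr W (src f) \<cdot>\<^bsub>W\<^esub> ?b f"
    using arr V.runit_natural[of "?b f"] by (simp add: nabla_runit)
  finally show "?b ((f \<otimes>\<^bsub>kleisli W M\<^esub> one (kleisli W M) ?I) \<cdot>\<^bsub>kleisli W M\<^esub> lift_arr W M (runit_arr W ?f))
      = ?b (lift_arr W M (runit_arr W (src f)) \<cdot>\<^bsub>kleisli W M\<^esub> f)"
    using arr assms by (simp add: kleisli_seq_lift lift_seq_kleisli arr_kleisli_iff del: base_arr_simps(1))
qed simp

lemma kleisli_lunit_natural:
  assumes "arr (kleisli W M) f"
  shows "(one (kleisli W M) (munit W) \<otimes>\<^bsub>kleisli W M\<^esub> f) \<cdot>\<^bsub>kleisli W M\<^esub> lift_arr W M (lunit_arr W (tgt f))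
    = lift_arr W M (lunit_arr W (src f)) \<cdot>\<^bsub>kleisli W M\<^esub> f"
proof (rule base_arr_eqI[of M])
  let ?b = "base_arr M" and ?n = "nabla_arr W M" and ?f = "tgt f" and ?I = "munit W"
  note arr = assms[unfolded arr_kleisli_iff]
  have "((eta_arr M ?I \<otimes>\<^bsub>W\<^esub> ?b f) \<cdot>\<^bsub>W\<^esub> ?n ?I ?f) \<cdot>\<^bsub>W\<^esub> fmap M (lunit_arr W ?f)
      = (one W ?I \<otimes>\<^bsub>W\<^esub> ?b f) \<cdot>\<^bsub>W\<^esub> (eta_arr M ?I \<otimes>\<^bsub>W\<^esub> one W (fobj M ?f)) \<cdot>\<^bsub>W\<^esub> ?n ?I ?f \<cdot>\<^bsub>W\<^esub> fmap M (lunit_arr W ?f)"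
    using arr by (simp add: V.interchange_seq)
  also have "\<dots> = lunit_arr W (src f) \<cdot>\<^bsub>W\<^esub> ?b f"
    using arr V.lunit_natural[of "?b f"] by (simp add: nabla_lunit)
  finally show "?b ((one (kleisli W M) ?I \<otimes>\<^bsub>kleisli W M\<^esub> f) \<cdot>\<^bsub>kleisli W M\<^esub> lift_arr W M (lunit_arr W ?f))
      = ?b (lift_arr W M (lunit_arr W (src f)) \<cdot>\<^bsub>kleisli W M\<^esub> f)"
    using arr assms by (simp add: kleisli_seq_lift lift_seq_kleisli arr_kleisli_iff del: base_arr_simps(1))
qed simp

text \<open>
  The coherence maps of the Kleisli category are images under \<open>L\<^sub>M\<close>, which preserves composites and tensor products; so
  invertibility, the pentagon and the triangle are inherited from the base.
\<close>

sublocale Kl: monoidal_category "kleisli W M"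
proof (rule monoidal_category_arrI, goal_cases)
  case 1 show ?case by unfold_locales
next
  case 2 show ?case by simp
next
  case 3 then show ?case by simp
next
  case 4 then show ?case by (simp add: arr_kleisli_iff)
next
  case 5 then show ?case by - (rule base_arr_eqI[of M], simp_all add: eta_ten)
next
  case 6 then show ?case by (rule kleisli_interchange)
next
  case (7 A B D)
  from 7[simplified] obtain y where "V.inverse_pair (assoc_arr W A B D) y" by (rule V.assoc_inverse)
  then show ?case unfolding kleisli_structure_lift by (blast intro: lift_inverse)
next
  case (8 A)
  from 8[simplified] obtain y where "V.inverse_pair (runit_arr W A) y" by (rule V.runit_inverse)
  then show ?case unfolding kleisli_structure_lift by (blast intro: lift_inverse)
next
  case (9 A)
  from 9[simplified] obtain y where "V.inverse_pair (lunit_arr W A) y" by (rule V.lunit_inverse)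
  then show ?case unfolding kleisli_structure_lift by (blast intro: lift_inverse)
next
  case 10 then show ?case by (simp add: kleisli_assoc_natural)
next
  case 11 then show ?case by (simp add: kleisli_runit_natural)
next
  case 12 then show ?case by (simp add: kleisli_lunit_natural)
next
  case 13 then show ?case by (simp add: V.assoc_pentagon flip: lift_seq lift_ten lift_one)
next
  case 14 then show ?case by (simp add: V.assoc_triangle flip: lift_seq lift_ten lift_one)
qed

end

section \<open>Parametrised arrows over a strict subcategory\<close>

lemma prod_category:
  assumes "category C" "category D"
  shows "category (prod_cat C D)"
proof -
  interpret C: category C by fact
  interpret D: category D by fact
  show ?thesis
    by unfold_locales
      (auto simp: prod_cat_def C.idn_hom C.cmp_hom C.idn_cmp C.cmp_idn C.cmp_assoc
        D.idn_hom D.cmp_hom D.idn_cmp D.cmp_idn D.cmp_assoc)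
qed

text \<open>
  The operations of the 2-category of parametrised arrows only use a monoidal category \<open>K\<close>, a set of parameter objects and an
  enriched category over \<open>K\<close>. The following definitions are that construction, change of base along \<open>\<U>/(-)\<close>; Kleisli
  categories enter in \<open>param_twocat_eq\<close>.
\<close>

definition slice_mult :: "('o, 'm, 'x) moncat_scheme \<Rightarrow> 'o \<Rightarrow> 'o \<Rightarrow> 'o \<Rightarrow> 'm
    \<Rightarrow> (('o \<times> 'm) \<times> ('o \<times> 'm), 'm \<times> 'm, 'o \<times> 'm, 'm) func" where
  "slice_mult K A B D h =
    \<lparr>fobj = (\<lambda>((P, f), (Q, g)).
       (tenO K P Q, cmp K (tenO K P Q) (tenO K A B) D (tenA K P A Q B f g) h)),
     farr = (\<lambda>((P, f), (Q, g)) ((P', f'), (Q', g')) (\<phi>, \<psi>). tenA K P P' Q Q' \<phi> \<psi>)\<rparr>"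

definition slice_twocat :: "('o, 'm, 'x) moncat_scheme \<Rightarrow> 'o set \<Rightarrow> ('a, 'o, 'm) ecat \<Rightarrow> ('a, 'o \<times> 'm, 'm) twocat" where
  "slice_twocat K U E =
    \<lparr>tobj = eobj E,
     thom = (\<lambda>X Y. slice K U (ehom E X Y)),
     tid = (\<lambda>X. (munit K, eid E X)),
     tcmp = (\<lambda>X Y Z. slice_mult K (ehom E X Y) (ehom E Y Z) (ehom E X Z) (ecomp E X Y Z))\<rparr>"

context category
begin

lemma slice_obj:
  "\<lbrakk>U \<subseteq> obj C; A \<in> obj C\<rbrakk> \<Longrightarrow> (P, f) \<in> obj (slice C U A) \<longleftrightarrow> P \<in> U \<and> arr C (P, f, A)"
  by (auto simp: slice_def arr_triple)

lemma slice_hom: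
  "\<lbrakk>U \<subseteq> obj C; P \<in> U; Q \<in> U\<rbrakk> \<Longrightarrow> \<phi> \<in> hom (slice C U A) (P, f) (Q, g)
    \<longleftrightarrow> arr C (P, \<phi>, Q) \<and> (P, f, A) = (P, \<phi>, Q) \<cdot>\<^bsub>C\<^esub> (Q, g, A)"
  by (auto simp: slice_def arr_triple)

lemma slice_category:
  assumes "U \<subseteq> obj C" "A \<in> obj C"
  shows "category (slice C U A)"
  using assms
  by unfold_locales
    (auto simp: slice_def subset_iff idn_hom cmp_hom idn_cmp cmp_idn cmp_assoc)

end

context monoidal_category
begin

lemma slice_mult_functor:
  assumes U: "U \<subseteq> obj V" "\<And>P Q. \<lbrakk>P \<in> U; Q \<in> U\<rbrakk> \<Longrightarrow> tenO V P Q \<in> U"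
    and obj: "A \<in> obj V" "B \<in> obj V" "D \<in> obj V"
    and h: "h \<in> hom V (tenO V A B) D"
  shows "cat_functor (prod_cat (slice V U A) (slice V U B)) (slice V U D) (slice_mult V A B D h)"
proof -
  interpret P: category "prod_cat (slice V U A) (slice V U B)"
    using U obj by (intro prod_category slice_category)
  interpret S: category "slice V U D" using U obj by (intro slice_category)
  have h': "arr V (tenO V A B, h, D)" using obj h by (simp add: arr_triple)
  have mult_obj: "(tenO V P Q, cmp V (tenO V P Q) (tenO V A B) D (tenA V P A Q B f g) h) \<in> obj (slice V U D)"
    if "P \<in> U" "Q \<in> U" "f \<in> hom V P A" "g \<in> hom V Q B" for P Q f g
    using that U obj h by (auto simp: slice_def intro!: cmp_hom tenA_hom)
  have tri: "cmp V (tenO V P Q) (tenO V A B) D (tenA V P A Q B (cmp V P P' A \<phi> f) (cmp V Q Q' B \<psi> g)) h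
      = cmp V (tenO V P Q) (tenO V P' Q') D (tenA V P P' Q Q' \<phi> \<psi>)
          (cmp V (tenO V P' Q') (tenO V A B) D (tenA V P' A Q' B f g) h)"
    if "P \<in> U" "P' \<in> U" "Q \<in> U" "Q' \<in> U" "f \<in> hom V P' A" "g \<in> hom V Q' B" "\<phi> \<in> hom V P P'" "\<psi> \<in> hom V Q Q'"
    for P P' Q Q' f g \<phi> \<psi>
    using that U obj h by (subst tenA_cmp) (auto intro!: cmp_assoc tenA_hom)
  show ?thesis
  proof (unfold_locales, goal_cases)
    case (1 X) then show ?case using mult_obj by (auto simp: slice_mult_def prod_cat_def slice_def)
  next
    case (2 X Y \<phi>)
    then show ?case using U obj tri
      by (auto simp: slice_mult_def prod_cat_def slice_def subset_iff intro!: tenA_hom)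
  next
    case (3 X)
    then show ?case using U obj by (auto simp: slice_mult_def prod_cat_def slice_def subset_iff tenA_idn)
  next
    case (4 X Y Z \<phi> \<psi>)
    then show ?case using U obj by (auto simp: slice_mult_def prod_cat_def slice_def subset_iff intro!: tenA_cmp)
  qed
qed

end

lemma full_strict_obj: "\<lbrakk>full_strict_monoidal_subcategory K U; P \<in> U\<rbrakk> \<Longrightarrow> P \<in> obj K"
  by (auto simp: full_strict_monoidal_subcategory_def)

lemma full_strict_closed:
  "full_strict_monoidal_subcategory K U \<Longrightarrow> munit K \<in> U"
  "\<lbrakk>full_strict_monoidal_subcategory K U; P \<in> U; Q \<in> U\<rbrakk> \<Longrightarrow> tenO K P Q \<in> U"
  by (auto simp: full_strict_monoidal_subcategory_def)

lemma full_strict_assoc: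
  "\<lbrakk>full_strict_monoidal_subcategory K U; P \<in> U; Q \<in> U; R \<in> U\<rbrakk> \<Longrightarrow> assoc_arr K P Q R = one K (tenO K P (tenO K Q R))"
  by (simp add: full_strict_monoidal_subcategory_def assoc_arr_def one_def)

lemma full_strict_lunit: "\<lbrakk>full_strict_monoidal_subcategory K U; P \<in> U\<rbrakk> \<Longrightarrow> lunit_arr K P = one K P"
  by (simp add: full_strict_monoidal_subcategory_def lunit_arr_def one_def)

lemma full_strict_runit: "\<lbrakk>full_strict_monoidal_subcategory K U; P \<in> U\<rbrakk> \<Longrightarrow> runit_arr K P = one K P"
  by (simp add: full_strict_monoidal_subcategory_def runit_arr_def one_def)

lemma full_strict_equations:
  assumes "full_strict_monoidal_subcategory K U"
  shows "\<lbrakk>P \<in> U; Q \<in> U; R \<in> U\<rbrakk> \<Longrightarrow> tenO K (tenO K P Q) R = tenO K P (tenO K Q R)"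
    and "P \<in> U \<Longrightarrow> tenO K (munit K) P = P" and "P \<in> U \<Longrightarrow> tenO K P (munit K) = P"
  using assms by (auto simp: full_strict_monoidal_subcategory_def)

context monoidal_category
begin

text \<open>
  On arrows between objects of a strict subcategory, naturality of the associator and of the unitors says that the tensor
  product is strictly associative and unital.
\<close>

lemma strict_ten_assoc:
  assumes U: "full_strict_monoidal_subcategory V U"
    and arr: "arr V f" "arr V g" "arr V h"
    and "src f \<in> U" "src g \<in> U" "src h \<in> U" "tgt f \<in> U" "tgt g \<in> U" "tgt h \<in> U"
  shows "(f \<otimes>\<^bsub>V\<^esub> g) \<otimes>\<^bsub>V\<^esub> h = f \<otimes>\<^bsub>V\<^esub> g \<otimes>\<^bsub>V\<^esub> h"
  using assoc_natural[OF arr] assms by (simp add: full_strict_assoc[OF U] full_strict_equations[OF U])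

lemma strict_unit_ten:
  assumes U: "full_strict_monoidal_subcategory V U" and "arr V f" "src f \<in> U" "tgt f \<in> U"
  shows "one V (munit V) \<otimes>\<^bsub>V\<^esub> f = f" and "f \<otimes>\<^bsub>V\<^esub> one V (munit V) = f"
  using lunit_natural[of f] runit_natural[of f] assms
  by (simp_all add: full_strict_lunit[OF U] full_strict_runit[OF U] full_strict_equations[OF U])

lemma strict_unit_split:
  assumes U: "full_strict_monoidal_subcategory V U"
  shows "unit_split_arr V = one V (munit V)"
  using unit_split_lunit U by (simp add: full_strict_lunit[OF U] full_strict_equations[OF U] full_strict_closed[OF U])

end

text \<open>
  On 1-cells, the laws of horizontal composition are the generalised axioms of the enriched category, with the associators
  and unitors at parameter objects equal to identities; on 2-cells they are strict associativity and unitality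
  of the tensor product.
\<close>

theorem slice_two_category:
  assumes "enriched_category K E" and U: "full_strict_monoidal_subcategory K U"
  shows "two_category (slice_twocat K U E)"
proof -
  interpret enriched_category K E by fact
  note strict = full_strict_obj[OF U] full_strict_closed[OF U] full_strict_equations[OF U]
    full_strict_assoc[OF U] full_strict_lunit[OF U] full_strict_runit[OF U]
  have sub: "U \<subseteq> obj K" using strict by auto
  note sobj = V.slice_obj[OF sub] and shom = V.slice_hom[OF sub]
  show ?thesis
  proof (rule two_category.intro, unfold slice_twocat_def twocat.simps, goal_cases)
    case (1 X Y) then show ?case by (simp add: V.slice_category sub)
  next
    case (2 X) then show ?case using strict eid_hom by (simp add: slice_def)
  next
    case (3 X Y Z) then show ?case using sub strict ecomp_hom by (simp add: V.slice_mult_functor)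
  next
    case (4 X Y Z T x y z)
    obtain P f Q g R h where x: "x = (P, f)" and y: "y = (Q, g)" and z: "z = (R, h)"
      by (metis surj_pair)
    let ?f = "(P, f, ehom E X Y)" and ?g = "(Q, g, ehom E Y Z)" and ?h = "(R, h, ehom E Z T)"
    have "arr K ?f" "arr K ?g" "arr K ?h" "P \<in> U" "Q \<in> U" "R \<in> U"
      using 4 x y z sobj by auto
    with 4(1-4) have "(((?f \<otimes>\<^bsub>K\<^esub> ?g) \<cdot>\<^bsub>K\<^esub> comp_arr K E X Y Z) \<otimes>\<^bsub>K\<^esub> ?h) \<cdot>\<^bsub>K\<^esub> comp_arr K E X Z T
        = (?f \<otimes>\<^bsub>K\<^esub> ((?g \<otimes>\<^bsub>K\<^esub> ?h) \<cdot>\<^bsub>K\<^esub> comp_arr K E Y Z T)) \<cdot>\<^bsub>K\<^esub> comp_arr K E X Y T"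
      using comp_arr_ten_assoc[of X Y Z T ?f ?g ?h] by (simp add: strict del: triple_ops)
    then show ?case by (auto simp: x y z slice_mult_def comp_arr_def)
  next
    case (5 X Y Z T x y z x' y' z' \<phi> \<psi> \<chi>)
    obtain P f Q g R h where x: "x = (P, f)" and y: "y = (Q, g)" and z: "z = (R, h)"
      by (metis surj_pair)
    obtain P' f' Q' g' R' h' where x': "x' = (P', f')" and y': "y' = (Q', g')" and z': "z' = (R', h')"
      by (metis surj_pair)
    have "P \<in> U" "Q \<in> U" "R \<in> U" "P' \<in> U" "Q' \<in> U" "R' \<in> U"
      "arr K (P, \<phi>, P')" "arr K (Q, \<psi>, Q')" "arr K (R, \<chi>, R')"
      using 5 x y z x' y' z' sobj shom by auto
    then have "((P, \<phi>, P') \<otimes>\<^bsub>K\<^esub> (Q, \<psi>, Q')) \<otimes>\<^bsub>K\<^esub> (R, \<chi>, R') = (P, \<phi>, P') \<otimes>\<^bsub>K\<^esub> (Q, \<psi>, Q') \<otimes>\<^bsub>K\<^esub> (R, \<chi>, R')"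
      by (intro V.strict_ten_assoc[OF U]) simp_all
    then show ?case by (simp add: x y z x' y' z' slice_mult_def)
  next
    case (6 X Y x)
    obtain P f where x: "x = (P, f)" by fastforce
    have "arr K (P, f, ehom E X Y)" "P \<in> U" using 6 x sobj by auto
    with 6(1,2) have "(id_arr K E X \<otimes>\<^bsub>K\<^esub> (P, f, ehom E X Y)) \<cdot>\<^bsub>K\<^esub> comp_arr K E X X Y = (P, f, ehom E X Y)"
      using id_ten_comp_arr[of X Y "(P, f, ehom E X Y)"] by (simp add: strict del: triple_ops)
    then show ?case by (auto simp: x slice_mult_def comp_arr_def id_arr_def)
  next
    case (7 X Y x x' \<phi>)
    obtain P f P' f' where x: "x = (P, f)" and x': "x' = (P', f')" by (metis surj_pair)
    have "P \<in> U" "P' \<in> U" "arr K (P, \<phi>, P')" using 7 x x' sobj shom by auto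
    then have "one K (munit K) \<otimes>\<^bsub>K\<^esub> (P, \<phi>, P') = (P, \<phi>, P')"
      by (intro V.strict_unit_ten[OF U]) simp_all
    then show ?case by (simp add: x x' slice_mult_def slice_def one_def)
  next
    case (8 X Y x)
    obtain P f where x: "x = (P, f)" by fastforce
    have "arr K (P, f, ehom E X Y)" "P \<in> U" using 8 x sobj by auto
    with 8(1,2) have "((P, f, ehom E X Y) \<otimes>\<^bsub>K\<^esub> id_arr K E Y) \<cdot>\<^bsub>K\<^esub> comp_arr K E X Y Y = (P, f, ehom E X Y)"
      using ten_id_comp_arr[of X Y "(P, f, ehom E X Y)"] by (simp add: strict del: triple_ops)
    then show ?case by (auto simp: x slice_mult_def comp_arr_def id_arr_def)
  next
    case (9 X Y x x' \<phi>)
    obtain P f P' f' where x: "x = (P, f)" and x': "x' = (P', f')" by (metis surj_pair)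
    have "P \<in> U" "P' \<in> U" "arr K (P, \<phi>, P')" using 9 x x' sobj shom by auto
    then have "(P, \<phi>, P') \<otimes>\<^bsub>K\<^esub> one K (munit K) = (P, \<phi>, P')"
      by (intro V.strict_unit_ten[OF U]) simp_all
    then show ?case by (simp add: x x' slice_mult_def slice_def one_def)
  qed
qed

text \<open>
  Change of base along \<open>L\<^sub>M\<close>. As \<open>L\<^sub>M\<close> is strict monoidal, its structure maps are identities and do not appear.
\<close>

definition kleisli_ecat :: "('w, 'n, 'y) moncat_scheme \<Rightarrow> ('w, 'n) monad \<Rightarrow> ('a, 'w, 'n) ecat \<Rightarrow> ('a, 'w, 'n) ecat" where
  "kleisli_ecat W M D =
    \<lparr>eobj = eobj D, ehom = ehom D,
     ecomp = (\<lambda>X Y Z. kl_lift W M (tenO W (ehom D X Y) (ehom D Y Z)) (ehom D X Z) (ecomp D X Y Z)),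
     eid = (\<lambda>X. kl_lift W M (munit W) (ehom D X X) (eid D X))\<rparr>"

lemma (in symmetric_monoidal_monad) kleisli_enriched:
  assumes "enriched_category W D"
  shows "enriched_category (kleisli W M) (kleisli_ecat W M D)"
proof -
  interpret D: enriched_category W D by fact
  let ?E = "kleisli_ecat W M D"
  have obj [simp]: "eobj ?E = eobj D" "ehom ?E = ehom D" by (simp_all add: kleisli_ecat_def)
  have comp [simp]: "comp_arr (kleisli W M) ?E X Y Z = lift_arr W M (comp_arr W D X Y Z)" for X Y Z
    by (simp add: kleisli_ecat_def comp_arr_def lift_arr_def)
  have id [simp]: "id_arr (kleisli W M) ?E X = lift_arr W M (id_arr W D X)" for X
    by (simp add: kleisli_ecat_def id_arr_def lift_arr_def)
  show ?thesis
  proof (rule enriched_category_arrI, goal_cases)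
    case 1 show ?case by unfold_locales
  qed (simp_all add: D.comp_arr_assoc D.id_comp_arr D.comp_id_arr flip: lift_seq lift_ten lift_one)
qed

lemma (in symmetric_monoidal_monad) full_strict_kleisli:
  assumes U: "full_strict_monoidal_subcategory W U"
  shows "full_strict_monoidal_subcategory (kleisli W M) U"
proof -
  have "lift_arr W M (one W A) = one (kleisli W M) A" if "A \<in> obj W" for A
    using that by (rule lift_one)
  then have "kl_lift W M A A (idn W A) = eta M A" if "A \<in> obj W" for A
    using that by (simp add: lift_arr_def one_def kleisli_def)
  then show ?thesis using U unfolding full_strict_monoidal_subcategory_def
    by (auto simp: kleisli_def subset_iff)
qed

lemma param_twocat_eq:
  "param_twocat V W M F U C = slice_twocat (kleisli W M) U (kleisli_ecat W M (change_base V W F C))"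
  by (simp add: param_twocat_def slice_twocat_def kleisli_ecat_def change_base_def
      slice_binary_def slice_mult_def slice_nullary_def)

section \<open>The inclusion of the underlying category\<close>

lemma discrete_category: "category (discrete_cat A)"
  by unfold_locales (auto simp: discrete_cat_def split: if_splits)

lemma discrete_functor:
  assumes "category D" and "\<And>x. x \<in> A \<Longrightarrow> f x \<in> obj D" and "\<And>x. x \<in> A \<Longrightarrow> idn D (f x) = e"
  shows "cat_functor (discrete_cat A) D \<lparr>fobj = f, farr = \<lambda>_ _ _. e\<rparr>"
proof -
  interpret A: category "discrete_cat A" by (rule discrete_category)
  interpret D: category D by fact
  have "e \<in> hom D (f x) (f x)" "cmp D (f x) (f x) (f x) e e = e" if "x \<in> A" for x
    using assms(2,3)[OF that] D.idn_hom[of "f x"] D.idn_cmp[of "f x" "f x" e] by simp_all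
  then show ?thesis using assms(2,3)
    by unfold_locales (auto simp: discrete_cat_def split: if_splits)
qed

lemma locally_discrete_two_category:
  assumes "category C"
  shows "two_category (locally_discrete C)"
proof -
  interpret category C by fact
  have func: "cat_functor (prod_cat (discrete_cat A) (discrete_cat B)) (discrete_cat D) \<lparr>fobj = f, farr = \<lambda>_ _ _. ()\<rparr>"
    if "f ` (A \<times> B) \<subseteq> D" for A B D and f :: "'b \<times> 'b \<Rightarrow> 'b"
  proof -
    interpret P: category "prod_cat (discrete_cat A) (discrete_cat B)" by (intro prod_category discrete_category)
    interpret D: category "discrete_cat D" by (rule discrete_category)
    show ?thesis using that by unfold_locales (auto simp: discrete_cat_def prod_cat_def split: if_splits)
  qed
  show ?thesis
  proof (rule two_category.intro, unfold locally_discrete_def twocat.simps, goal_cases)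
    case 1 show ?case by (rule discrete_category)
  next
    case 3 then show ?case by (intro func) (auto intro: cmp_hom)
  qed (auto split: if_splits simp: discrete_cat_def idn_hom cmp_assoc idn_cmp cmp_idn)
qed


definition param_inclusion :: "('v, 'm, 'x) moncat_scheme \<Rightarrow> ('w, 'n, 'y) smc_scheme \<Rightarrow> ('w, 'n) monad
    \<Rightarrow> ('v, 'm, 'w, 'n) laxfunc \<Rightarrow> ('a, 'v, 'm) ecat \<Rightarrow> ('a, 'm, unit, 'a, 'w \<times> 'n, 'n) twofunc" where
  "param_inclusion V W M F C =
    \<lparr>tfobj = (\<lambda>X. X),
     tfhom = (\<lambda>X Y. \<lparr>fobj = slice_nullary V W M F (ehom C X Y), farr = (\<lambda>_ _ _. eta M (munit W))\<rparr>)\<rparr>"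

lemma slice_nullary_arr:
  "slice_nullary V W M F A x
    = (munit W, mor (lift_arr W M (eps_arr V W F \<cdot>\<^bsub>W\<^esub> fmap F (munit V, x, A))))"
  by (simp add: slice_nullary_def lax_nullary_def lift_arr_def eps_arr_def fmap_def)

text \<open>
  The image of a convolution is the composite, or product, of the images. The splitting of \<open>I\<close> in \<open>\<W>\<close> disappears since it is
  inverse to \<open>l\<^sub>I\<close>, an identity by strictness of \<open>\<U>\<close>; for the same reason the parameter object \<open>I \<otimes> I\<close> on the left-hand
  side is the object \<open>I\<close> on the right.
\<close>

lemma slice_binary_nullary:
  fixes F :: "('v, 'm, 'w, 'n) laxfunc" and W :: "('w, 'n) smc"
  assumes "symmetric_monoidal_monad W M" and "lax_monoidal_functor V W F"
    and U: "full_strict_monoidal_subcategory W U"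
    and f: "arr V (munit V, f, A)" and g: "arr V (munit V, g, B)" and h: "arr V (tenO V A B, h, D)"
  shows "fobj (slice_binary V W M F A B D h) (slice_nullary V W M F A f, slice_nullary V W M F B g)
    = slice_nullary V W M F D (cmp V (munit V) (tenO V (munit V) (munit V)) D (unit_split V)
        (cmp V (tenO V (munit V) (munit V)) (tenO V A B) D (tenA V (munit V) A (munit V) B f g) h))"
proof -
  interpret M: symmetric_monoidal_monad W M by fact
  interpret F: lax_monoidal_functor V W F by fact
  let ?f = "(munit V, f, A)" and ?g = "(munit V, g, B)" and ?h = "(tenO V A B, h, D)"
  let ?n = "\<lambda>x. eps_arr V W F \<cdot>\<^bsub>W\<^esub> fmap F x" and ?l = "lift_arr W M"
  have arr: "arr W (?n ?f)" "arr W (?n ?g)" "arr W (mul_arr V W F A B \<cdot>\<^bsub>W\<^esub> fmap F ?h)"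
    and obj: "A \<in> obj V" "B \<in> obj V"
    using f g h by (auto simp: arr_triple intro!: M.V.arr_seq F.arr_fmap F.arr_mul F.arr_eps)
  have II: "tenO W (munit W) (munit W) = munit W"
    using full_strict_equations(2)[OF U] full_strict_closed(1)[OF U] by simp
  have "(?n ?f \<otimes>\<^bsub>W\<^esub> ?n ?g) \<cdot>\<^bsub>W\<^esub> mul_arr V W F A B \<cdot>\<^bsub>W\<^esub> fmap F ?h
      = ?n (unit_split_arr V \<cdot>\<^bsub>V\<^esub> (?f \<otimes>\<^bsub>V\<^esub> ?g) \<cdot>\<^bsub>V\<^esub> ?h)"
    using F.lax_convolution[of ?f ?g ?h] f g h arr obj
    by (simp add: M.V.strict_unit_split[OF U] II del: triple_ops)
  then have "(?l (?n ?f) \<otimes>\<^bsub>kleisli W M\<^esub> ?l (?n ?g)) \<cdot>\<^bsub>kleisli W M\<^esub> ?l (mul_arr V W F A B \<cdot>\<^bsub>W\<^esub> fmap F ?h)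
      = ?l (?n (unit_split_arr V \<cdot>\<^bsub>V\<^esub> (?f \<otimes>\<^bsub>V\<^esub> ?g) \<cdot>\<^bsub>V\<^esub> ?h))"
    using arr by (simp add: II del: triple_ops flip: M.lift_seq M.lift_ten)
  then show ?thesis
    by (simp add: slice_binary_def slice_nullary_def lax_nullary_def lax_binary_def lift_arr_def
        eps_arr_def mul_arr_def fmap_def unit_split_arr_def II)
qed

theorem proposition3p14:
  fixes V :: "('v, 'm) smc" and W :: "('w, 'n) smc" and M :: "('w, 'n) monad"
    and F :: "('v, 'm, 'w, 'n) laxfunc" and U :: "'w set" and C :: "('a, 'v, 'm) ecat"
  assumes "symmetric_monoidal_category V"
    and "symmetric_monoidal_category W"
    and "symmetric_monoidal_monad W M"
    and "symmetric_monoidal_functor V W F"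
    and "full_strict_monoidal_subcategory W U"
    and "enriched_category V C"
  shows "\<exists>\<iota> :: ('a, 'm, unit, 'a, 'w \<times> 'n, 'n) twofunc.
      two_functor (locally_discrete (underlying V C)) (param_twocat V W M F U C) \<iota> \<and>
      identity_on_objects (locally_discrete (underlying V C)) (param_twocat V W M F U C) \<iota> \<and>
      (\<forall>S :: ('a, 'm) emon. monoidal_enriched_category V C S \<longrightarrow>
        strictly_preserves_monoidal (locally_discrete (underlying V C))
          (locally_discrete_mon (underlying_mon V C S)) (param_twomon V W M F C S) \<iota>) \<and>
      (\<forall>S :: ('a, 'm) esmon. symmetric_monoidal_enriched_category V C S \<longrightarrow>
        strictly_preserves_symmetric_monoidal (locally_discrete (underlying V C))
          (locally_discrete_smon (underlying_smon V C S)) (param_twosmon V W M F C S) \<iota>) \<and>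
      (faithful (underlying V C) (change_base_underlying V W F C) \<and>
       (\<forall>X\<in>eobj C. \<forall>Y\<in>eobj C.
          inj_on (\<lambda>x. cmp W (munit W) (fobj F (ehom C X Y)) (fobj M (fobj F (ehom C X Y))) x
                        (eta M (fobj F (ehom C X Y))))
            (hom W (munit W) (fobj F (ehom C X Y)))) \<longrightarrow>
       two_faithful (locally_discrete (underlying V C)) \<iota>)"
proof -
  interpret V: symmetric_monoidal_category V by fact
  interpret M: symmetric_monoidal_monad W M by fact
  interpret F: symmetric_monoidal_functor V W F by fact
  interpret C: enriched_category V C by fact
  note U = assms(5)
  let ?\<iota> = "param_inclusion V W M F C"
  have lax: "lax_monoidal_functor V W F" by unfold_locales
  have UK: "full_strict_monoidal_subcategory (kleisli W M) U" using U by (rule M.full_strict_kleisli)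
  have I: "munit W \<in> U" and II: "tenO W (munit W) (munit W) = munit W"
    using full_strict_equations(2)[OF U] full_strict_closed(1)[OF U] by simp_all
  have comp1: "fobj (slice_binary V W M F A B D h) (slice_nullary V W M F A f, slice_nullary V W M F B g)
      = slice_nullary V W M F D (cmp V (munit V) (tenO V (munit V) (munit V)) D (unit_split V)
          (cmp V (tenO V (munit V) (munit V)) (tenO V A B) D (tenA V (munit V) A (munit V) B f g) h))"
    if "A \<in> obj V" "B \<in> obj V" "D \<in> obj V" "f \<in> hom V (munit V) A" "g \<in> hom V (munit V) B" "h \<in> hom V (tenO V A B) D"
    for A B D f g h
    using that by (intro slice_binary_nullary[OF assms(3) lax U]) (simp_all add: arr_triple)
  \<comment> \<open>Products of identity 2-cells: \<open>\<eta>\<^sub>I \<otimes> \<eta>\<^sub>I\<close> is the identity of \<open>I \<otimes> I = I\<close>.\<close>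
  have comp2: "farr (slice_binary V W M F A B D h) (slice_nullary V W M F A f, slice_nullary V W M F B g)
      (slice_nullary V W M F A f', slice_nullary V W M F B g') (eta M (munit W), eta M (munit W)) = eta M (munit W)"
    for A B D f f' g g' h
    using M.Kl.tenA_idn[of "munit W" "munit W"] II
    by (simp add: slice_binary_def slice_nullary_def) (simp add: kleisli_def)
  interpret S: two_category "locally_discrete (underlying V C)"
    by (intro locally_discrete_two_category C.underlying_category)
  interpret T: two_category "param_twocat V W M F U C"
    unfolding param_twocat_eq
    by (intro slice_two_category M.kleisli_enriched change_base_enriched UK lax assms(6))
  have slice: "slice_nullary V W M F A f \<in> obj (slice (kleisli W M) U (fobj F A))"
    if "A \<in> obj V" "f \<in> hom V (munit V) A" for A f
  proof -
    have "arr W (eps_arr V W F \<cdot>\<^bsub>W\<^esub> fmap F (munit V, f, A))"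
      using that by (intro M.V.arr_seq F.arr_eps F.arr_fmap) (simp_all add: arr_triple)
    from M.arr_lift[OF this] show ?thesis
      unfolding slice_nullary_arr by (simp add: slice_def I arr_def)
  qed
  have two_functor: "two_functor (locally_discrete (underlying V C)) (param_twocat V W M F U C) ?\<iota>"
  proof (intro two_functor.intro two_functor_axioms.intro S.two_category_axioms T.two_category_axioms, goal_cases)
    case (2 X Y)
    then have obj: "ehom C X Y \<in> obj V" and XY: "X \<in> eobj C" "Y \<in> eobj C"
      by (simp_all add: locally_discrete_def underlying_def)
    have "category (thom (param_twocat V W M F U C) X Y)"
      by (rule T.thom_category) (simp_all add: param_twocat_def XY)
    then have "cat_functor (discrete_cat (hom V (munit V) (ehom C X Y))) (thom (param_twocat V W M F U C) X Y) (tfhom ?\<iota> X Y)"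
      unfolding param_inclusion_def twofunc.simps using slice[OF obj]
      by (intro discrete_functor) (simp_all add: param_twocat_def slice_def slice_nullary_def kleisli_def)
    then show ?case by (simp add: locally_discrete_def underlying_def param_inclusion_def)
  qed (auto simp: param_inclusion_def param_twocat_def locally_discrete_def underlying_def discrete_cat_def
      comp1 comp2 C.ecomp_hom)
  have monoidal: "strictly_preserves_monoidal (locally_discrete (underlying V C))
      (locally_discrete_mon (underlying_mon V C S)) (param_twomon V W M F C S) ?\<iota>"
    if "monoidal_enriched_category V C S" for S :: "('a, 'm, 'z) emon_scheme"
  proof -
    interpret S: monoidal_enriched_category V C S by fact
    have ten: "A1 \<in> eobj C \<Longrightarrow> A2 \<in> eobj C \<Longrightarrow> etenO S A1 A2 \<in> eobj C" for A1 A2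
      using S.ten.efobj_obj[of "(A1, A2)"] by (simp add: eprod_def ef_ten_def)
    have tenA: "\<lbrakk>A1 \<in> eobj C; A2 \<in> eobj C; B1 \<in> eobj C; B2 \<in> eobj C\<rbrakk>
      \<Longrightarrow> etenA S A1 B1 A2 B2 \<in> hom V (tenO V (ehom C A1 B1) (ehom C A2 B2)) (ehom C (etenO S A1 A2) (etenO S B1 B2))" for A1 A2 B1 B2
      using S.ten.efarr_hom[of "(A1, A2)" "(B1, B2)"] by (simp add: eprod_def ef_ten_def)
    show ?thesis
      unfolding strictly_preserves_monoidal_def
      by (auto simp: param_inclusion_def param_twomon_def locally_discrete_def locally_discrete_mon_def
          underlying_def underlying_mon_def discrete_cat_def comp1 comp2 ten tenA)
  qed
  have symmetric: "strictly_preserves_symmetric_monoidal (locally_discrete (underlying V C))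
      (locally_discrete_smon (underlying_smon V C S)) (param_twosmon V W M F C S) ?\<iota>"
    if "symmetric_monoidal_enriched_category V C S" for S :: "('a, 'm) esmon"
  proof -
    have "monoidal_enriched_category V C S"
      using that by (simp add: symmetric_monoidal_enriched_category_def)
    from monoidal[OF this] show ?thesis
      unfolding strictly_preserves_symmetric_monoidal_def strictly_preserves_monoidal_def
      by (simp add: locally_discrete_smon_def locally_discrete_mon_def underlying_smon_def param_twosmon_def underlying_mon_def
          twomon.defs moncat.defs param_twomon_def param_inclusion_def)
  qed
  have faith: "two_faithful (locally_discrete (underlying V C)) ?\<iota>"
    if F: "faithful (underlying V C) (change_base_underlying V W F C)"
      and eta: "\<forall>X\<in>eobj C. \<forall>Y\<in>eobj C.
        inj_on (\<lambda>x. cmp W (munit W) (fobj F (ehom C X Y)) (fobj M (fobj F (ehom C X Y))) x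
                        (eta M (fobj F (ehom C X Y))))
            (hom W (munit W) (fobj F (ehom C X Y)))"
    unfolding two_faithful_def
  proof (intro ballI conjI)
    fix X Y assume "X \<in> tobj (locally_discrete (underlying V C))" "Y \<in> tobj (locally_discrete (underlying V C))"
    then have XY: "X \<in> eobj C" "Y \<in> eobj C" by (simp_all add: locally_discrete_def underlying_def)
    have hom: "lax_nullary V W F (ehom C X Y) f \<in> hom W (munit W) (fobj F (ehom C X Y))"
      if "f \<in> hom V (munit V) (ehom C X Y)" for f
      using that XY M.V.arr_seq[of "eps_arr V W F" "fmap F (munit V, f, ehom C X Y)"]
        F.arr_eps F.arr_fmap[of "(munit V, f, ehom C X Y)"]
      by (simp add: arr_triple eps_arr_def fmap_def lax_nullary_def)
    show "inj_on (fobj (tfhom ?\<iota> X Y)) (obj (thom (locally_discrete (underlying V C)) X Y))"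
    proof (rule inj_onI)
      fix f g
      assume f: "f \<in> obj (thom (locally_discrete (underlying V C)) X Y)"
        and g: "g \<in> obj (thom (locally_discrete (underlying V C)) X Y)"
        and eq: "fobj (tfhom ?\<iota> X Y) f = fobj (tfhom ?\<iota> X Y) g"
      have f': "f \<in> hom V (munit V) (ehom C X Y)" and g': "g \<in> hom V (munit V) (ehom C X Y)"
        using f g by (simp_all add: locally_discrete_def discrete_cat_def underlying_def)
      \<comment> \<open>First cancel \<open>\<eta>\<close>, then use that \<open>F\<^sub>*\<^sup>0\<close> is faithful.\<close>
      have "lax_nullary V W F (ehom C X Y) f = lax_nullary V W F (ehom C X Y) g"
        by (rule inj_onD[OF eta[rule_format, OF XY] _ hom[OF f'] hom[OF g']])
          (use eq in \<open>simp add: param_inclusion_def slice_nullary_def kl_lift_def\<close>)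
      then show "f = g"
        using F XY f' g' by (auto simp: faithful_def underlying_def change_base_underlying_def dest: inj_onD)
    qed
    show "faithful (thom (locally_discrete (underlying V C)) X Y) (tfhom ?\<iota> X Y)"
      by (simp add: faithful_def inj_on_def)
  qed
  have "identity_on_objects (locally_discrete (underlying V C)) (param_twocat V W M F U C) ?\<iota>"
    by (simp add: identity_on_objects_def locally_discrete_def underlying_def param_twocat_def param_inclusion_def)
  then show ?thesis
    using two_functor monoidal symmetric faith by blast
qed

end
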